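(* Let $n\in\mathbb N$ and $r\in(0,+\infty]$, and let $q\in\mathbb C\setminus\{0\}$. (i) If $n\ge 2$, $r<\infty$, and $|q|=1$, then the Fréchet algebras $\mathcal O_q(\mathbb D^n_r)$ and $\mathcal O_q(\mathbb B^n_r)$ are not topologically isomorphic. (ii) If $|q|\ne 1$, then $\mathcal O_q(\mathbb D^n_r)$ and $\mathcal O_q(\mathbb B^n_r)$ are topologically isomorphic; in fact, they are equal as power series algebras (i.e., they consist of the same formal series $\sum_{k} c_k x^k$, with the same multiplication and the same topology).
   Context: All algebras are complex, associative and unital, and homomorphisms are unital. Two topological algebras are topologically isomorphic if there is an algebra isomorphism between them that is a homeomorphism. A Fréchet algebra is a complete metrizable locally convex algebra. $\mathbb Z_+=\{0,1,2,\dots\}$. For $k=(k_1,\dots,k_n)\in\mathbb Z_+^n$ put $|k|=k_1+\cdots+k_n$ and $x^k=x_1^{k_1}\cdots x_n^{k_n}$. For $q\in\mathbb C\setminus\{0\}$ define $w_q(k)=1$ if $|q|\ge 1$, and $w_q(k)=|q|^{\sum_{i<j}k_ik_j}$ if $|q|<1$. Quantum polydisk: for $r\in(0,+\infty]$, $$\mathcal O_q(\mathbb D^n_r)=\Bigl\{a=\sum_{k\in\mathbb Z_+^n}c_kx^k : \|a\|_\rho=\sum_{k}|c_k|\,w_q(k)\,\rho^{|k|}<\infty\ \ \forall\rho\in(0,r)\Bigr\},$$ the set of formal series with complex coefficients $c_k$, topologized by the norms $\|\cdot\|_\rho$ ($0<\rho<r$). For $t>0$ and $m\in\mathbb N$,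 $[m]_t=1+t+\cdots+t^{m-1}$, $[m]_t!=[1]_t[2]_t\cdots[m]_t$, $[0]_t!=1$, and $[k]_t!=[k_1]_t!\cdots[k_n]_t!$ for $k\in\mathbb Z_+^n$. Quantum ball: for $r\in(0,+\infty]$, $$\mathcal O_q(\mathbb B^n_r)=\Bigl\{a=\sum_{k\in\mathbb Z_+^n}c_kx^k : \|a\|_\rho=\sum_{k}|c_k|\Bigl(\frac{[k]_{|q|^{-2}}!}{[\,|k|\,]_{|q|^{-2}}!}\Bigr)^{1/2}\rho^{|k|}<\infty\ \ \forall\rho\in(0,r)\Bigr\},$$ topologized by these norms $\|\cdot\|_\rho$ ($0<\rho<r$). Both are Fréchet algebras with respect to the (unique) continuous multiplication determined by $x_ix_j=q\,x_jx_i$ for $i<j$. *)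

theory Defs
  imports "HOL-Analysis.Analysis" "HOL-Algebra.Module" "HOL-Algebra.QuotRing"
begin

section \<open>Topological algebras\<close>

record 'a top_algebra = "(complex, 'a) module" +
  top_of :: "'a topology"

text \<open>
  \<open>ring_iso\<close> consists of the bijective unital ring homomorphisms; together with
  complex homogeneity this gives the isomorphisms of unital complex algebras.
\<close>

definition top_isomorphic :: "'a top_algebra \<Rightarrow> 'b top_algebra \<Rightarrow> bool" where
  "top_isomorphic A B \<longleftrightarrow>
     (\<exists>f \<in> ring_iso A B.
        (\<forall>c. \<forall>a \<in> carrier A. f (c \<odot>\<^bsub>A\<^esub> a) = c \<odot>\<^bsub>B\<^esub> f a) \<and>
        homeomorphic_map (top_of A) (top_of B) f)"

section \<open>Multi-indices and formal power series\<close>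

text \<open>
  The variables are indexed by \<open>0, \<dots>, n - 1\<close>.  A multi-index is a function on \<open>nat\<close> that
  vanishes outside \<open>{..<n}\<close>, and a formal series \<open>\<Sum>k. c k x^k\<close> is its coefficient function,
  extended by 0 to functions that are not multi-indices.
\<close>

type_synonym mindex = "nat \<Rightarrow> nat"
type_synonym series = "mindex \<Rightarrow> complex"

definition mindices :: "nat \<Rightarrow> mindex set" where
  "mindices n = {k. \<forall>i\<ge>n. k i = 0}"

definition mdeg :: "nat \<Rightarrow> mindex \<Rightarrow> nat" where
  "mdeg n k = (\<Sum>i<n. k i)"

definition monom_ser :: "mindex \<Rightarrow> series" where
  "monom_ser k = (\<lambda>m. if m = k then 1 else 0)"

definition gen_ser :: "nat \<Rightarrow> series" where
  "gen_ser i = monom_ser ((\<lambda>_. 0)(i := 1))"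

text \<open>
  Moving the factor \<open>x_j\<close> of \<open>x^k\<close> to the right past the factor \<open>x_i\<close> of \<open>x^l\<close>, where
  \<open>i < j\<close>, contributes the factor \<open>1/q\<close>, because \<open>x_i x_j = q x_j x_i\<close>.  Hence
  \<open>x^k x^l = q^(-e) x^(k + l)\<close> with \<open>e = \<Sum>i<j. k_j l_i\<close>.  Extending this bilinearly and
  continuously gives the multiplication of series below; in it \<open>k \<le> m\<close> and \<open>m - k\<close> are
  understood componentwise, so that the sum is finite for every multi-index \<open>m\<close>.
\<close>

definition q_twist :: "nat \<Rightarrow> mindex \<Rightarrow> mindex \<Rightarrow> nat" where
  "q_twist n k l = (\<Sum>j<n. \<Sum>i<j. k j * l i)"

definition q_mult :: "nat \<Rightarrow> complex \<Rightarrow> series \<Rightarrow> series \<Rightarrow> series" where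
  "q_mult n q a b =
     (\<lambda>m. \<Sum>k\<in>{..m}. inverse q ^ q_twist n k (m - k) * a k * b (m - k))"

section \<open>Power series algebras defined by a weight\<close>

definition wt_norm :: "nat \<Rightarrow> (mindex \<Rightarrow> real) \<Rightarrow> real \<Rightarrow> series \<Rightarrow> real" where
  "wt_norm n w \<rho> a = (\<Sum>\<^sub>\<infinity>k\<in>mindices n. cmod (a k) * w k * \<rho> ^ mdeg n k)"

definition wt_series :: "nat \<Rightarrow> (mindex \<Rightarrow> real) \<Rightarrow> ereal \<Rightarrow> series set" where
  "wt_series n w r =
     {a. (\<forall>k. k \<notin> mindices n \<longrightarrow> a k = 0) \<and>
         (\<forall>\<rho>>0. ereal \<rho> < r \<longrightarrow>
            (\<lambda>k. cmod (a k) * w k * \<rho> ^ mdeg n k) summable_on mindices n)}"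

definition wt_topology :: "nat \<Rightarrow> (mindex \<Rightarrow> real) \<Rightarrow> ereal \<Rightarrow> series topology" where
  "wt_topology n w r = topology_generated_by
     {{b \<in> wt_series n w r. wt_norm n w \<rho> (\<lambda>k. b k - a k) < \<epsilon>} | a \<rho> \<epsilon>.
        a \<in> wt_series n w r \<and> 0 < \<rho> \<and> ereal \<rho> < r \<and> 0 < \<epsilon>}"

definition wt_algebra ::
    "nat \<Rightarrow> complex \<Rightarrow> (mindex \<Rightarrow> real) \<Rightarrow> ereal \<Rightarrow> series top_algebra" where
  "wt_algebra n q w r =
     \<lparr>carrier = wt_series n w r,
      mult = q_mult n q,
      one = monom_ser (\<lambda>_. 0),
      zero = (\<lambda>_. 0),
      add = (\<lambda>a b k. a k + b k),
      smult = (\<lambda>c a k. c * a k),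
      top_of = wt_topology n w r\<rparr>"

section \<open>The quantum polydisk and the quantum ball\<close>

definition polydisk_wt :: "nat \<Rightarrow> complex \<Rightarrow> mindex \<Rightarrow> real" where
  "polydisk_wt n q k =
     (if cmod q \<ge> 1 then 1 else cmod q ^ (\<Sum>j<n. \<Sum>i<j. k i * k j))"

definition q_polydisk :: "nat \<Rightarrow> complex \<Rightarrow> ereal \<Rightarrow> series top_algebra" where
  "q_polydisk n q r = wt_algebra n q (polydisk_wt n q) r"

definition t_int :: "real \<Rightarrow> nat \<Rightarrow> real" where
  "t_int t m = (\<Sum>i<m. t ^ i)"

definition t_fact :: "real \<Rightarrow> nat \<Rightarrow> real" where
  "t_fact t m = (\<Prod>j=1..m. t_int t j)"

definition t_mfact :: "nat \<Rightarrow> real \<Rightarrow> mindex \<Rightarrow> real" where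
  "t_mfact n t k = (\<Prod>i<n. t_fact t (k i))"

definition ball_wt :: "nat \<Rightarrow> complex \<Rightarrow> mindex \<Rightarrow> real" where
  "ball_wt n q k =
     (let t = cmod q powi (-2) in sqrt (t_mfact n t k / t_fact t (mdeg n k)))"

definition q_ball :: "nat \<Rightarrow> complex \<Rightarrow> ereal \<Rightarrow> series top_algebra" where
  "q_ball n q r = wt_algebra n q (ball_wt n q) r"

section \<open>The multiplication satisfies the defining relations\<close>

lemma mindices_zero: "(\<lambda>_. 0) \<in> mindices n"
  by (simp add: mindices_def)

lemma mindices_add: "k \<in> mindices n \<Longrightarrow> l \<in> mindices n \<Longrightarrow> (\<lambda>i. k i + l i) \<in> mindices n"
  by (simp add: mindices_def)

lemma mindices_le:
  assumes "m \<in> mindices n" "k \<le> m" shows "k \<in> mindices n"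
  unfolding mindices_def
proof (intro CollectI allI impI)
  fix i assume "n \<le> i"
  then have "m i = 0" using assms(1) by (simp add: mindices_def)
  with le_funD[OF assms(2), of i] show "k i = 0" by simp
qed

lemma finite_below:
  assumes "m \<in> mindices n" shows "finite {..m::mindex}"
proof (rule finite_subset)
  have fin: "finite (PiE {..<n} (\<lambda>i. {..m i}))" by (intro finite_PiE) auto
  show "finite ((\<lambda>g i. if i < n then g i else 0) ` PiE {..<n} (\<lambda>i. {..m i}))"
    using fin by (rule finite_imageI)
  show "{..m} \<subseteq> (\<lambda>g i. if i < n then g i else 0) ` PiE {..<n} (\<lambda>i. {..m i})"
  proof
    fix k assume k: "k \<in> {..m}"
    then have "k \<in> mindices n" using assms mindices_le by blast
    then have "k = (\<lambda>i. if i < n then restrict k {..<n} i else 0)"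
      by (auto simp: mindices_def fun_eq_iff)
    moreover have "restrict k {..<n} \<in> PiE {..<n} (\<lambda>i. {..m i})"
      using k by (auto simp: le_fun_def)
    ultimately show "k \<in> (\<lambda>g i. if i < n then g i else 0) ` PiE {..<n} (\<lambda>i. {..m i})"
      by (rule image_eqI)
  qed
qed

lemma q_mult_monom:
  assumes "k \<in> mindices n" "l \<in> mindices n"
  shows "q_mult n q (monom_ser k) (monom_ser l) =
    (\<lambda>m. inverse q ^ q_twist n k l * monom_ser (\<lambda>i. k i + l i) m)"
proof
  fix m
  show "q_mult n q (monom_ser k) (monom_ser l) m =
    inverse q ^ q_twist n k l * monom_ser (\<lambda>i. k i + l i) m"
  proof (cases "m = (\<lambda>i. k i + l i)")
    case True
    have fin: "finite {..m}" using assms True finite_below mindices_add by blast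
    have km: "k \<in> {..m}" and l: "m - k = l" by (auto simp: True le_fun_def fun_eq_iff)
    have "q_mult n q (monom_ser k) (monom_ser l) m =
       (\<Sum>j\<in>{..m}. if j = k then inverse q ^ q_twist n k l else 0)"
      unfolding q_mult_def by (intro sum.cong) (auto simp: monom_ser_def l)
    also have "\<dots> = inverse q ^ q_twist n k l" using fin km by simp
    finally show ?thesis by (simp add: monom_ser_def True)
  next
    case False
    have "inverse q ^ q_twist n j (m - j) * monom_ser k j * monom_ser l (m - j) = 0"
      if "j \<in> {..m}" for j
    proof -
      have "\<not> (j = k \<and> m - j = l)"
      proof
        assume jl: "j = k \<and> m - j = l"
        have "m i = k i + l i" for i
          using jl that by (auto simp: le_fun_def)
        then show False using False by (auto simp: fun_eq_iff)
      qed
      then show ?thesis by (auto simp: monom_ser_def)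
    qed
    then show ?thesis using False
      unfolding q_mult_def monom_ser_def[of "\<lambda>i. k i + l i"] by (simp add: sum.neutral)
  qed
qed

lemma q_mult_gen:
  assumes "i < j" "j < n" "q \<noteq> 0"
  shows "q_mult n q (gen_ser i) (gen_ser j) =
         (\<lambda>m. q * q_mult n q (gen_ser j) (gen_ser i) m)"
proof -
  let ?e = "\<lambda>i. (\<lambda>_. 0)(i := 1) :: mindex"
  have e: "?e i \<in> mindices n" "?e j \<in> mindices n" using assms by (auto simp: mindices_def)
  have t0: "q_twist n (?e i) (?e j) = 0" unfolding q_twist_def using assms
    by (auto intro!: sum.neutral)
  have t1: "q_twist n (?e j) (?e i) = 1"
  proof -
    have "(\<Sum>a<b. ?e j b * ?e i a) = (if b = j then 1 else 0)" for b
    proof (cases "b = j")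
      case True
      then have "(\<Sum>a<b. ?e j b * ?e i a) = (\<Sum>a<b. if a = i then 1 else 0)"
        by (intro sum.cong) auto
      then show ?thesis using True assms by simp
    qed simp
    then show ?thesis unfolding q_twist_def using assms by simp
  qed
  have c: "(\<lambda>a. ?e j a + ?e i a) = (\<lambda>a. ?e i a + ?e j a)" by (simp add: add.commute)
  show ?thesis
    unfolding gen_ser_def q_mult_monom[OF e] q_mult_monom[OF e(2,1)] t0 t1 c
    by (rule ext) (use assms(3) in \<open>simp flip: mult.assoc\<close>)
qed

lemma q_mult_gen_monom:
  assumes "k \<in> mindices n" "i < n" "\<And>j. j < i \<Longrightarrow> k j = 0"
  shows "q_mult n q (gen_ser i) (monom_ser k) = monom_ser (k(i := Suc (k i)))"
proof -
  let ?e = "(\<lambda>_. 0)(i := 1) :: mindex"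
  have e: "?e \<in> mindices n" using assms by (auto simp: mindices_def)
  have t0: "q_twist n ?e k = 0" unfolding q_twist_def using assms
    by (auto intro!: sum.neutral)
  have c: "(\<lambda>a. ?e a + k a) = k(i := Suc (k i))" by (auto simp: fun_eq_iff)
  show ?thesis
    unfolding gen_ser_def q_mult_monom[OF e assms(1)] t0 c by simp
qed

text \<open>The series \<open>monom_ser k\<close> is the ordered product of the powers \<open>x_i^(k_i)\<close>.\<close>

lemma monom_ser_eq_prod:
  assumes k: "k \<in> mindices n"
  shows "foldr (\<lambda>i a. (q_mult n q (gen_ser i) ^^ k i) a) [0..<n] (monom_ser (\<lambda>_. 0)) =
         monom_ser k"
proof -
  have pw: "(q_mult n q (gen_ser i) ^^ p) (monom_ser h) = monom_ser (h(i := p))"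
    if "h \<in> mindices n" "i < n" "\<And>j. j \<le> i \<Longrightarrow> h j = 0" for h i p
  proof (induction p)
    case 0
    then show ?case using that(3)[of i] by (simp add: fun_upd_idem)
  next
    case (Suc p)
    have "h(i := p) \<in> mindices n" using that by (auto simp: mindices_def)
    then have "q_mult n q (gen_ser i) (monom_ser (h(i := p))) =
        monom_ser ((h(i := p))(i := Suc ((h(i := p)) i)))"
      by (rule q_mult_gen_monom) (use that in auto)
    then show ?case by (simp only: funpow.simps comp_apply Suc.IH fun_upd_upd fun_upd_same)
  qed
  have "d \<le> n \<Longrightarrow>
      foldr (\<lambda>i a. (q_mult n q (gen_ser i) ^^ k i) a) [n-d..<n] (monom_ser (\<lambda>_. 0)) =
      monom_ser (\<lambda>i. if i < n - d then 0 else k i)" for d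
  proof (induction d)
    case 0
    have "(\<lambda>i. if i < n then 0 else k i) = (\<lambda>_. 0)"
      using k by (auto simp: mindices_def fun_eq_iff)
    then show ?case by simp
  next
    case (Suc d)
    let ?i = "n - Suc d"
    let ?h = "\<lambda>i. if i < n - d then 0 else k i"
    have S: "Suc ?i = n - d" and "?i < n" using Suc.prems by auto
    have "?h \<in> mindices n" using k by (auto simp: mindices_def)
    then have "(q_mult n q (gen_ser ?i) ^^ k ?i) (monom_ser ?h) = monom_ser (?h(?i := k ?i))"
      by (rule pw) (use S \<open>?i < n\<close> in auto)
    moreover have "?h(?i := k ?i) = (\<lambda>i. if i < ?i then 0 else k i)"
      using S by (auto simp: fun_eq_iff)
    ultimately show ?case using Suc S \<open>?i < n\<close> by (simp add: upt_conv_Cons)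
  qed
  from this[of n] show ?thesis by simp
qed

lemma q_twist_add_left: "q_twist n (\<lambda>i. k i + l i) p = q_twist n k p + q_twist n l p"
  by (simp add: q_twist_def sum.distrib algebra_simps)

lemma q_twist_add_right: "q_twist n k (\<lambda>i. l i + p i) = q_twist n k l + q_twist n k p"
  by (simp add: q_twist_def sum.distrib algebra_simps)

text \<open>Outside the multi-indices the product is 0, because its factors are.\<close>

lemma q_mult_support:
  assumes "\<And>k. k \<notin> mindices n \<Longrightarrow> a k = 0" "\<And>k. k \<notin> mindices n \<Longrightarrow> b k = 0"
    and "m \<notin> mindices n"
  shows "q_mult n q a b m = 0"
proof -
  have "a k = 0 \<or> b (m - k) = 0" if "k \<le> m" for k
  proof (rule ccontr)
    assume "\<not> (a k = 0 \<or> b (m - k) = 0)"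
    then have "k \<in> mindices n" "m - k \<in> mindices n" using assms by blast+
    then have "(\<lambda>i. k i + (m - k) i) \<in> mindices n" by (rule mindices_add)
    moreover have "(\<lambda>i. k i + (m - k) i) = m" using that by (auto simp: le_fun_def fun_eq_iff)
    ultimately show False using assms by simp
  qed
  then show ?thesis unfolding q_mult_def by (intro sum.neutral) auto
qed

lemma q_mult_assoc:
  assumes a: "\<And>k. k \<notin> mindices n \<Longrightarrow> a k = 0"
    and b: "\<And>k. k \<notin> mindices n \<Longrightarrow> b k = 0"
    and c: "\<And>k. k \<notin> mindices n \<Longrightarrow> c k = 0"
  shows "q_mult n q (q_mult n q a b) c = q_mult n q a (q_mult n q b c)"
proof
  fix m
  show "q_mult n q (q_mult n q a b) c m = q_mult n q a (q_mult n q b c) m"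
  proof (cases "m \<in> mindices n")
    case False
    have "q_mult n q (q_mult n q a b) c m = 0"
      by (rule q_mult_support[OF _ _ False]) (auto intro: q_mult_support a b c)
    moreover have "q_mult n q a (q_mult n q b c) m = 0"
      by (rule q_mult_support[OF _ _ False]) (auto intro: q_mult_support a b c)
    ultimately show ?thesis by simp
  next
    case m: True
    define F where "F k l p =
      inverse q ^ (q_twist n k l + q_twist n k p + q_twist n l p) * a k * b l * c p" for k l p
    have fin: "finite {..k}" if "k \<le> m" for k using finite_below mindices_le m that by blast
    have "q_mult n q (q_mult n q a b) c m =
        (\<Sum>s\<in>{..m}. \<Sum>k\<in>{..s}. F k (s - k) (m - s))"
    proof -
      have "inverse q ^ q_twist n s (m - s) * q_mult n q a b s * c (m - s) =
          (\<Sum>k\<in>{..s}. F k (s - k) (m - s))" for s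
      proof -
        have tw: "q_twist n s (m - s) = q_twist n k (m - s) + q_twist n (s - k) (m - s)"
          if "k \<le> s" for k
        proof -
          have "(\<lambda>i. k i + (s - k) i) = s" using that by (auto simp: le_fun_def fun_eq_iff)
          then show ?thesis using q_twist_add_left[of n k "s - k" "m - s"] by simp
        qed
        show ?thesis
          unfolding q_mult_def F_def sum_distrib_left sum_distrib_right
        proof (intro sum.cong refl)
          fix k assume "k \<in> {..s}"
          then have "k \<le> s" by simp
          show "inverse q ^ q_twist n s (m - s) *
                (inverse q ^ q_twist n k (s - k) * a k * b (s - k)) * c (m - s) =
              inverse q ^ (q_twist n k (s - k) + q_twist n k (m - s) + q_twist n (s - k) (m - s)) *
                a k * b (s - k) * c (m - s)"
            unfolding tw[OF \<open>k \<le> s\<close>] power_add by (simp only: mult_ac)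
        qed
      qed
      then show ?thesis unfolding q_mult_def[of n q "q_mult n q a b"] by simp
    qed
    also have "\<dots> = (\<Sum>(s,k)\<in>Sigma {..m} (\<lambda>s. {..s}). F k (s - k) (m - s))"
      by (rule sum.Sigma) (use fin in auto)
    also have "\<dots> = (\<Sum>(k,l)\<in>Sigma {..m} (\<lambda>k. {..m - k}). F k l (m - k - l))"
    proof (rule sum.reindex_bij_witness[of _ "\<lambda>(k,l). (\<lambda>i. k i + l i, k)" "\<lambda>(s,k). (k, s - k)"],
        goal_cases)
      case (1 x)
      obtain s k where x: "x = (s, k)" by (cases x)
      have "k i \<le> s i" for i using 1 le_funD[of k s i] by (simp add: x)
      then show ?case by (simp add: x fun_eq_iff)
    next
      case (2 x)
      obtain s k where x: "x = (s, k)" by (cases x)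
      have "k i \<le> s i" "s i \<le> m i" for i
        using 2 le_funD[of k s i] le_funD[of s m i] by (simp_all add: x)
      then have "k \<le> m" "s - k \<le> m - k"
        by (auto intro!: le_funI diff_le_mono intro: le_trans)
      then show ?case by (simp add: x)
    next
      case (3 x)
      then show ?case by (auto simp: fun_eq_iff)
    next
      case (4 x)
      obtain k l where x: "x = (k, l)" by (cases x)
      have kl: "k i \<le> m i" "l i \<le> m i - k i" for i
        using 4 le_funD[of k m i] le_funD[of l "m - k" i] by (simp_all add: x)
      have "k i + l i \<le> m i" for i using kl[of i] by linarith
      then have "(\<lambda>i. k i + l i) \<le> m" "k \<le> (\<lambda>i. k i + l i)" by (auto intro!: le_funI)
      then show ?case by (simp add: x)
    next
      case (5 x)
      obtain s k where x: "x = (s, k)" by (cases x)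
      have "k i \<le> s i" "s i \<le> m i" for i
        using 5 le_funD[of k s i] le_funD[of s m i] by (simp_all add: x)
      then have "m - k - (s - k) = m - s" by (simp add: fun_eq_iff)
      then show ?case by (simp add: x)
    qed
    also have "\<dots> = (\<Sum>k\<in>{..m}. \<Sum>l\<in>{..m - k}. F k l (m - k - l))"
      by (rule sum.Sigma[symmetric]) (use fin in \<open>auto simp: le_fun_def\<close>)
    also have "\<dots> = q_mult n q a (q_mult n q b c) m"
    proof -
      have "inverse q ^ q_twist n k (m - k) * a k * q_mult n q b c (m - k) =
          (\<Sum>l\<in>{..m - k}. F k l (m - k - l))" for k
      proof -
        have tw: "q_twist n k (m - k) = q_twist n k l + q_twist n k (m - k - l)"
          if "l \<le> m - k" for l
        proof -
          have "(\<lambda>i. l i + (m - k - l) i) = m - k"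
            using le_funD[OF that] by (intro ext) (simp only: minus_apply le_add_diff_inverse)
          then show ?thesis using q_twist_add_right[of n k l "m - k - l"] by simp
        qed
        show ?thesis
          unfolding q_mult_def F_def sum_distrib_left
        proof (intro sum.cong refl)
          fix l assume "l \<in> {..m - k}"
          then have "l \<le> m - k" by simp
          show "inverse q ^ q_twist n k (m - k) * a k *
                (inverse q ^ q_twist n l (m - k - l) * b l * c (m - k - l)) =
              inverse q ^ (q_twist n k l + q_twist n k (m - k - l) + q_twist n l (m - k - l)) *
                a k * b l * c (m - k - l)"
            unfolding tw[OF \<open>l \<le> m - k\<close>] power_add by (simp only: mult_ac)
        qed
      qed
      then show ?thesis unfolding q_mult_def[of n q a] by simp
    qed
    finally show ?thesis .
  qed
qed

end

theory Submission
  imports Defs "HOL-Complex_Analysis.Riemann_Mapping"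
begin

text \<open>
  If \<open>\<bar>q\<bar> \<noteq> 1\<close>, the two weights differ by factors \<open>\<Prod>j. 1 - t^j\<close> with \<open>0 < t < 1\<close>, which are
  bounded away from 0, so the two algebras coincide.

  Let \<open>\<bar>q\<bar> = 1\<close> and let \<open>f\<close> be an isomorphism from the polydisk to the ball algebra, with inverse
  \<open>g\<close>. Bounded functionals are determined by their values on monomials.

  If \<open>q \<noteq> 1\<close>, the relations force the augmentation to be preserved, since it is the only character
  with a space of derivations of dimension \<open>n \<ge> 2\<close>, and force the linear part of \<open>f\<close> to be a monomial
  matrix with entries of modulus at most 1. Then \<open>g\<close> maps \<open>x_s^m x_t^m\<close>, whose norm in the ball algebra is
  exponentially small compared with \<open>\<rho>^(2m)\<close>, to a series whose lowest term has no such decay.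

  If \<open>q = 1\<close>, the bounded characters are the points of the two domains, and \<open>f\<close>, \<open>g\<close> induce mutually
  inverse holomorphic maps. The Schwarz lemma on both sides would make the derivative at the origin
  of the ball a bijection carrying the Euclidean norm to a weighted maximum norm, which
  contradicts the parallelogram law.
\<close>

section \<open>Topologies defined by weights\<close>

text \<open>A continuous isomorphism need not respect the grading, and its estimates lose radius: a
  norm at \<open>\<rho>\<close> is controlled only by a norm at some \<open>\<sigma>\<close> below
  the radius, with an unknown constant. For \<open>q\<close> other than 1 the usable information is
  therefore exponential rates along powers, and a finite radius bounds the possible
  \<open>\<sigma>\<close>. Powers of one generator have the same weight in both algebras and merely
  bound the linear part; products of powers of two distinct generators are the simplest family on
  which the weights differ exponentially. When \<open>q = 1\<close>, the relations no longer single
  out the augmentation, so the centre of the ball may land at any point of the polydisk. It is not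
  moved back. Instead Schwarz-Pick is applied in each coordinate at that point, and its factors
  \<open>conformal_factor\<close> supply the weights of the maximum norm. For |q| < 1 the exponent
  of the polydisk weight is exactly the surplus that appears when t-factorials are rewritten from
  base \<open>1/t\<close> to base \<open>t\<close>.\<close>

locale positive_weight =
  fixes n :: nat and w :: "mindex \<Rightarrow> real" and r :: ereal
  assumes wt_pos: "k \<in> mindices n \<Longrightarrow> 0 < w k"
    and radius_pos: "0 < r"
begin

lemma ex_radius: obtains \<rho> where "0 < \<rho>" "ereal \<rho> < r"
proof -
  obtain \<rho> where "0 < ereal \<rho>" "ereal \<rho> < r"
    using ereal_dense2[OF radius_pos] by auto
  then show ?thesis using that by simp
qed

lemma term_nonneg: "k \<in> mindices n \<Longrightarrow> 0 < \<rho> \<Longrightarrow> 0 \<le> cmod (a k) * w k * \<rho> ^ mdeg n k"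
  using wt_pos[of k] by simp

lemma series_summable:
  "a \<in> wt_series n w r \<Longrightarrow> 0 < \<rho> \<Longrightarrow> ereal \<rho> < r \<Longrightarrow>
    (\<lambda>k. cmod (a k) * w k * \<rho> ^ mdeg n k) summable_on mindices n"
  by (simp add: wt_series_def)

lemma series_support: "a \<in> wt_series n w r \<Longrightarrow> k \<notin> mindices n \<Longrightarrow> a k = 0"
  by (simp add: wt_series_def)

lemma norm_nonneg: "0 < \<rho> \<Longrightarrow> 0 \<le> wt_norm n w \<rho> a"
  unfolding wt_norm_def by (rule infsum_nonneg) (rule term_nonneg)

lemma summable_add:
  assumes "(\<lambda>k. cmod (a k) * w k * \<rho> ^ mdeg n k) summable_on mindices n"
    and "(\<lambda>k. cmod (b k) * w k * \<rho> ^ mdeg n k) summable_on mindices n" and "0 < \<rho>"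
  shows "(\<lambda>k. cmod (a k + b k) * w k * \<rho> ^ mdeg n k) summable_on mindices n"
proof (rule summable_on_comparison_test[OF summable_on_add[OF assms(1,2)]])
  fix k assume k: "k \<in> mindices n"
  have "cmod (a k + b k) * (w k * \<rho> ^ mdeg n k) \<le> (cmod (a k) + cmod (b k)) * (w k * \<rho> ^ mdeg n k)"
    by (rule mult_right_mono[OF norm_triangle_ineq]) (use wt_pos[OF k] assms(3) in simp)
  then show "cmod (a k + b k) * w k * \<rho> ^ mdeg n k \<le>
      cmod (a k) * w k * \<rho> ^ mdeg n k + cmod (b k) * w k * \<rho> ^ mdeg n k"
    by (simp add: algebra_simps)
  show "0 \<le> cmod (a k + b k) * w k * \<rho> ^ mdeg n k"
    by (rule term_nonneg[OF k assms(3)])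
qed

lemma series_add: "a \<in> wt_series n w r \<Longrightarrow> b \<in> wt_series n w r \<Longrightarrow> (\<lambda>k. a k + b k) \<in> wt_series n w r"
  using summable_add unfolding wt_series_def by auto

lemma series_scale: assumes "a \<in> wt_series n w r" shows "(\<lambda>k. c * a k) \<in> wt_series n w r"
proof -
  have "(\<lambda>k. cmod (c * a k) * w k * \<rho> ^ mdeg n k) summable_on mindices n"
    if "0 < \<rho>" "ereal \<rho> < r" for \<rho>
    using summable_on_cmult_right[OF series_summable[OF assms that], of "cmod c"]
    by (simp add: norm_mult mult.assoc)
  then show ?thesis using assms unfolding wt_series_def by auto
qed

lemma series_diff: "a \<in> wt_series n w r \<Longrightarrow> b \<in> wt_series n w r \<Longrightarrow> (\<lambda>k. a k - b k) \<in> wt_series n w r"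
  using series_add[OF _ series_scale[of b "-1"], of a] by simp

lemma series_finite:
  assumes "finite F" "F \<subseteq> mindices n"
  shows "(\<lambda>k. if k \<in> F then a k else 0) \<in> wt_series n w r"
proof -
  have "(\<lambda>k. cmod (if k \<in> F then a k else 0) * w k * \<rho> ^ mdeg n k) summable_on mindices n" for \<rho>
    by (rule summable_on_cong_neutral[THEN iffD1, OF _ _ _ summable_on_finite[OF assms(1)]])
       (use assms in auto)
  then show ?thesis using assms unfolding wt_series_def by auto
qed

lemma series_monom: "k \<in> mindices n \<Longrightarrow> monom_ser k \<in> wt_series n w r"
  using series_finite[of "{k}" "\<lambda>_. 1"] unfolding monom_ser_def by simp

lemma series_gen: "i < n \<Longrightarrow> gen_ser i \<in> wt_series n w r"
  unfolding gen_ser_def by (rule series_monom) (simp add: mindices_def)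

lemma norm_add_le:
  assumes "a \<in> wt_series n w r" "b \<in> wt_series n w r" "0 < \<rho>" "ereal \<rho> < r"
  shows "wt_norm n w \<rho> (\<lambda>k. a k + b k) \<le> wt_norm n w \<rho> a + wt_norm n w \<rho> b"
proof -
  note s = series_summable[OF assms(1,3,4)] series_summable[OF assms(2,3,4)]
  have "wt_norm n w \<rho> (\<lambda>k. a k + b k) \<le>
      (\<Sum>\<^sub>\<infinity>k\<in>mindices n. cmod (a k) * w k * \<rho> ^ mdeg n k + cmod (b k) * w k * \<rho> ^ mdeg n k)"
    unfolding wt_norm_def
  proof (rule infsum_mono)
    show "(\<lambda>k. cmod (a k + b k) * w k * \<rho> ^ mdeg n k) summable_on mindices n"
      by (rule summable_add[OF s assms(3)])
    show "(\<lambda>k. cmod (a k) * w k * \<rho> ^ mdeg n k + cmod (b k) * w k * \<rho> ^ mdeg n k)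
        summable_on mindices n" by (rule summable_on_add[OF s])
    fix k assume k: "k \<in> mindices n"
    have "cmod (a k + b k) * (w k * \<rho> ^ mdeg n k) \<le> (cmod (a k) + cmod (b k)) * (w k * \<rho> ^ mdeg n k)"
      by (rule mult_right_mono[OF norm_triangle_ineq]) (use wt_pos[OF k] assms(3) in simp)
    then show "cmod (a k + b k) * w k * \<rho> ^ mdeg n k \<le>
      cmod (a k) * w k * \<rho> ^ mdeg n k + cmod (b k) * w k * \<rho> ^ mdeg n k"
      by (simp add: algebra_simps)
  qed
  also have "\<dots> = wt_norm n w \<rho> a + wt_norm n w \<rho> b"
    unfolding wt_norm_def by (rule infsum_add[OF s])
  finally show ?thesis .
qed

lemma norm_scale: "wt_norm n w \<rho> (\<lambda>k. c * a k) = cmod c * wt_norm n w \<rho> a"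
  unfolding wt_norm_def by (simp add: norm_mult mult.assoc infsum_cmult_right')

lemma norm_triangle:
  assumes "a \<in> wt_series n w r" "b \<in> wt_series n w r" "c \<in> wt_series n w r" "0 < \<rho>" "ereal \<rho> < r"
  shows "wt_norm n w \<rho> (\<lambda>k. a k - c k) \<le>
    wt_norm n w \<rho> (\<lambda>k. a k - b k) + wt_norm n w \<rho> (\<lambda>k. b k - c k)"
  using norm_add_le[OF series_diff[OF assms(1,2)] series_diff[OF assms(2,3)] assms(4,5)] by simp

lemma norm_mono:
  assumes "a \<in> wt_series n w r" "0 < \<rho>" "\<rho> \<le> \<rho>'" "ereal \<rho>' < r"
  shows "wt_norm n w \<rho> a \<le> wt_norm n w \<rho>' a"
  unfolding wt_norm_def
proof (rule infsum_mono)
  have "ereal \<rho> < r" using assms(3,4) by (meson ereal_less_eq(3) le_less_trans)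
  then show "(\<lambda>k. cmod (a k) * w k * \<rho> ^ mdeg n k) summable_on mindices n"
    by (rule series_summable[OF assms(1,2)])
  show "(\<lambda>k. cmod (a k) * w k * \<rho>' ^ mdeg n k) summable_on mindices n"
    using assms by (intro series_summable) auto
  fix k assume "k \<in> mindices n"
  then show "cmod (a k) * w k * \<rho> ^ mdeg n k \<le> cmod (a k) * w k * \<rho>' ^ mdeg n k"
    using assms wt_pos[of k] by (intro mult_left_mono power_mono) auto
qed

lemma coeff_le_norm:
  assumes "a \<in> wt_series n w r" "0 < \<rho>" "ereal \<rho> < r" "k \<in> mindices n"
  shows "cmod (a k) * w k * \<rho> ^ mdeg n k \<le> wt_norm n w \<rho> a"
proof -
  have "infsum (\<lambda>k. cmod (a k) * w k * \<rho> ^ mdeg n k) {k} \<le> wt_norm n w \<rho> a"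
    unfolding wt_norm_def
    by (rule infsum_mono_neutral[OF _ series_summable[OF assms(1-3)]])
       (use assms(2,4) term_nonneg in auto)
  then show ?thesis by simp
qed

lemma norm_monom:
  assumes "k \<in> mindices n" shows "wt_norm n w \<rho> (monom_ser k) = w k * \<rho> ^ mdeg n k"
proof -
  have "wt_norm n w \<rho> (monom_ser k) =
      infsum (\<lambda>l. cmod (monom_ser k l) * w l * \<rho> ^ mdeg n l) {k}"
    unfolding wt_norm_def by (rule infsum_cong_neutral) (use assms in \<open>auto simp: monom_ser_def\<close>)
  then show ?thesis by (simp add: monom_ser_def)
qed

lemma topspace_wt [simp]: "topspace (wt_topology n w r) = wt_series n w r"
proof -
  obtain \<rho> where \<rho>: "0 < \<rho>" "ereal \<rho> < r" by (rule ex_radius)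
  have "a \<in> {b \<in> wt_series n w r. wt_norm n w \<rho> (\<lambda>k. b k - a k) < 1}" if "a \<in> wt_series n w r" for a
    using that by (simp add: wt_norm_def)
  then show ?thesis unfolding wt_topology_def topology_generated_by_topspace using \<rho> zero_less_one
    by (intro equalityI subsetI) blast+
qed

text \<open>The generating balls form only a subbasis and need not be centred at \<open>a\<close>.
  Recentring is the triangle inequality; in an intersection two radii are replaced by the larger
  one, because the norms increase with the radius, so one norm ball always suffices.\<close>

lemma open_contains_ball:
  assumes "openin (wt_topology n w r) U" "a \<in> U"
  shows "\<exists>\<rho> \<delta>. 0 < \<rho> \<and> ereal \<rho> < r \<and> 0 < \<delta> \<and>
    {b \<in> wt_series n w r. wt_norm n w \<rho> (\<lambda>k. b k - a k) < \<delta>} \<subseteq> U"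
proof -
  have aS: "a \<in> wt_series n w r" using openin_subset[OF assms(1)] assms(2) by auto
  have "generate_topology_on {{b \<in> wt_series n w r. wt_norm n w \<rho> (\<lambda>k. b k - a k) < \<epsilon>} | a \<rho> \<epsilon>.
        a \<in> wt_series n w r \<and> 0 < \<rho> \<and> ereal \<rho> < r \<and> 0 < \<epsilon>} U"
    using assms(1) unfolding wt_topology_def openin_topology_generated_by_iff .
  then show ?thesis using assms(2)
  proof (induction rule: generate_topology_on.induct)
    case (Int U V)
    then obtain \<rho> \<delta> \<rho>' \<delta>' where *: "0 < \<rho>" "ereal \<rho> < r" "0 < \<delta>"
        "{b \<in> wt_series n w r. wt_norm n w \<rho> (\<lambda>k. b k - a k) < \<delta>} \<subseteq> U"
        "0 < \<rho>'" "ereal \<rho>' < r" "0 < \<delta>'"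
        "{b \<in> wt_series n w r. wt_norm n w \<rho>' (\<lambda>k. b k - a k) < \<delta>'} \<subseteq> V"
      by auto
    have le: "wt_norm n w \<sigma> (\<lambda>k. b k - a k) \<le> wt_norm n w (max \<rho> \<rho>') (\<lambda>k. b k - a k)"
      if "b \<in> wt_series n w r" "0 < \<sigma>" "\<sigma> \<le> max \<rho> \<rho>'" for b \<sigma>
      using * by (intro norm_mono series_diff that aS) (auto simp: max_def)
    have "{b \<in> wt_series n w r. wt_norm n w (max \<rho> \<rho>') (\<lambda>k. b k - a k) < min \<delta> \<delta>'} \<subseteq> U \<inter> V"
    proof
      fix b assume "b \<in> {b \<in> wt_series n w r. wt_norm n w (max \<rho> \<rho>') (\<lambda>k. b k - a k) < min \<delta> \<delta>'}"
      then have b: "b \<in> wt_series n w r" "wt_norm n w (max \<rho> \<rho>') (\<lambda>k. b k - a k) < min \<delta> \<delta>'"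
        by auto
      show "b \<in> U \<inter> V" using * le[of b \<rho>] le[of b \<rho>'] b by force
    qed
    moreover have "0 < max \<rho> \<rho>'" "ereal (max \<rho> \<rho>') < r" "0 < min \<delta> \<delta>'"
      using * by (auto simp: max_def)
    ultimately show ?case by blast
  next
    case (UN K)
    then obtain V where V: "V \<in> K" "a \<in> V" by blast
    from UN.IH[OF this] show ?case using V(1) by blast
  next
    case (Basis U)
    then obtain c \<rho> \<epsilon> where U: "U = {b \<in> wt_series n w r. wt_norm n w \<rho> (\<lambda>k. b k - c k) < \<epsilon>}"
      and *: "c \<in> wt_series n w r" "0 < \<rho>" "ereal \<rho> < r" "0 < \<epsilon>" by blast
    have "wt_norm n w \<rho> (\<lambda>k. b k - c k) < \<epsilon>" if "b \<in> wt_series n w r"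
      "wt_norm n w \<rho> (\<lambda>k. b k - a k) < \<epsilon> - wt_norm n w \<rho> (\<lambda>k. a k - c k)" for b
      using norm_triangle[OF that(1) aS *(1-3)] that(2) by linarith
    then have "{b \<in> wt_series n w r. wt_norm n w \<rho> (\<lambda>k. b k - a k) <
        \<epsilon> - wt_norm n w \<rho> (\<lambda>k. a k - c k)} \<subseteq> U" unfolding U by blast
    moreover have "0 < \<epsilon> - wt_norm n w \<rho> (\<lambda>k. a k - c k)" using Basis(2) U by simp
    ultimately show ?case using *(2,3) by blast
  qed auto
qed

end

lemma wt_series_mono:
  assumes "positive_weight n w r" "positive_weight n v r"
    and le: "\<And>k. k \<in> mindices n \<Longrightarrow> v k \<le> C * w k"
  shows "wt_series n w r \<subseteq> wt_series n v r"
proof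
  interpret w: positive_weight n w r by fact
  interpret v: positive_weight n v r by fact
  fix a assume a: "a \<in> wt_series n w r"
  have "(\<lambda>k. cmod (a k) * v k * \<rho> ^ mdeg n k) summable_on mindices n"
    if \<rho>: "0 < \<rho>" "ereal \<rho> < r" for \<rho>
  proof (rule summable_on_comparison_test[OF summable_on_cmult_right[OF w.series_summable[OF a \<rho>], of C]])
    fix k assume k: "k \<in> mindices n"
    have "v k * (cmod (a k) * \<rho> ^ mdeg n k) \<le> (C * w k) * (cmod (a k) * \<rho> ^ mdeg n k)"
      by (rule mult_right_mono[OF le[OF k]]) (use \<rho> in simp)
    then show "cmod (a k) * v k * \<rho> ^ mdeg n k \<le> C * (cmod (a k) * w k * \<rho> ^ mdeg n k)"
      by (simp add: algebra_simps)
    show "0 \<le> cmod (a k) * v k * \<rho> ^ mdeg n k" by (rule v.term_nonneg[OF k \<rho>(1)])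
  qed
  then show "a \<in> wt_series n v r" using w.series_support[OF a] unfolding wt_series_def by auto
qed

lemma wt_norm_le:
  assumes "positive_weight n w r" "positive_weight n v r"
    and le: "\<And>k. k \<in> mindices n \<Longrightarrow> v k \<le> C * w k"
    and a: "a \<in> wt_series n w r" and \<rho>: "0 < \<rho>" "ereal \<rho> < r"
  shows "wt_norm n v \<rho> a \<le> C * wt_norm n w \<rho> a"
proof -
  interpret w: positive_weight n w r by fact
  interpret v: positive_weight n v r by fact
  have av: "a \<in> wt_series n v r" using wt_series_mono[OF assms(1-3)] a by blast
  have "wt_norm n v \<rho> a \<le> (\<Sum>\<^sub>\<infinity>k\<in>mindices n. C * (cmod (a k) * w k * \<rho> ^ mdeg n k))"
    unfolding wt_norm_def
  proof (rule infsum_mono[OF v.series_summable[OF av \<rho>] summable_on_cmult_right[OF w.series_summable[OF a \<rho>]]])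
    fix k assume k: "k \<in> mindices n"
    have "v k * (cmod (a k) * \<rho> ^ mdeg n k) \<le> (C * w k) * (cmod (a k) * \<rho> ^ mdeg n k)"
      by (rule mult_right_mono[OF le[OF k]]) (use \<rho> in simp)
    then show "cmod (a k) * v k * \<rho> ^ mdeg n k \<le> C * (cmod (a k) * w k * \<rho> ^ mdeg n k)"
      by (simp add: algebra_simps)
  qed
  then show ?thesis by (simp add: wt_norm_def infsum_cmult_right')
qed

lemma openin_wt_topology_mono:
  assumes "positive_weight n w r" "positive_weight n v r" "0 < C"
    and le: "\<And>k. k \<in> mindices n \<Longrightarrow> v k \<le> C * w k"
    and eq: "wt_series n v r = wt_series n w r"
    and U: "openin (wt_topology n v r) U"
  shows "openin (wt_topology n w r) U"
proof (subst openin_subopen, rule ballI)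
  interpret w: positive_weight n w r by fact
  interpret v: positive_weight n v r by fact
  fix a assume a: "a \<in> U"
  then have aS: "a \<in> wt_series n w r" using openin_subset[OF U] eq by auto
  obtain \<rho> \<delta> where *: "0 < \<rho>" "ereal \<rho> < r" "0 < \<delta>"
    "{b \<in> wt_series n v r. wt_norm n v \<rho> (\<lambda>k. b k - a k) < \<delta>} \<subseteq> U"
    using v.open_contains_ball[OF U a] by blast
  let ?V = "{b \<in> wt_series n w r. wt_norm n w \<rho> (\<lambda>k. b k - a k) < \<delta> / C}"
  have "openin (wt_topology n w r) ?V"
    unfolding wt_topology_def using aS * \<open>0 < C\<close>
    by (intro topology_generated_by_Basis CollectI exI[of _ a] exI[of _ \<rho>] exI[of _ "\<delta> / C"]) auto
  moreover have "a \<in> ?V" using aS * \<open>0 < C\<close> by (simp add: wt_norm_def)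
  moreover have "?V \<subseteq> U"
  proof
    fix b assume b: "b \<in> ?V"
    then have "wt_norm n v \<rho> (\<lambda>k. b k - a k) \<le> C * wt_norm n w \<rho> (\<lambda>k. b k - a k)"
      using aS by (intro wt_norm_le[OF assms(1,2) le] w.series_diff *(1,2)) auto
    also have "\<dots> < \<delta>" using b \<open>0 < C\<close> by (simp add: field_simps)
    finally show "b \<in> U" using b *(4) eq by auto
  qed
  ultimately show "\<exists>T. openin (wt_topology n w r) T \<and> a \<in> T \<and> T \<subseteq> U" by blast
qed

text \<open>Comparability by constants uniform in \<open>k\<close> makes carrier and topology
  literally equal; the other record fields do not mention the weight.\<close>

lemma wt_algebra_cong:
  assumes "positive_weight n w r" "positive_weight n v r" "0 < C" "0 < D"
    and "\<And>k. k \<in> mindices n \<Longrightarrow> v k \<le> C * w k" "\<And>k. k \<in> mindices n \<Longrightarrow> w k \<le> D * v k"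
  shows "wt_algebra n q w r = wt_algebra n q v r"
proof -
  have S: "wt_series n w r = wt_series n v r"
    using wt_series_mono[OF assms(1,2,5)] wt_series_mono[OF assms(2,1,6)] by blast
  have "wt_topology n w r = wt_topology n v r"
    using openin_wt_topology_mono[OF assms(1,2,3,5) S[symmetric]]
      openin_wt_topology_mono[OF assms(2,1,4,6) S]
    by (auto simp: topology_eq)
  with S show ?thesis by (simp add: wt_algebra_def)
qed

section \<open>Comparison of the weights\<close>

lemma t_int_pos: "0 < t \<Longrightarrow> 1 \<le> m \<Longrightarrow> 0 < t_int t m"
  unfolding t_int_def by (rule sum_pos) (auto simp: lessThan_empty_iff)

lemma t_fact_pos: "0 < t \<Longrightarrow> 0 < t_fact t m"
  unfolding t_fact_def by (rule prod_pos) (auto intro: t_int_pos)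

lemma t_mfact_pos: "0 < t \<Longrightarrow> 0 < t_mfact n t k"
  unfolding t_mfact_def by (rule prod_pos) (auto intro: t_fact_pos)

text \<open>Summing the geometric progressions turns the t-factorial into the finite Pochhammer
  product \<open>(t;t)_m\<close> over \<open>(1 - t) ^ m\<close>. In the multinomial quotient the
  denominators cancel because the degree is additive.\<close>

lemma t_fact_eq_prod:
  assumes "t < 1"
  shows "t_fact t m = (\<Prod>j=1..m. 1 - t ^ j) / (1 - t) ^ m"
proof -
  have "t_fact t m = (\<Prod>j=1..m. (1 - t ^ j) / (1 - t))"
    unfolding t_fact_def t_int_def using assms by (intro prod.cong) (auto simp: sum_gp_strict)
  then show ?thesis by (simp add: prod_dividef)
qed

text \<open>Reciprocal of \<open>1 + y \<le> exp y\<close> at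
  \<open>y = x / (1 - x)\<close>.\<close>

lemma one_minus_ge_exp:
  fixes x :: real
  assumes "x < 1"
  shows "exp (- x / (1 - x)) \<le> 1 - x"
proof -
  have "1 / (1 - x) = 1 + x / (1 - x)" using assms by (simp add: field_simps)
  also have "\<dots> \<le> exp (x / (1 - x))" by (rule exp_ge_add_one_self)
  finally have "inverse (exp (x / (1 - x))) \<le> inverse (1 / (1 - x))"
    using assms by (intro le_imp_inverse_le) auto
  then show ?thesis by (simp add: exp_minus)
qed

text \<open>Since \<open>1 - t \<le> 1 - t ^ j\<close>, each factor is at least
  \<open>exp (- t ^ j / (1 - t))\<close>, and the geometric series bounds the sum of the exponents
  independently of \<open>m\<close>. The two divisions by \<open>1 - t\<close> in the witness come
  from these two estimates.\<close>

lemma q_pochhammer_bounds: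
  fixes t :: real
  assumes "0 < t" "t < 1"
  obtains c where "0 < c" "c \<le> 1" "\<And>m. c \<le> (\<Prod>j=1..m. 1 - t ^ j)" "\<And>m. (\<Prod>j=1..m. 1 - t ^ j) \<le> 1"
proof
  let ?c = "exp (- ((1 / (1 - t)) / (1 - t)))"
  show "0 < ?c" "?c \<le> 1" using assms by auto
  have lt: "t ^ j < 1" if "1 \<le> j" for j using assms that by (simp add: power_less_one_iff)
  show "(\<Prod>j=1..m. 1 - t ^ j) \<le> 1" for m
    using assms lt by (intro prod_le_1) (auto intro: less_imp_le)
  show "?c \<le> (\<Prod>j=1..m. 1 - t ^ j)" for m
  proof -
    have "(\<Sum>j=1..m. t ^ j) \<le> (\<Sum>j<Suc m. t ^ j)"
      using assms by (intro sum_mono2) auto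
    also have "\<dots> \<le> 1 / (1 - t)" using assms unfolding sum_gp_strict by (auto intro: divide_right_mono)
    finally have "(\<Sum>j=1..m. t ^ j) / (1 - t) \<le> (1 / (1 - t)) / (1 - t)"
      using assms by (intro divide_right_mono) auto
    then have "(\<Sum>j=1..m. t ^ j / (1 - t)) \<le> (1 / (1 - t)) / (1 - t)"
      by (simp only: sum_divide_distrib)
    then have "?c \<le> exp (\<Sum>j=1..m. - (t ^ j / (1 - t)))" by (simp add: sum_negf)
    also have "\<dots> = (\<Prod>j=1..m. exp (- (t ^ j / (1 - t))))" by (simp add: exp_sum)
    also have "\<dots> \<le> (\<Prod>j=1..m. 1 - t ^ j)"
    proof (intro prod_mono conjI)
      fix j assume j: "j \<in> {1..m}"
      then have tj: "t ^ j \<le> t" using assms power_decreasing[of 1 j t] by simp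
      have "t ^ j / (1 - t ^ j) \<le> t ^ j / (1 - t)"
        using tj assms lt[of j] j by (intro divide_left_mono) auto
      then have "exp (- (t ^ j / (1 - t))) \<le> exp (- (t ^ j) / (1 - t ^ j))" by simp
      also have "\<dots> \<le> 1 - t ^ j" using lt[of j] j by (intro one_minus_ge_exp) auto
      finally show "exp (- (t ^ j / (1 - t))) \<le> 1 - t ^ j" .
    qed simp
    finally show ?thesis .
  qed
qed

lemma t_multinomial_bounds:
  assumes "0 < t" "t < 1"
  obtains c where "0 < c" "\<And>k. c \<le> t_mfact n t k / t_fact t (mdeg n k)"
    "\<And>k. t_mfact n t k / t_fact t (mdeg n k) \<le> 1 / c"
proof -
  obtain c where c: "0 < c" "c \<le> 1" "\<And>m. c \<le> (\<Prod>j=1..m. 1 - t ^ j)" "\<And>m. (\<Prod>j=1..m. 1 - t ^ j) \<le> 1"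
    by (rule q_pochhammer_bounds[OF assms]) blast
  let ?p = "\<lambda>m::nat. \<Prod>j=1..m. 1 - t ^ j"
  have eq: "t_mfact n t k / t_fact t (mdeg n k) = (\<Prod>i<n. ?p (k i)) / ?p (mdeg n k)" for k
  proof -
    have "t_mfact n t k = (\<Prod>i<n. ?p (k i)) / (1 - t) ^ mdeg n k"
      unfolding t_mfact_def t_fact_eq_prod[OF assms(2)] prod_dividef mdeg_def power_sum ..
    then show ?thesis unfolding t_fact_eq_prod[OF assms(2)] using assms by simp
  qed
  have p0: "0 < ?p m" for m using c(1) c(3)[of m] by linarith
  have up: "(\<Prod>i<n. ?p (k i)) \<le> 1" and lo: "c ^ n \<le> (\<Prod>i<n. ?p (k i))" for k
  proof -
    show "(\<Prod>i<n. ?p (k i)) \<le> 1" using p0 c(4) by (intro prod_le_1) (auto intro: less_imp_le)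
    have "(\<Prod>i<n. c) \<le> (\<Prod>i<n. ?p (k i))" using c by (intro prod_mono) auto
    then show "c ^ n \<le> (\<Prod>i<n. ?p (k i))" by simp
  qed
  show ?thesis
  proof (rule that)
    \<comment> \<open>The numerator has \<open>n\<close> factors, each at least \<open>c\<close>.
      The extra power lets the same constant cover the upper bound \<open>1 / c\<close> coming from
      the denominator, also when \<open>n = 0\<close>.\<close>
    show "0 < c ^ Suc n" using c by simp
    fix k
    have "c ^ Suc n \<le> c ^ n" using c by (intro power_decreasing) auto
    also have "\<dots> \<le> (\<Prod>i<n. ?p (k i))" by (rule lo)
    also have "\<dots> \<le> (\<Prod>i<n. ?p (k i)) / ?p (mdeg n k)"
      using divide_left_mono[OF c(4)[of "mdeg n k"], of "\<Prod>i<n. ?p (k i)"] p0 prod_nonneg[of "{..<n}" "\<lambda>i. ?p (k i)"]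
      by (simp add: less_imp_le)
    finally show "c ^ Suc n \<le> t_mfact n t k / t_fact t (mdeg n k)" unfolding eq .
    have "(\<Prod>i<n. ?p (k i)) / ?p (mdeg n k) \<le> 1 / c"
      using up[of k] c(3)[of "mdeg n k"] c(1) by (intro frac_le) auto
    also have "\<dots> \<le> 1 / c ^ Suc n"
      using c power_decreasing[of 1 "Suc n" c] by (intro divide_left_mono) auto
    finally show "t_mfact n t k / t_fact t (mdeg n k) \<le> 1 / c ^ Suc n" unfolding eq .
  qed
qed

text \<open>Reversing the sum gives \<open>[m]_{1/t} = t^{-(m-1)} [m]_t\<close>. This transfers
  bases above 1, which occur for |q| < 1, to the range where the Pochhammer products are bounded
  below.\<close>

lemma t_fact_inverse:
  assumes "0 < t" shows "t_fact (inverse t) m = inverse t ^ (\<Sum>j<m. j) * t_fact t m"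
proof (induction m)
  case 0
  then show ?case by (simp add: t_fact_def)
next
  case (Suc m)
  have "t_int (inverse t) (Suc m) = inverse t ^ m * t_int t (Suc m)"
  proof -
    have "t_int t (Suc m) = (\<Sum>i<Suc m. t ^ (m - i))"
      unfolding t_int_def by (subst sum.nat_diff_reindex[symmetric]) simp
    moreover have "inverse t ^ m * t ^ (m - i) = inverse t ^ i" if "i < Suc m" for i
      using assms that by (simp add: power_diff field_simps)
    ultimately show ?thesis unfolding t_int_def by (simp add: sum_distrib_left del: sum.lessThan_Suc)
  qed
  moreover have "t_fact s (Suc m) = t_int s (Suc m) * t_fact s m" for s
    by (simp add: t_fact_def)
  ultimately show ?case using Suc by (simp add: power_add)
qed

text \<open>The inner sums are binomial coefficients \<open>m choose 2\<close>: two elements of a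
  disjoint union of blocks lie in one block or in two different ones. The second term is the
  exponent of \<open>polydisk_wt\<close> for |q| < 1.\<close>

lemma sum_lessThan_mdeg:
  "(\<Sum>j<mdeg n k. j) = (\<Sum>i<n. \<Sum>j<k i. j) + (\<Sum>j<n. \<Sum>i<j. k i * k j)"
proof (induction n)
  case (Suc n)
  have *: "(\<Sum>j<a + b. j) = (\<Sum>j<a. j) + (\<Sum>j<b. j) + a * b" for a b :: nat
    by (induction b) (auto simp: algebra_simps)
  show ?case using Suc by (simp add: mdeg_def * sum_distrib_right)
qed (simp add: mdeg_def)

lemma polydisk_wt_pos: "q \<noteq> 0 \<Longrightarrow> 0 < polydisk_wt n q k"
  by (simp add: polydisk_wt_def)

lemma ball_wt_pos: "q \<noteq> 0 \<Longrightarrow> 0 < ball_wt n q k"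
  by (simp add: ball_wt_def Let_def t_mfact_pos t_fact_pos)

lemma ball_wt_comparable:
  assumes "q \<noteq> 0" "cmod q \<noteq> 1"
  obtains c where "0 < c" "\<And>k. c * polydisk_wt n q k \<le> ball_wt n q k"
    "\<And>k. ball_wt n q k \<le> 1 / c * polydisk_wt n q k"
proof (cases "cmod q > 1")
  case True
  define t where "t = cmod q powi (-2)"
  have "1 < cmod q ^ 2" using True by (simp add: one_less_power)
  moreover have "t = inverse (cmod q ^ 2)" by (simp add: t_def power_int_minus)
  ultimately have t: "0 < t" "t < 1" by (auto intro: inverse_less_1_iff[THEN iffD2])
  obtain c where c: "0 < c" "\<And>k. c \<le> t_mfact n t k / t_fact t (mdeg n k)"
    "\<And>k. t_mfact n t k / t_fact t (mdeg n k) \<le> 1 / c"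
    using t_multinomial_bounds[OF t, of n] by blast
  show ?thesis
  proof (rule that[of "sqrt c"])
    show "0 < sqrt c" using c by simp
    fix k
    have eq: "polydisk_wt n q k = 1" "ball_wt n q k = sqrt (t_mfact n t k / t_fact t (mdeg n k))"
      using True by (simp_all add: ball_wt_def polydisk_wt_def t_def Let_def)
    show "sqrt c * polydisk_wt n q k \<le> ball_wt n q k"
      unfolding eq using real_sqrt_le_mono[OF c(2)[of k]] by simp
    have "sqrt (1 / c) = 1 / sqrt c" by (simp add: real_sqrt_divide)
    then show "ball_wt n q k \<le> 1 / sqrt c * polydisk_wt n q k"
      unfolding eq using real_sqrt_le_mono[OF c(3)[of k]] by (simp only: mult_1_right)
  qed
next
  case False
  \<comment> \<open>Here the base of the ball weight is \<open>inverse t\<close>, so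
    \<open>t_fact_inverse\<close> applies. The surplus \<open>t ^ E\<close> has square root
    \<open>|q| ^ E\<close>, which is the polydisk weight.\<close>
  define t where "t = cmod q powi 2"
  have "cmod q < 1" using False assms by simp
  then have t: "0 < t" "t < 1" using assms power_less_one_iff[of "cmod q" 2] by (simp_all add: t_def)
  obtain c where c: "0 < c" "\<And>k. c \<le> t_mfact n t k / t_fact t (mdeg n k)"
    "\<And>k. t_mfact n t k / t_fact t (mdeg n k) \<le> 1 / c"
    using t_multinomial_bounds[OF t, of n] by blast
  have eq: "ball_wt n q k = polydisk_wt n q k * sqrt (t_mfact n t k / t_fact t (mdeg n k))" for k
  proof -
    let ?E = "\<Sum>j<n. \<Sum>i<j. k i * k j"
    have inv: "cmod q powi (-2) = inverse t" by (simp add: t_def power_int_minus)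
    have "t_mfact n (inverse t) k = inverse t ^ (\<Sum>i<n. \<Sum>j<k i. j) * t_mfact n t k"
      unfolding t_mfact_def t_fact_inverse[OF t(1)] by (simp add: prod.distrib power_sum)
    then have "t_mfact n (inverse t) k / t_fact (inverse t) (mdeg n k) =
        t ^ ?E * (t_mfact n t k / t_fact t (mdeg n k))"
      unfolding t_fact_inverse[OF t(1)] sum_lessThan_mdeg using t by (simp add: power_add field_simps)
    moreover have "sqrt (t ^ ?E) = cmod q ^ ?E"
      by (simp add: real_sqrt_power t_def)
    ultimately have "ball_wt n q k = cmod q ^ ?E * sqrt (t_mfact n t k / t_fact t (mdeg n k))"
      unfolding ball_wt_def inv Let_def by (simp only: real_sqrt_mult)
    then show ?thesis using \<open>cmod q < 1\<close> by (simp add: polydisk_wt_def)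
  qed
  show ?thesis
  proof (rule that[of "sqrt c"])
    show "0 < sqrt c" using c by simp
    fix k
    have p: "0 \<le> polydisk_wt n q k" using polydisk_wt_pos[OF assms(1)] by (rule less_imp_le)
    show "sqrt c * polydisk_wt n q k \<le> ball_wt n q k"
      unfolding eq using mult_left_mono[OF real_sqrt_le_mono[OF c(2)[of k]] p] by (simp add: mult.commute)
    show "ball_wt n q k \<le> 1 / sqrt c * polydisk_wt n q k"
      unfolding eq using mult_left_mono[OF real_sqrt_le_mono[OF c(3)[of k]] p]
      by (simp only: mult.commute real_sqrt_divide real_sqrt_one)
  qed
qed

lemma positive_weight_polydisk: "q \<noteq> 0 \<Longrightarrow> 0 < r \<Longrightarrow> positive_weight n (polydisk_wt n q) r"
  by unfold_locales (auto intro: polydisk_wt_pos)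

lemma positive_weight_ball: "q \<noteq> 0 \<Longrightarrow> 0 < r \<Longrightarrow> positive_weight n (ball_wt n q) r"
  by unfold_locales (auto intro: ball_wt_pos)

lemma polydisk_eq_ball:
  assumes "q \<noteq> 0" "cmod q \<noteq> 1" "0 < r"
  shows "q_polydisk n q r = q_ball n q r"
proof -
  obtain c where c: "0 < c" "\<And>k. c * polydisk_wt n q k \<le> ball_wt n q k"
    "\<And>k. ball_wt n q k \<le> 1 / c * polydisk_wt n q k"
    using ball_wt_comparable[OF assms(1,2), of n] by blast
  have "polydisk_wt n q k \<le> 1 / c * ball_wt n q k" for k
    using c(1) c(2)[of k] by (simp add: field_simps)
  with c show ?thesis unfolding q_polydisk_def q_ball_def
    by (intro wt_algebra_cong[of _ _ _ _ "1 / c" "1 / c"] positive_weight_polydisk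
        positive_weight_ball assms) auto
qed

lemma top_isomorphic_refl: "top_isomorphic A A"
  unfolding top_isomorphic_def
  by (rule bexI[of _ id]) (auto simp: ring_iso_def ring_hom_def homeomorphic_map_id)

section \<open>Bounded functionals and homomorphisms\<close>

text \<open>The added variable has index at most every index already present; it is found by
  removing the least index of the support. In this order \<open>x_i x^k\<close> is a monomial
  without a power of \<open>q\<close>, so \<open>q_mult_gen_monom\<close> applies in the inductive
  step.\<close>

lemma mindex_induct [consumes 1, case_names zero step]:
  assumes "k \<in> mindices n" and "P (\<lambda>_. 0)"
    and step: "\<And>i k. i < n \<Longrightarrow> k \<in> mindices n \<Longrightarrow> (\<And>j. j < i \<Longrightarrow> k j = 0) \<Longrightarrow> P k \<Longrightarrow>
      P (k(i := Suc (k i)))"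
  shows "P k"
  using assms(1)
proof (induction "mdeg n k" arbitrary: k rule: less_induct)
  case less
  show ?case
  proof (cases "k = (\<lambda>_. 0)")
    case False
    define i where "i = (LEAST i. k i \<noteq> 0)"
    have ki: "k i \<noteq> 0" unfolding i_def by (rule LeastI_ex) (use False in auto)
    have lt: "k j = 0" if "j < i" for j using that not_less_Least unfolding i_def by blast
    have "i < n" using ki less.prems by (auto simp: mindices_def not_less[symmetric])
    let ?k = "k(i := k i - 1)"
    have k: "?k \<in> mindices n" using less.prems \<open>i < n\<close> by (auto simp: mindices_def)
    have "mdeg n ?k < mdeg n k"
      unfolding mdeg_def by (rule sum_strict_mono_ex1) (use ki \<open>i < n\<close> in auto)
    then have "P (?k(i := Suc (?k i)))" using k lt \<open>i < n\<close> by (intro step less.hyps) auto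
    then show ?thesis using ki by simp
  qed (use assms(2) in simp)
qed

lemma mdeg_Suc: "i < n \<Longrightarrow> mdeg n (k(i := Suc (k i))) = Suc (mdeg n k)"
  unfolding mdeg_def by (subst (1 2) sum.remove[of _ i]) auto

lemma mdeg_zero [simp]: "mdeg n (\<lambda>_. 0) = 0"
  by (simp add: mdeg_def)

lemma mdeg_add: "mdeg n (\<lambda>i. k i + l i) = mdeg n k + mdeg n l"
  by (simp add: mdeg_def sum.distrib)

lemma mdeg_diff: "k \<le> m \<Longrightarrow> mdeg n k + mdeg n (m - k) = mdeg n m"
  unfolding mdeg_def sum.distrib[symmetric] by (rule sum.cong) (auto simp: le_fun_def)

lemma mindices_diff: "m \<in> mindices n \<Longrightarrow> m - k \<in> mindices n"
  by (simp add: mindices_def)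

text \<open>Cauchy product: the double family is absolutely summable, and
  \<open>(k, l) \<mapsto> (k + l, k)\<close> regroups it into the finite fibres below each
  \<open>m\<close>. The general value type serves both real norms (closure under products) and
  complex evaluations.\<close>

lemma convolution_has_sum:
  fixes f g :: "mindex \<Rightarrow> 'a :: {banach, real_normed_algebra}"
  assumes f: "(\<lambda>k. norm (f k)) summable_on mindices n" and g: "(\<lambda>k. norm (g k)) summable_on mindices n"
  shows "((\<lambda>m. \<Sum>k\<in>{..m}. f k * g (m - k)) has_sum
    (\<Sum>\<^sub>\<infinity>k\<in>mindices n. f k) * (\<Sum>\<^sub>\<infinity>k\<in>mindices n. g k)) (mindices n)"
proof -
  let ?M = "mindices n"
  have fs: "(f has_sum infsum f ?M) ?M" and gs: "(g has_sum infsum g ?M) ?M"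
    using assms by (auto intro!: has_sum_infsum abs_summable_summable)
  have "(\<lambda>(k,l). norm (f k) * norm (g l)) summable_on (Sigma ?M (\<lambda>_. ?M))"
  proof (rule summable_on_SigmaI)
    show "((\<lambda>l. case (k, l) of (k, l) \<Rightarrow> norm (f k) * norm (g l)) has_sum
        norm (f k) * (\<Sum>\<^sub>\<infinity>l\<in>?M. norm (g l))) ?M" for k
      using has_sum_cmult_right[OF has_sum_infsum[OF g], of "norm (f k)"] by simp
    show "(\<lambda>k. norm (f k) * (\<Sum>\<^sub>\<infinity>l\<in>?M. norm (g l))) summable_on ?M"
      by (rule summable_on_cmult_left[OF f])
  qed simp
  then have "(\<lambda>x. norm ((\<lambda>(k,l). f k * g l) x)) summable_on (Sigma ?M (\<lambda>_. ?M))"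
    by (rule summable_on_comparison_test) (auto simp: norm_mult_ineq)
  then have "(\<lambda>(k,l). f k * g l) summable_on (Sigma ?M (\<lambda>_. ?M))" by (rule abs_summable_summable)
  then have "((\<lambda>(k,l). f k * g l) has_sum infsum f ?M * infsum g ?M) (Sigma ?M (\<lambda>_. ?M))"
    using has_sum_cmult_right[OF gs] has_sum_cmult_left[OF fs]
    by (intro has_sum_SigmaI[where g = "\<lambda>k. f k * infsum g ?M"]) auto
  also have "?this \<longleftrightarrow> ((\<lambda>(m,k). f k * g (m - k)) has_sum infsum f ?M * infsum g ?M)
      (Sigma ?M (\<lambda>m. {..m}))"
  proof (rule has_sum_reindex_bij_witness[where i = "\<lambda>(m,k). (k, m - k)" and
      j = "\<lambda>(k,l). (\<lambda>i. k i + l i, k)"], goal_cases)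
    case (1 x)
    then show ?case by (auto simp: fun_eq_iff)
  next
    case (2 x)
    then show ?case by (auto simp: mindices_add le_fun_def)
  next
    case (3 x)
    then show ?case by (auto simp: le_fun_def fun_eq_iff)
  next
    case (4 x)
    then show ?case using mindices_diff mindices_le by auto
  next
    case (5 x)
    obtain k l where x: "x = (k, l)" by (cases x)
    have "(\<lambda>i. k i + l i) - k = l" by (simp add: fun_eq_iff)
    then show ?case by (simp add: x)
  qed simp
  finally show ?thesis
  proof (rule has_sum_SigmaD)
    fix m assume "m \<in> ?M"
    then show "((\<lambda>k. case (m, k) of (m, k) \<Rightarrow> f k * g (m - k)) has_sum
        (\<Sum>k\<in>{..m}. f k * g (m - k))) {..m}"
      using finite_below by (auto intro: has_sum_finite)
  qed
qed

text \<open>For unimodular \<open>q\<close> the twist factors have modulus 1, so the moduli of the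
  product are dominated by the convolution of the moduli.\<close>

lemma q_mult_closed_polydisk:
  assumes q: "cmod q = 1" and a: "a \<in> wt_series n (\<lambda>_. 1) r" and b: "b \<in> wt_series n (\<lambda>_. 1) r"
  shows "q_mult n q a b \<in> wt_series n (\<lambda>_. 1) r"
proof -
  have "(\<lambda>m. cmod (q_mult n q a b m) * 1 * \<rho> ^ mdeg n m) summable_on mindices n"
    if \<rho>: "0 < \<rho>" "ereal \<rho> < r" for \<rho>
  proof -
    let ?f = "\<lambda>a k. cmod (a k) * 1 * \<rho> ^ mdeg n k"
    have s: "(\<lambda>k. norm (?f a k)) summable_on mindices n" "(\<lambda>k. norm (?f b k)) summable_on mindices n"
      using a b \<rho> by (auto simp: wt_series_def)
    show ?thesis
    proof (rule summable_on_comparison_test[OF has_sum_imp_summable[OF convolution_has_sum[OF s]]])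
      fix m assume m: "m \<in> mindices n"
      have "cmod (q_mult n q a b m) \<le> (\<Sum>k\<in>{..m}. cmod (a k) * cmod (b (m - k)))"
        unfolding q_mult_def by (rule order_trans[OF norm_sum])
          (simp add: norm_mult norm_power norm_inverse q)
      then have "cmod (q_mult n q a b m) * 1 * \<rho> ^ mdeg n m \<le>
          (\<Sum>k\<in>{..m}. cmod (a k) * cmod (b (m - k))) * \<rho> ^ mdeg n m"
        using \<rho> by (simp add: mult_right_mono)
      also have "\<dots> = (\<Sum>k\<in>{..m}. ?f a k * ?f b (m - k))"
        unfolding sum_distrib_right
      proof (intro sum.cong refl)
        fix k assume "k \<in> {..m}"
        then have "\<rho> ^ mdeg n m = \<rho> ^ mdeg n k * \<rho> ^ mdeg n (m - k)"
          by (simp add: mdeg_diff power_add[symmetric])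
        then show "cmod (a k) * cmod (b (m - k)) * \<rho> ^ mdeg n m = ?f a k * ?f b (m - k)" by simp
      qed
      finally show "cmod (q_mult n q a b m) * 1 * \<rho> ^ mdeg n m \<le> (\<Sum>k\<in>{..m}. ?f a k * ?f b (m - k))" .
    qed (use \<rho> in simp)
  qed
  moreover have "q_mult n q a b m = 0" if "m \<notin> mindices n" for m
    using a b that by (intro q_mult_support) (auto simp: wt_series_def)
  ultimately show ?thesis unfolding wt_series_def by auto
qed

locale bounded_functional = positive_weight +
  fixes T :: "series \<Rightarrow> complex"
  assumes T_add: "a \<in> wt_series n w r \<Longrightarrow> b \<in> wt_series n w r \<Longrightarrow> T (\<lambda>k. a k + b k) = T a + T b"
    and T_scale: "a \<in> wt_series n w r \<Longrightarrow> T (\<lambda>k. c * a k) = c * T a"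
    and T_bounded: "\<exists>C \<rho>. 0 < \<rho> \<and> ereal \<rho> < r \<and> (\<forall>a\<in>wt_series n w r. cmod (T a) \<le> C * wt_norm n w \<rho> a)"
begin

lemma T_zero: "T (\<lambda>_. 0) = 0"
  using T_scale[of "monom_ser (\<lambda>_. 0)" 0] series_monom[OF mindices_zero] by simp

lemma T_finite:
  assumes "finite F" "F \<subseteq> mindices n"
  shows "T (\<lambda>k. if k \<in> F then a k else 0) = (\<Sum>k\<in>F. a k * T (monom_ser k))"
  using assms
proof (induction F rule: finite_induct)
  case empty
  then show ?case by (simp add: T_zero)
next
  case (insert x F)
  have "(\<lambda>k. if k \<in> insert x F then a k else 0) =
      (\<lambda>k. (\<lambda>k. a x * monom_ser x k) k + (\<lambda>k. if k \<in> F then a k else 0) k)"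
    using insert by (auto simp: monom_ser_def)
  then have "T (\<lambda>k. if k \<in> insert x F then a k else 0) =
      T (\<lambda>k. a x * monom_ser x k) + T (\<lambda>k. if k \<in> F then a k else 0)"
    using insert by (simp only:) (rule T_add; intro series_scale series_monom series_finite; simp)
  then show ?case using insert by (simp add: T_scale series_monom)
qed

text \<open>Finite truncations of \<open>a\<close> converge to \<open>a\<close> in the norm that
  bounds \<open>T\<close>: the norm of the remainder is the tail of a summable family.\<close>

lemma has_sum_T:
  assumes a: "a \<in> wt_series n w r"
  shows "((\<lambda>k. a k * T (monom_ser k)) has_sum T a) (mindices n)"
proof -
  obtain C \<rho> where *: "0 < \<rho>" "ereal \<rho> < r" "\<And>a. a \<in> wt_series n w r \<Longrightarrow> cmod (T a) \<le> C * wt_norm n w \<rho> a"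
    using T_bounded by blast
  let ?h = "\<lambda>k. cmod (a k) * w k * \<rho> ^ mdeg n k"
  have h: "?h summable_on mindices n" by (rule series_summable[OF a *(1,2)])
  have le: "cmod (sum (\<lambda>k. a k * T (monom_ser k)) F - T a) \<le> C * (wt_norm n w \<rho> a - sum ?h F)"
    if F: "finite F" "F \<subseteq> mindices n" for F
  proof -
    define b where "b = (\<lambda>k. if k \<in> F then a k else 0)"
    have b: "b \<in> wt_series n w r" unfolding b_def by (rule series_finite[OF F])
    have "T a = T (\<lambda>k. (a k - b k) + b k)" by simp
    also have "\<dots> = T (\<lambda>k. a k - b k) + T b" by (rule T_add[OF series_diff[OF a b] b])
    finally have "sum (\<lambda>k. a k * T (monom_ser k)) F - T a = - T (\<lambda>k. a k - b k)"
      using T_finite[OF F, of a] unfolding b_def[symmetric] by simp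
    then have "cmod (sum (\<lambda>k. a k * T (monom_ser k)) F - T a) = cmod (T (\<lambda>k. a k - b k))"
      by (simp only: norm_minus_cancel)
    also have "\<dots> \<le> C * wt_norm n w \<rho> (\<lambda>k. a k - b k)" by (rule *(3)[OF series_diff[OF a b]])
    also have "wt_norm n w \<rho> (\<lambda>k. a k - b k) = infsum ?h (mindices n - F)"
      unfolding wt_norm_def by (rule infsum_cong_neutral) (auto simp: b_def)
    also have "\<dots> = wt_norm n w \<rho> a - sum ?h F"
      unfolding wt_norm_def by (subst infsum_Diff[OF h _ F(2)]) (use F in auto)
    finally show ?thesis .
  qed
  have "(sum ?h \<longlongrightarrow> wt_norm n w \<rho> a) (finite_subsets_at_top (mindices n))"
    using has_sum_infsum[OF h] unfolding has_sum_def wt_norm_def .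
  then have "((\<lambda>F. C * (wt_norm n w \<rho> a - sum ?h F)) \<longlongrightarrow> C * (wt_norm n w \<rho> a - wt_norm n w \<rho> a))
      (finite_subsets_at_top (mindices n))" by (intro tendsto_intros)
  then have "((\<lambda>F. sum (\<lambda>k. a k * T (monom_ser k)) F - T a) \<longlongrightarrow> 0) (finite_subsets_at_top (mindices n))"
    by (intro Lim_null_comparison[OF eventually_finite_subsets_at_top_weakI[OF le]]) simp_all
  then show ?thesis unfolding has_sum_def by (rule Lim_null[THEN iffD2])
qed

end

lemma bounded_functional_eqI:
  assumes "bounded_functional n w r T" "bounded_functional n w r T'"
    and "\<And>k. k \<in> mindices n \<Longrightarrow> T (monom_ser k) = T' (monom_ser k)"
    and a: "a \<in> wt_series n w r"
  shows "T a = T' a"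
proof -
  have "((\<lambda>k. a k * T (monom_ser k)) has_sum T' a) (mindices n)"
    using bounded_functional.has_sum_T[OF assms(2) a]
    by (rule has_sum_cong[THEN iffD1, rotated]) (simp add: assms(3))
  with bounded_functional.has_sum_T[OF assms(1) a] show ?thesis by (rule has_sum_unique)
qed

lemma bounded_functional_sum:
  assumes "finite I" "positive_weight n w r" "\<And>i. i \<in> I \<Longrightarrow> bounded_functional n w r (T i)"
  shows "bounded_functional n w r (\<lambda>a. \<Sum>i\<in>I. c i * T i a)"
  using assms(1,3)
proof (induction I rule: finite_induct)
  case empty
  interpret positive_weight n w r by fact
  obtain \<rho> where "0 < \<rho>" "ereal \<rho> < r" by (rule ex_radius)
  then have "\<exists>C \<rho>. 0 < \<rho> \<and> ereal \<rho> < r \<and> (\<forall>a\<in>wt_series n w r. 0 \<le> C * wt_norm n w \<rho> a)"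
    by (intro exI[of _ 0] exI[of _ \<rho>]) simp
  then show ?case by unfold_locales simp_all
next
  case (insert i I)
  interpret S: bounded_functional n w r "\<lambda>a. \<Sum>i\<in>I. c i * T i a" using insert by auto
  interpret T: bounded_functional n w r "T i" using insert by auto
  obtain C \<rho> where *: "0 < \<rho>" "ereal \<rho> < r"
    "\<And>a. a \<in> wt_series n w r \<Longrightarrow> cmod (\<Sum>i\<in>I. c i * T i a) \<le> C * wt_norm n w \<rho> a"
    using S.T_bounded by blast
  obtain C' \<rho>' where **: "0 < \<rho>'" "ereal \<rho>' < r"
    "\<And>a. a \<in> wt_series n w r \<Longrightarrow> cmod (T i a) \<le> C' * wt_norm n w \<rho>' a"
    using T.T_bounded by blast
  let ?\<rho> = "max \<rho> \<rho>'"
  have \<rho>: "0 < ?\<rho>" "ereal ?\<rho> < r" using * ** by (auto simp: max_def)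
  have "cmod (\<Sum>i\<in>insert i I. c i * T i a) \<le> (cmod (c i) * \<bar>C'\<bar> + \<bar>C\<bar>) * wt_norm n w ?\<rho> a"
    if a: "a \<in> wt_series n w r" for a
  proof -
    have mono: "wt_norm n w \<rho> a \<le> wt_norm n w ?\<rho> a" "wt_norm n w \<rho>' a \<le> wt_norm n w ?\<rho> a"
      using * ** \<rho> a by (auto intro: S.norm_mono)
    have nn: "0 \<le> wt_norm n w \<rho> a" "0 \<le> wt_norm n w \<rho>' a" using * ** by (auto intro: S.norm_nonneg)
    have "cmod (\<Sum>i\<in>I. c i * T i a) \<le> \<bar>C\<bar> * wt_norm n w ?\<rho> a"
      by (rule order_trans[OF *(3)[OF a] mult_mono]) (use mono nn in auto)
    moreover have "cmod (c i * T i a) \<le> cmod (c i) * (\<bar>C'\<bar> * wt_norm n w ?\<rho> a)"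
      unfolding norm_mult
      by (intro mult_left_mono order_trans[OF **(3)[OF a] mult_mono]) (use mono nn in auto)
    ultimately have "cmod (c i * T i a + (\<Sum>i\<in>I. c i * T i a)) \<le>
        cmod (c i) * (\<bar>C'\<bar> * wt_norm n w ?\<rho> a) + \<bar>C\<bar> * wt_norm n w ?\<rho> a"
      by (intro order_trans[OF norm_triangle_ineq] add_mono)
    then show ?thesis using insert by (simp add: algebra_simps)
  qed
  then have "\<exists>C \<rho>. 0 < \<rho> \<and> ereal \<rho> < r \<and> (\<forall>a\<in>wt_series n w r.
      cmod (\<Sum>i\<in>insert i I. c i * T i a) \<le> C * wt_norm n w \<rho> a)"
    using \<rho> by blast
  then show ?case using insert
    by unfold_locales (auto simp: S.T_add T.T_add S.T_scale T.T_scale algebra_simps)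
qed

lemma (in positive_weight) coeff_functional:
  assumes "k \<in> mindices n" shows "bounded_functional n w r (\<lambda>a. a k)"
proof
  obtain \<rho> where \<rho>: "0 < \<rho>" "ereal \<rho> < r" by (rule ex_radius)
  have "cmod (a k) \<le> 1 / (w k * \<rho> ^ mdeg n k) * wt_norm n w \<rho> a" if "a \<in> wt_series n w r" for a
    using coeff_le_norm[OF that \<rho> assms] wt_pos[OF assms] \<rho>
    by (simp add: pos_le_divide_eq mult.assoc)
  then show "\<exists>C \<rho>. 0 < \<rho> \<and> ereal \<rho> < r \<and> (\<forall>a\<in>wt_series n w r. cmod (a k) \<le> C * wt_norm n w \<rho> a)"
    using \<rho> by blast
qed auto

text \<open>Continuity is recorded in the form in which it is used: every norm of the target is
  controlled by some norm of the source, up to a constant. The same locale describes an isomorphism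
  and its inverse.\<close>

locale wt_hom = W: positive_weight n w r + V: positive_weight n v r for n w v r +
  fixes q :: complex and f :: "series \<Rightarrow> series"
  assumes closed: "a \<in> wt_series n w r \<Longrightarrow> f a \<in> wt_series n v r"
    and add: "a \<in> wt_series n w r \<Longrightarrow> b \<in> wt_series n w r \<Longrightarrow> f (\<lambda>k. a k + b k) = (\<lambda>k. f a k + f b k)"
    and scale: "a \<in> wt_series n w r \<Longrightarrow> f (\<lambda>k. c * a k) = (\<lambda>k. c * f a k)"
    and mult: "a \<in> wt_series n w r \<Longrightarrow> b \<in> wt_series n w r \<Longrightarrow>
      f (q_mult n q a b) = q_mult n q (f a) (f b)"
    and one: "f (monom_ser (\<lambda>_. 0)) = monom_ser (\<lambda>_. 0)"
    and bounded: "0 < \<rho> \<Longrightarrow> ereal \<rho> < r \<Longrightarrow> \<exists>C \<sigma>. 0 \<le> C \<and> 0 < \<sigma> \<and> ereal \<sigma> < r \<and>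
      (\<forall>a\<in>wt_series n w r. wt_norm n v \<rho> (f a) \<le> C * wt_norm n w \<sigma> a)"
begin

lemma functional_comp:
  assumes "bounded_functional n v r T" shows "bounded_functional n w r (\<lambda>a. T (f a))"
proof
  interpret T: bounded_functional n v r T by fact
  obtain C \<rho> where *: "0 < \<rho>" "ereal \<rho> < r" "\<And>a. a \<in> wt_series n v r \<Longrightarrow> cmod (T a) \<le> C * wt_norm n v \<rho> a"
    using T.T_bounded by blast
  obtain C' \<sigma> where **: "0 \<le> C'" "0 < \<sigma>" "ereal \<sigma> < r"
    "\<And>a. a \<in> wt_series n w r \<Longrightarrow> wt_norm n v \<rho> (f a) \<le> C' * wt_norm n w \<sigma> a"
    using bounded[OF *(1,2)] by blast
  have "cmod (T (f a)) \<le> (\<bar>C\<bar> * C') * wt_norm n w \<sigma> a" if a: "a \<in> wt_series n w r" for a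
  proof -
    have "cmod (T (f a)) \<le> C * wt_norm n v \<rho> (f a)" by (rule *(3)[OF closed[OF a]])
    also have "\<dots> \<le> \<bar>C\<bar> * (C' * wt_norm n w \<sigma> a)"
      using **(4)[OF a] V.norm_nonneg[OF *(1)] by (intro mult_mono) auto
    finally show ?thesis by (simp add: mult.assoc)
  qed
  then show "\<exists>C \<rho>. 0 < \<rho> \<and> ereal \<rho> < r \<and> (\<forall>a\<in>wt_series n w r. cmod (T (f a)) \<le> C * wt_norm n w \<rho> a)"
    using ** by blast
  show "T (f (\<lambda>k. a k + b k)) = T (f a) + T (f b)"
    if "a \<in> wt_series n w r" "b \<in> wt_series n w r" for a b
    using that by (simp add: add T.T_add closed)
  show "T (f (\<lambda>k. c * a k)) = c * T (f a)" if "a \<in> wt_series n w r" for a c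
    using that by (simp add: scale T.T_scale closed)
qed

lemma gen_mult_monom:
  assumes "k \<in> mindices n" "i < n" "\<And>j. j < i \<Longrightarrow> k j = 0"
  shows "f (monom_ser (k(i := Suc (k i)))) = q_mult n q (f (gen_ser i)) (f (monom_ser k))"
proof -
  have "q_mult n q (gen_ser i) (monom_ser k) = monom_ser (k(i := Suc (k i)))"
    by (rule q_mult_gen_monom) (use assms in auto)
  then show ?thesis using mult[OF W.series_gen[OF assms(2)] W.series_monom[OF assms(1)]] by simp
qed

end

text \<open>The preimage of the unit ball of the norm at \<open>\<rho>\<close> contains a norm ball
  around 0; homogeneity turns this into a global estimate.\<close>

lemma continuous_imp_bounded:
  assumes "positive_weight n w r" "positive_weight n v r"
    and closed: "\<And>a. a \<in> wt_series n w r \<Longrightarrow> f a \<in> wt_series n v r"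
    and scale: "\<And>a c. a \<in> wt_series n w r \<Longrightarrow> f (\<lambda>k. c * a k) = (\<lambda>k. c * f a k)"
    and cont: "continuous_map (wt_topology n w r) (wt_topology n v r) f"
    and \<rho>: "0 < \<rho>" "ereal \<rho> < r"
  shows "\<exists>C \<sigma>. 0 \<le> C \<and> 0 < \<sigma> \<and> ereal \<sigma> < r \<and>
      (\<forall>a\<in>wt_series n w r. wt_norm n v \<rho> (f a) \<le> C * wt_norm n w \<sigma> a)"
proof -
  interpret W: positive_weight n w r by fact
  interpret V: positive_weight n v r by fact
  let ?z = "\<lambda>_. 0 :: complex"
  have zW: "?z \<in> wt_series n w r" and zV: "?z \<in> wt_series n v r"
    using W.series_finite[of "{}"] V.series_finite[of "{}"] by auto
  have fz: "f ?z = ?z" using scale[OF zW, of 0] by simp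
  let ?B = "{b \<in> wt_series n v r. wt_norm n v \<rho> (\<lambda>k. b k - ?z k) < 1}"
  have "openin (wt_topology n v r) ?B" unfolding wt_topology_def
    using zV \<rho> by (intro topology_generated_by_Basis CollectI exI[of _ ?z] exI[of _ \<rho>] exI[of _ 1]) auto
  then have "openin (wt_topology n w r) {a \<in> topspace (wt_topology n w r). f a \<in> ?B}"
    by (rule openin_continuous_map_preimage[OF cont])
  moreover have "?z \<in> {a \<in> topspace (wt_topology n w r). f a \<in> ?B}"
    using zW zV fz by (simp add: wt_norm_def)
  ultimately obtain \<sigma> \<delta> where s: "0 < \<sigma>" "ereal \<sigma> < r" "0 < \<delta>"
    "{b \<in> wt_series n w r. wt_norm n w \<sigma> (\<lambda>k. b k - ?z k) < \<delta>} \<subseteq> {a \<in> topspace (wt_topology n w r). f a \<in> ?B}"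
    using W.open_contains_ball by meson
  have lt: "wt_norm n v \<rho> (f a) < 1" if "a \<in> wt_series n w r" "wt_norm n w \<sigma> a < \<delta>" for a
    using s(4) that by auto
  have "wt_norm n v \<rho> (f a) \<le> 1 / \<delta> * wt_norm n w \<sigma> a" if a: "a \<in> wt_series n w r" for a
  proof (rule field_le_epsilon)
    fix e :: real assume "0 < e"
    \<comment> \<open>The summand \<open>e * \<delta>\<close> keeps the divisor positive when the
      norm of \<open>a\<close> vanishes and makes the rescaled norm strictly smaller than
      \<open>\<delta>\<close>; as \<open>e\<close> is arbitrary, it disappears in the end.\<close>
    let ?N = "wt_norm n w \<sigma> a + e * \<delta>"
    have N: "0 < ?N" using W.norm_nonneg[OF s(1), of a] \<open>0 < e\<close> \<open>0 < \<delta>\<close> by (simp add: add_nonneg_pos)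
    let ?c = "of_real (\<delta> / ?N) :: complex"
    have c: "cmod ?c = \<delta> / ?N" using N \<open>0 < \<delta>\<close> by (simp only: norm_of_real) simp
    have "wt_norm n w \<sigma> (\<lambda>k. ?c * a k) = \<delta> * (wt_norm n w \<sigma> a / ?N)"
      unfolding W.norm_scale c by simp
    also have "\<dots> < \<delta> * 1"
      using N \<open>0 < e\<close> \<open>0 < \<delta>\<close> by (intro mult_strict_left_mono) auto
    finally have "wt_norm n v \<rho> (f (\<lambda>k. ?c * a k)) < 1"
      by (intro lt[OF W.series_scale[OF a]]) (simp only: mult_1_right)
    then have "\<delta> / ?N * wt_norm n v \<rho> (f a) < 1" unfolding scale[OF a] V.norm_scale c .
    then have "wt_norm n v \<rho> (f a) < ?N / \<delta>" using N \<open>0 < \<delta>\<close> by (simp add: field_simps)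
    then show "wt_norm n v \<rho> (f a) \<le> 1 / \<delta> * wt_norm n w \<sigma> a + e"
      using \<open>0 < \<delta>\<close> by (simp add: add_divide_distrib)
  qed
  moreover have "0 \<le> 1 / \<delta>" using s by simp
  ultimately show ?thesis using s by blast
qed

lemma top_isomorphic_imp_wt_homs:
  assumes W: "positive_weight n w r" and V: "positive_weight n v r"
    and cl: "\<And>a b. a \<in> wt_series n w r \<Longrightarrow> b \<in> wt_series n w r \<Longrightarrow> q_mult n q a b \<in> wt_series n w r"
    and iso: "top_isomorphic (wt_algebra n q w r) (wt_algebra n q v r)"
  obtains f g where "wt_hom n w v r q f" "wt_hom n v w r q g"
    "\<And>a. a \<in> wt_series n w r \<Longrightarrow> g (f a) = a" "\<And>b. b \<in> wt_series n v r \<Longrightarrow> f (g b) = b"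
proof -
  interpret W: positive_weight n w r by fact
  interpret V: positive_weight n v r by fact
  let ?A = "wt_series n w r" and ?B = "wt_series n v r"
  obtain f where f: "f \<in> ring_iso (wt_algebra n q w r) (wt_algebra n q v r)"
    and sc: "\<And>a c. a \<in> ?A \<Longrightarrow> f (\<lambda>k. c * a k) = (\<lambda>k. c * f a k)"
    and hm: "homeomorphic_map (wt_topology n w r) (wt_topology n v r) f"
    using iso unfolding top_isomorphic_def by (auto simp: wt_algebra_def)
  have fc: "f a \<in> ?B" if "a \<in> ?A" for a
    using f that by (auto simp: ring_iso_def ring_hom_def wt_algebra_def)
  have fa: "f (\<lambda>k. a k + b k) = (\<lambda>k. f a k + f b k)" if "a \<in> ?A" "b \<in> ?A" for a b
    using f that by (auto simp: ring_iso_def ring_hom_def wt_algebra_def)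
  have fm: "f (q_mult n q a b) = q_mult n q (f a) (f b)" if "a \<in> ?A" "b \<in> ?A" for a b
    using f that by (auto simp: ring_iso_def ring_hom_def wt_algebra_def)
  have f1: "f (monom_ser (\<lambda>_. 0)) = monom_ser (\<lambda>_. 0)"
    using f by (auto simp: ring_iso_def ring_hom_def wt_algebra_def)
  obtain g where g: "homeomorphic_maps (wt_topology n w r) (wt_topology n v r) f g"
    using hm homeomorphic_map_maps by blast
  then have cf: "continuous_map (wt_topology n w r) (wt_topology n v r) f"
    and cg: "continuous_map (wt_topology n v r) (wt_topology n w r) g"
    and gf: "\<And>a. a \<in> ?A \<Longrightarrow> g (f a) = a" and fg: "\<And>b. b \<in> ?B \<Longrightarrow> f (g b) = b"
    unfolding homeomorphic_maps_def by auto
  have gc: "g b \<in> ?A" if "b \<in> ?B" for b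
    using continuous_map_image_subset_topspace[OF cg] that by auto
  have gs: "g (\<lambda>k. c * b k) = (\<lambda>k. c * g b k)" if b: "b \<in> ?B" for b c
    using gf[OF W.series_scale[OF gc[OF b]], of c] unfolding sc[OF gc[OF b]] fg[OF b] .
  have ga: "g (\<lambda>k. a k + b k) = (\<lambda>k. g a k + g b k)" if "a \<in> ?B" "b \<in> ?B" for a b
    using gf[OF W.series_add[OF gc gc], OF that] unfolding fa[OF gc gc, OF that] fg[OF that(1)] fg[OF that(2)] .
  \<comment> \<open>\<open>f\<close> sends the product of \<open>g a\<close> and \<open>g b\<close>,
    which lies in the source by \<open>cl\<close>, to the product of \<open>a\<close> and
    \<open>b\<close>. Applying \<open>g\<close> gives multiplicativity with no estimate of products
    in the target.\<close>
  have gm: "g (q_mult n q a b) = q_mult n q (g a) (g b)" if "a \<in> ?B" "b \<in> ?B" for a b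
    using gf[OF cl[OF gc gc], OF that] unfolding fm[OF gc gc, OF that] fg[OF that(1)] fg[OF that(2)] .
  have g1: "g (monom_ser (\<lambda>_. 0)) = monom_ser (\<lambda>_. 0)"
    using gf[OF W.series_monom[OF mindices_zero]] unfolding f1 .
  have bf: "\<exists>C \<sigma>. 0 \<le> C \<and> 0 < \<sigma> \<and> ereal \<sigma> < r \<and>
      (\<forall>a\<in>wt_series n w r. wt_norm n v \<rho> (f a) \<le> C * wt_norm n w \<sigma> a)"
    if "0 < \<rho>" "ereal \<rho> < r" for \<rho>
    by (rule continuous_imp_bounded[OF W V _ _ cf that]) (fact fc sc)+
  have bg: "\<exists>C \<sigma>. 0 \<le> C \<and> 0 < \<sigma> \<and> ereal \<sigma> < r \<and>
      (\<forall>a\<in>wt_series n v r. wt_norm n w \<rho> (g a) \<le> C * wt_norm n v \<sigma> a)"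
    if "0 < \<rho>" "ereal \<rho> < r" for \<rho>
    by (rule continuous_imp_bounded[OF V W _ _ cg that]) (fact gc gs)+
  have hf: "wt_hom n w v r q f"
    by (rule wt_hom.intro[OF W V], rule wt_hom_axioms.intro, erule fc, erule (1) fa, erule sc,
        erule (1) fm, rule f1, erule (1) bf)
  have hg: "wt_hom n v w r q g"
    by (rule wt_hom.intro[OF V W], rule wt_hom_axioms.intro, erule gc, erule (1) ga, erule gs,
        erule (1) gm, rule g1, erule (1) bg)
  show ?thesis by (rule that[of f g, OF hf hg gf fg])
qed

section \<open>The noncommutative unimodular case\<close>

definition single :: "nat \<Rightarrow> nat \<Rightarrow> mindex" where
  "single s p = (\<lambda>_. 0)(s := p)"

lemma single_apply: "single s p i = (if i = s then p else 0)"
  by (simp add: single_def)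

lemma gen_ser_eq: "gen_ser i = monom_ser (single i 1)"
  by (simp add: gen_ser_def single_def)

lemma single_zero: "single s 0 = (\<lambda>_. 0)"
  by (auto simp: single_apply)

lemma single_mindices: "s < n \<Longrightarrow> single s p \<in> mindices n"
  by (auto simp: mindices_def single_apply)

lemma mdeg_single: "s < n \<Longrightarrow> mdeg n (single s p) = p"
  by (simp add: mdeg_def single_apply)

lemma single_eq_iff: "single s 1 = single t 1 \<longleftrightarrow> s = t"
  by (metis single_apply one_neq_zero)

lemma single_ne_zero: "single s (Suc p) \<noteq> (\<lambda>_. 0)"
  by (metis single_apply nat.distinct(1))

lemma fun_upd_Suc_eq_single: "k(j := Suc (k j)) = single i 1 \<longleftrightarrow> i = j \<and> k = (\<lambda>_. 0)"
proof
  assume eq: "k(j := Suc (k j)) = single i 1"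
  from fun_cong[OF eq, of j] have "i = j" "k j = 0" by (auto simp: single_apply split: if_splits)
  moreover have "k l = 0" if "l \<noteq> j" for l
    using fun_cong[OF eq, of l] that \<open>i = j\<close> by (simp add: single_apply)
  ultimately show "i = j \<and> k = (\<lambda>_. 0)" by (metis ext)
qed (auto simp: single_apply fun_eq_iff)

lemma q_twist_single: "q_twist n (single s a) (single s b) = 0"
  unfolding q_twist_def by (intro sum.neutral ballI) (auto simp: single_apply)

lemma atMost_single: "{..single s p} = single s ` {..p}"
proof (intro equalityI subsetI)
  fix k assume k: "k \<in> {..single s p}"
  have le: "k i \<le> single s p i" for i using k le_funD[of k "single s p" i] by simp
  have "k i = single s (k s) i" for i using le[of i] by (auto simp: single_apply split: if_splits)
  then have "k = single s (k s)" by (rule ext)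
  moreover have "k s \<le> p" using le[of s] by (simp add: single_apply)
  ultimately show "k \<in> single s ` {..p}" by blast
qed (auto simp: le_fun_def single_apply)

text \<open>Below \<open>x_s^p\<close> there are only powers of \<open>x_s\<close>, which commute,
  so no power of \<open>q\<close> enters. Along a coordinate axis series multiply as in the
  commutative case, which is what later turns the relations into equations
  \<open>x = q * x\<close>.\<close>

lemma q_mult_coeff_single:
  "q_mult n q a b (single s p) = (\<Sum>j\<le>p. a (single s j) * b (single s (p - j)))"
proof -
  have inj: "inj_on (single s) {..p}" by (rule inj_onI) (metis single_apply)
  have "single s p - single s j = single s (p - j)" for j by (auto simp: fun_eq_iff single_apply)
  then show ?thesis unfolding q_mult_def atMost_single by (simp add: sum.reindex[OF inj] q_twist_single)
qed

lemma q_mult_coeff_zero: "q_mult n q a b (\<lambda>_. 0) = a (\<lambda>_. 0) * b (\<lambda>_. 0)"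
  using q_mult_coeff_single[of n q a b 0 0] by (simp add: single_zero)

lemma q_mult_coeff_one:
  "q_mult n q a b (single s 1) = a (\<lambda>_. 0) * b (single s 1) + a (single s 1) * b (\<lambda>_. 0)"
  by (subst q_mult_coeff_single) (simp add: single_zero)

lemma q_mult_coeff_two:
  "q_mult n q a b (single s 2) =
    a (\<lambda>_. 0) * b (single s 2) + a (single s 1) * b (single s 1) + a (single s 2) * b (\<lambda>_. 0)"
  by (subst q_mult_coeff_single) (simp add: single_zero numeral_2_eq_2)

lemma mdeg_le_one_cases:
  assumes "k \<in> mindices n" "mdeg n k \<le> 1"
  obtains "k = (\<lambda>_. 0)" | s where "s < n" "k = single s 1"
proof (cases "k = (\<lambda>_. 0)")
  case False
  then obtain s where s: "k s \<noteq> 0" by auto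
  then have sn: "s < n" using assms(1) by (auto simp: mindices_def not_less[symmetric])
  have "mdeg n k = k s + (\<Sum>i\<in>{..<n} - {s}. k i)" unfolding mdeg_def using sn by (simp add: sum.remove)
  then have ks: "k s = 1" and "(\<Sum>i\<in>{..<n} - {s}. k i) = 0" using assms(2) s by linarith+
  then have "k i = 0" if "i \<noteq> s" for i using assms(1) that by (cases "i < n") (auto simp: mindices_def)
  then have "k = single s 1" using ks by (auto simp: single_apply)
  with sn show ?thesis by (rule that(2))
qed

lemma monom_zero_coeff [simp]:
  "monom_ser (\<lambda>_. 0) (\<lambda>_. 0) = 1" "monom_ser (\<lambda>_. 0) (single s (Suc 0)) = 0"
  "monom_ser (k(i := Suc p)) (\<lambda>_. 0) = 0"
proof -
  have "(k(i := Suc p)) i \<noteq> 0" by simp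
  then have "(\<lambda>_. 0) \<noteq> k(i := Suc p)" by metis
  then show "monom_ser (k(i := Suc p)) (\<lambda>_. 0) = 0" by (simp only: monom_ser_def if_False)
qed (use single_ne_zero[of s 0] in \<open>auto simp: monom_ser_def\<close>)

text \<open>Other terms of the same total degree are excluded too, so that leading monomials
  multiply without cancellation.\<close>

definition lowest_term :: "nat \<Rightarrow> series \<Rightarrow> complex \<Rightarrow> mindex \<Rightarrow> bool" where
  "lowest_term n a c k \<longleftrightarrow>
    (\<forall>l\<in>mindices n. mdeg n l \<le> mdeg n k \<longrightarrow> a l = (if l = k then c else 0))"

text \<open>If \<open>j\<close> has degree above that of \<open>k\<close>, then \<open>m - j\<close>
  has degree below that of \<open>l\<close>, where \<open>b\<close> vanishes; otherwise
  \<open>a j\<close> vanishes unless \<open>j = k\<close>.\<close>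

lemma lowest_term_mult:
  assumes a: "lowest_term n a c k" and b: "lowest_term n b d l" and k: "k \<in> mindices n" and l: "l \<in> mindices n"
  shows "lowest_term n (q_mult n q a b) (inverse q ^ q_twist n k l * c * d) (\<lambda>i. k i + l i)"
  unfolding lowest_term_def
proof (intro ballI impI)
  fix m assume m: "m \<in> mindices n" "mdeg n m \<le> mdeg n (\<lambda>i. k i + l i)"
  have *: "a j * b (m - j) = (if j = k \<and> m - j = l then c * d else 0)" if j: "j \<le> m" for j
  proof -
    have jM: "j \<in> mindices n" "m - j \<in> mindices n" using j m mindices_le mindices_diff by blast+
    have sum: "mdeg n j + mdeg n (m - j) \<le> mdeg n k + mdeg n l" using mdeg_diff[OF j, of n] m(2) by (simp add: mdeg_add)
    show ?thesis
    proof (cases "mdeg n j \<le> mdeg n k")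
      case True
      then have aj: "a j = (if j = k then c else 0)" using a jM unfolding lowest_term_def by blast
      have "b (m - j) = (if m - j = l then d else 0)" if "j = k"
        using b jM sum that unfolding lowest_term_def by auto
      then show ?thesis using aj by auto
    next
      case False
      then have "mdeg n (m - j) \<le> mdeg n l" "m - j \<noteq> l" "j \<noteq> k" using sum by auto
      then have "b (m - j) = 0" using b jM unfolding lowest_term_def by auto
      then show ?thesis using \<open>j \<noteq> k\<close> by simp
    qed
  qed
  have eq: "q_mult n q a b m =
      (\<Sum>j\<in>{..m}. if j = k then (if m - j = l then inverse q ^ q_twist n k l * c * d else 0) else 0)"
    unfolding q_mult_def mult.assoc using * by (intro sum.cong) auto
  have "\<dots> = (if k \<le> m \<and> m - k = l then inverse q ^ q_twist n k l * c * d else 0)"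
    using finite_below[OF m(1)] by (subst sum.delta) auto
  moreover have "k \<le> m \<and> m - k = l \<longleftrightarrow> m = (\<lambda>i. k i + l i)"
  proof
    assume "k \<le> m \<and> m - k = l"
    then have "m i = k i + l i" for i using le_funD[of k m i] by auto
    then show "m = (\<lambda>i. k i + l i)" by (rule ext)
  qed (auto simp: le_fun_def fun_eq_iff)
  ultimately show "q_mult n q a b m = (if m = (\<lambda>i. k i + l i) then inverse q ^ q_twist n k l * c * d else 0)"
    unfolding eq by simp
qed

lemma (in positive_weight) lowest_term_le_norm:
  assumes "lowest_term n a c k" "k \<in> mindices n" "a \<in> wt_series n w r" "0 < \<rho>" "ereal \<rho> < r"
  shows "cmod c * w k * \<rho> ^ mdeg n k \<le> wt_norm n w \<rho> a"
  using coeff_le_norm[OF assms(3-5,2)] assms(1,2) by (simp add: lowest_term_def)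

section \<open>Constant and linear parts of a homomorphism\<close>

context wt_hom
begin

abbreviation lin :: "nat \<Rightarrow> nat \<Rightarrow> complex" where
  "lin i s \<equiv> f (gen_ser i) (single s 1)"

lemma coeff_comp_functional: "k \<in> mindices n \<Longrightarrow> bounded_functional n w r (\<lambda>a. f a k)"
  by (rule functional_comp[OF V.coeff_functional])

text \<open>A linear combination of the linear coefficients of \<^term>\<open>f a\<close> is a derivation in \<^term>\<open>a\<close>
  relative to the character \<open>a \<mapsto> f a 0\<close>, hence it is determined by its values on the generators.\<close>

lemma linear_part_eq_zero:
  assumes gen: "\<And>i. i < n \<Longrightarrow> (\<Sum>s<n. c s * lin i s) = 0" and a: "a \<in> wt_series n w r"
  shows "(\<Sum>s<n. c s * f a (single s 1)) = 0"
proof -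
  let ?T = "\<lambda>a. \<Sum>s<n. c s * f a (single s 1)"
  have T: "bounded_functional n w r ?T"
    by (rule bounded_functional_sum) (auto intro!: W.positive_weight_axioms coeff_comp_functional single_mindices)
  \<comment> \<open>The zero functional, written as an empty sum so that
    \<open>bounded_functional_sum\<close> applies.\<close>
  have T0: "bounded_functional n w r (\<lambda>a. \<Sum>s\<in>{}. c s * f a (single s 1))"
    by (rule bounded_functional_sum) (auto intro: W.positive_weight_axioms)
  have "?T (monom_ser k) = 0" if "k \<in> mindices n" for k
    using that
  proof (induction k rule: mindex_induct)
    case zero
    then show ?case by (simp add: one)
  next
    case (step i k)
    have eq: "f (monom_ser (k(i := Suc (k i)))) = q_mult n q (f (gen_ser i)) (f (monom_ser k))"
      by (rule gen_mult_monom) (use step in auto)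
    have "?T (monom_ser (k(i := Suc (k i)))) =
        f (gen_ser i) (\<lambda>_. 0) * ?T (monom_ser k) + ?T (gen_ser i) * f (monom_ser k) (\<lambda>_. 0)"
      unfolding eq q_mult_coeff_one
      by (simp add: sum_distrib_left sum_distrib_right sum.distrib algebra_simps)
    then show ?case unfolding gen[OF step(1)] step.IH mult_zero_left mult_zero_right add_0_left .
  qed
  then show ?thesis using bounded_functional_eqI[OF T T0 _ a] by simp
qed

text \<open>\<open>a \<mapsto> f a 0\<close> is a bounded functional, multiplicative by
  \<open>q_mult_coeff_zero\<close>. As it kills the generators, it agrees with the augmentation on
  monomials and hence everywhere.\<close>

lemma counit_preserved:
  assumes gen: "\<And>i. i < n \<Longrightarrow> f (gen_ser i) (\<lambda>_. 0) = 0" and a: "a \<in> wt_series n w r"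
  shows "f a (\<lambda>_. 0) = a (\<lambda>_. 0)"
proof (rule bounded_functional_eqI[OF coeff_comp_functional[OF mindices_zero] W.coeff_functional[OF mindices_zero] _ a])
  fix k assume "k \<in> mindices n"
  then show "f (monom_ser k) (\<lambda>_. 0) = monom_ser k (\<lambda>_. 0)"
  proof (induction k rule: mindex_induct)
    case (step i k)
    have eq: "f (monom_ser (k(i := Suc (k i)))) = q_mult n q (f (gen_ser i)) (f (monom_ser k))"
      by (rule gen_mult_monom) (use step in auto)
    show ?case unfolding eq q_mult_coeff_zero monom_zero_coeff gen[OF step(1)] by simp
  qed (simp add: one)
qed

text \<open>Chain rule at the augmentation: when the images of the generators have no constant term,
  the images of monomials of degree at least 2 have no linear term, so linear parts are transformed
  by the matrix \<open>lin\<close> alone.\<close>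

lemma linear_part:
  assumes gen: "\<And>i. i < n \<Longrightarrow> f (gen_ser i) (\<lambda>_. 0) = 0" and a: "a \<in> wt_series n w r" and s: "s < n"
  shows "f a (single s 1) = (\<Sum>i<n. lin i s * a (single i 1))"
proof (rule bounded_functional_eqI[OF coeff_comp_functional[OF single_mindices[OF s]] bounded_functional_sum _ a])
  show "bounded_functional n w r (\<lambda>a. a (single i 1))" if "i \<in> {..<n}" for i
    using that by (intro W.coeff_functional single_mindices) simp
  fix k assume "k \<in> mindices n"
  then show "f (monom_ser k) (single s 1) = (\<Sum>i<n. lin i s * monom_ser k (single i 1))"
  proof (induction k rule: mindex_induct)
    case zero
    then show ?case by (simp add: one)
  next
    case (step j k)
    have eq: "f (monom_ser (k(j := Suc (k j)))) = q_mult n q (f (gen_ser j)) (f (monom_ser k))"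
      by (rule gen_mult_monom) (use step in auto)
    have e: "single i 1 = k(j := Suc (k j)) \<longleftrightarrow> i = j \<and> k = (\<lambda>_. 0)" for i
      unfolding fun_upd_Suc_eq_single[symmetric] by (rule eq_commute)
    have "f (monom_ser (k(j := Suc (k j)))) (single s 1) = lin j s * f (monom_ser k) (\<lambda>_. 0)"
      using gen[OF step(1)] unfolding eq q_mult_coeff_one by simp
    also have "f (monom_ser k) (\<lambda>_. 0) = (if k = (\<lambda>_. 0) then 1 else 0)"
      by (subst counit_preserved[OF gen W.series_monom[OF step(2)]]) (auto simp: monom_ser_def)
    also have "lin j s * \<dots> = (\<Sum>i<n. if i = j then lin j s * (if k = (\<lambda>_. 0) then 1 else 0) else 0)"
      using step(1) by simp
    also have "\<dots> = (\<Sum>i<n. lin i s * monom_ser (k(j := Suc (k j))) (single i 1))"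
      by (intro sum.cong) (simp_all only: monom_ser_def e, auto)
    finally show ?case .
  qed
qed (auto intro: W.positive_weight_axioms)

text \<open>Powers of one variable have no twist, so the leading coefficient is simply a power of
  \<open>c\<close>; its modulus is all that enters the norm estimates.\<close>

lemma lowest_term_power:
  assumes q: "cmod q = 1" and i: "i < n" and s: "s < n" and low: "lowest_term n (f (gen_ser i)) c (single s 1)"
  shows "\<exists>d. cmod d = cmod c ^ m \<and> lowest_term n (f (monom_ser (single i m))) d (single s m)"
proof (induction m)
  case 0
  have "l = (\<lambda>_. 0)" if "l \<in> mindices n" "mdeg n l = 0" for l
    using that by (auto simp: mdeg_def mindices_def fun_eq_iff not_less[symmetric])
  then have "lowest_term n (monom_ser (\<lambda>_. 0)) 1 (\<lambda>_. 0)"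
    unfolding lowest_term_def by (auto simp: monom_ser_def)
  then show ?case by (intro exI[of _ 1]) (simp add: single_zero one)
next
  case (Suc m)
  then obtain d where d: "cmod d = cmod c ^ m" "lowest_term n (f (monom_ser (single i m))) d (single s m)" by blast
  have "(single i m)(i := Suc (single i m i)) = single i (Suc m)" by (auto simp: single_apply)
  moreover have "f (monom_ser ((single i m)(i := Suc (single i m i)))) =
      q_mult n q (f (gen_ser i)) (f (monom_ser (single i m)))"
    by (rule gen_mult_monom[OF single_mindices[OF i] i]) (simp add: single_apply)
  ultimately have eq: "f (monom_ser (single i (Suc m))) = q_mult n q (f (gen_ser i)) (f (monom_ser (single i m)))"
    by simp
  have s1: "(\<lambda>i. single s 1 i + single s m i) = single s (Suc m)" by (auto simp: single_apply)
  have "lowest_term n (f (monom_ser (single i (Suc m)))) (c * d) (single s (Suc m))"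
    using lowest_term_mult[OF low d(2) single_mindices[OF s] single_mindices[OF s], of q]
    unfolding eq s1 by (simp add: q_twist_single)
  then show ?case using d(1) by (intro exI[of _ "c * d"]) (simp add: norm_mult)
qed

end

text \<open>The constant disappears in m-th roots, so continuity estimates with unknown constants
  still compare exponential rates.\<close>

lemma power_le_imp_base_le:
  fixes x y C :: real
  assumes "0 \<le> x" "0 < y" "\<And>m. x ^ m \<le> C * y ^ m"
  shows "x \<le> y"
proof (rule ccontr)
  assume "\<not> x \<le> y"
  then have "1 < x / y" using assms by simp
  then obtain m where "C < (x / y) ^ m" using real_arch_pow by blast
  then show False using assms(3)[of m] assms(2) by (simp add: power_divide field_simps)
qed

section \<open>Exponential rates of the ball weight for unimodular q\<close>

lemma ball_wt_unimodular:
  "cmod q = 1 \<Longrightarrow> ball_wt n q k = sqrt ((\<Prod>i<n. fact (k i)) / fact (mdeg n k))"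
proof -
  assume q: "cmod q = 1"
  have "t_int 1 m = of_nat m" for m by (simp add: t_int_def)
  then have "t_fact 1 m = fact m" for m
    by (simp add: t_fact_def fact_prod)
  then show ?thesis by (simp add: ball_wt_def q t_mfact_def)
qed

lemma polydisk_wt_unimodular: "cmod q = 1 \<Longrightarrow> polydisk_wt n q = (\<lambda>_. 1)"
  by (simp add: polydisk_wt_def fun_eq_iff)

lemma ball_wt_single:
  assumes "cmod q = 1" "s < n"
  shows "ball_wt n q (single s m) = 1"
proof -
  have "(\<Prod>i<n. fact (single s m i)) = (fact m :: real)"
    using assms(2) by (subst prod.remove[of _ s]) (auto intro!: prod.neutral simp: single_apply)
  then show ?thesis by (simp add: ball_wt_unimodular assms mdeg_single)
qed

text \<open>This is \<open>2 ^ m \<le> (2m choose m)\<close>; consecutive central binomials have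
  quotient \<open>2 (2m + 1) / (m + 1)\<close>, which is at least 2.\<close>

lemma power2_fact_le: "2 ^ m * (fact m * fact m) \<le> (fact (2 * m) :: real)"
proof (induction m)
  case (Suc m)
  have "(2::real) ^ Suc m * (fact (Suc m) * fact (Suc m)) =
      (2 * (real m + 1) * (real m + 1)) * (2 ^ m * (fact m * fact m))"
    by (simp add: algebra_simps)
  also have "\<dots> \<le> ((2 * real m + 2) * (2 * real m + 1)) * fact (2 * m)"
    by (rule mult_mono[OF _ Suc]) (auto simp: algebra_simps)
  also have "\<dots> = fact (2 * Suc m)" by (simp add: algebra_simps)
  finally show ?case .
qed simp

text \<open>The weight is \<open>(2m choose m)\<close> to the power -1/2. Powers of one variable
  have weight 1 as in the polydisk; this mixed family is where the two algebras part
  exponentially.\<close>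

lemma ball_wt_two:
  assumes "cmod q = 1" "s < n" "t < n" "s \<noteq> t"
  shows "ball_wt n q (\<lambda>i. single s m i + single t m i) \<le> (1 / sqrt 2) ^ m"
proof -
  let ?k = "\<lambda>i. single s m i + single t m i"
  have "(\<Prod>i<n. fact (?k i)) = (fact m * fact m :: real)"
  proof -
    have "(\<Prod>i<n. fact (?k i)) = fact (?k s) * (\<Prod>i\<in>{..<n} - {s}. fact (?k i) :: real)"
      using assms by (subst prod.remove[of _ s]) auto
    also have "(\<Prod>i\<in>{..<n} - {s}. fact (?k i) :: real) = fact (?k t) * (\<Prod>i\<in>{..<n} - {s} - {t}. fact (?k i))"
      using assms by (subst prod.remove[of _ t]) auto
    also have "(\<Prod>i\<in>{..<n} - {s} - {t}. fact (?k i) :: real) = 1" by (rule prod.neutral) (auto simp: single_apply)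
    finally show ?thesis using assms by (simp add: single_apply)
  qed
  moreover have "mdeg n ?k = 2 * m" unfolding mdeg_add mdeg_single[OF assms(2)] mdeg_single[OF assms(3)] by simp
  ultimately have "ball_wt n q ?k = sqrt (fact m * fact m / fact (2 * m))"
    by (simp only: ball_wt_unimodular[OF assms(1)])
  also have "\<dots> \<le> sqrt (1 / 2 ^ m)"
    using power2_fact_le[of m] by (intro real_sqrt_le_mono) (simp add: field_simps)
  also have "\<dots> = (1 / sqrt 2) ^ m" by (simp add: real_sqrt_divide real_sqrt_power power_divide)
  finally show ?thesis .
qed

section \<open>The contradiction for q other than 1\<close>

locale unimodular_iso =
  F: wt_hom n "\<lambda>_. 1" "ball_wt n q" "ereal R" q f + G: wt_hom n "ball_wt n q" "\<lambda>_. 1" "ereal R" q g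
  for n q R f g +
  assumes gf: "a \<in> wt_series n (\<lambda>_. 1) (ereal R) \<Longrightarrow> g (f a) = a"
    and fg: "b \<in> wt_series n (ball_wt n q) (ereal R) \<Longrightarrow> f (g b) = b"
    and n2: "2 \<le> n" and R: "0 < R" and q: "cmod q = 1"
begin

lemma relation:
  assumes "i < j" "j < n"
  shows "q_mult n q (f (gen_ser i)) (f (gen_ser j)) m = q * q_mult n q (f (gen_ser j)) (f (gen_ser i)) m"
proof -
  have i: "gen_ser i \<in> wt_series n (\<lambda>_. 1) (ereal R)" and j: "gen_ser j \<in> wt_series n (\<lambda>_. 1) (ereal R)"
    using assms by (auto intro: F.W.series_gen)
  have c: "q_mult n q (gen_ser j) (gen_ser i) \<in> wt_series n (\<lambda>_. 1) (ereal R)"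
    by (rule q_mult_closed_polydisk[OF q j i])
  have "q \<noteq> 0" using q by auto
  from F.scale[OF c, of q] show ?thesis
    unfolding q_mult_gen[OF assms \<open>q \<noteq> 0\<close>, symmetric] F.mult[OF i j] F.mult[OF j i] by metis
qed

text \<open>At 1, \<open>x_s\<close> and \<open>x_s^2\<close> both orders of the product have the
  same coefficient, because multiplication along an axis is commutative. By \<open>relation\<close>
  each such coefficient is \<open>q\<close> times itself, hence 0. In the third statement vanishing
  constant terms isolate the product of the linear coefficients.\<close>

lemma noncommutative_relations:
  assumes "q \<noteq> 1" "i < n" "j < n" "i \<noteq> j"
  shows "f (gen_ser i) (\<lambda>_. 0) * f (gen_ser j) (\<lambda>_. 0) = 0"
    and "f (gen_ser i) (\<lambda>_. 0) * F.lin j s + f (gen_ser j) (\<lambda>_. 0) * F.lin i s = 0"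
    and "f (gen_ser i) (\<lambda>_. 0) = 0 \<Longrightarrow> f (gen_ser j) (\<lambda>_. 0) = 0 \<Longrightarrow> F.lin i s * F.lin j s = 0"
proof -
  have *: "f (gen_ser i) (\<lambda>_. 0) * f (gen_ser j) (\<lambda>_. 0) = 0 \<and>
      f (gen_ser i) (\<lambda>_. 0) * F.lin j s + f (gen_ser j) (\<lambda>_. 0) * F.lin i s = 0 \<and>
      (f (gen_ser i) (\<lambda>_. 0) = 0 \<longrightarrow> f (gen_ser j) (\<lambda>_. 0) = 0 \<longrightarrow> F.lin i s * F.lin j s = 0)"
    if ij: "i < j" "j < n" for i j
  proof -
    have z: "x = 0" if "x = q * x" for x :: complex
      using that assms(1) by (metis mult_cancel_right1)
    have 0: "f (gen_ser i) (\<lambda>_. 0) * f (gen_ser j) (\<lambda>_. 0) = 0"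
      using relation[OF ij, of "\<lambda>_. 0"] unfolding q_mult_coeff_zero by (intro z) (simp add: mult.commute)
    have 1: "f (gen_ser i) (\<lambda>_. 0) * F.lin j s + f (gen_ser j) (\<lambda>_. 0) * F.lin i s = 0"
      using relation[OF ij, of "single s 1"] unfolding q_mult_coeff_one
      by (intro z) (simp add: mult.commute add.commute)
    have 2: "F.lin i s * F.lin j s = 0" if "f (gen_ser i) (\<lambda>_. 0) = 0" "f (gen_ser j) (\<lambda>_. 0) = 0"
      using relation[OF ij, of "single s 2"] that unfolding q_mult_coeff_two
      by (intro z) (simp add: mult.commute)
    show ?thesis using 0 1 2 by blast
  qed
  consider "i < j" | "j < i" using assms(4) by linarith
  note cases = this
  show "f (gen_ser i) (\<lambda>_. 0) * f (gen_ser j) (\<lambda>_. 0) = 0"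
    using cases *[of i j] *[of j i] assms by (metis mult.commute)
  show "f (gen_ser i) (\<lambda>_. 0) * F.lin j s + f (gen_ser j) (\<lambda>_. 0) * F.lin i s = 0"
    using cases *[of i j] *[of j i] assms by (metis add.commute)
  show "F.lin i s * F.lin j s = 0" if "f (gen_ser i) (\<lambda>_. 0) = 0" "f (gen_ser j) (\<lambda>_. 0) = 0"
    using cases *[of i j] *[of j i] assms that by (metis mult.commute)
qed

text \<open>If \<open>q \<noteq> 1\<close>, then at every character other than the augmentation the space of
  derivations is at most one-dimensional.\<close>

lemma counit_gen:
  assumes "q \<noteq> 1" "i < n"
  shows "f (gen_ser i) (\<lambda>_. 0) = 0"
proof (rule ccontr)
  assume nz: "f (gen_ser i) (\<lambda>_. 0) \<noteq> 0"
  have lin0: "F.lin j s = 0" if "j < n" "j \<noteq> i" for j s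
    using noncommutative_relations(1)[OF assms that(1)] noncommutative_relations(2)[OF assms that(1), of s] nz that
    by auto
  \<comment> \<open>All generators except the \<open>i\<close>-th have zero linear image, and two
    coordinates leave room for a nonzero functional \<open>(x, y)\<close> that kills row
    \<open>i\<close> as well. It then kills the linear part of every \<open>f a\<close>, in
    particular of the generators 0 and 1 of the target, which lie in the image.\<close>
  have ex: "\<exists>x y. (x \<noteq> 0 \<or> y \<noteq> 0) \<and> x * F.lin i 0 + y * F.lin i 1 = 0"
  proof (cases "F.lin i 0 = 0")
    case True
    then show ?thesis by (intro exI[of _ 1] exI[of _ 0]) simp
  next
    case False
    then show ?thesis by (intro exI[of _ "F.lin i 1"] exI[of _ "- F.lin i 0"]) simp
  qed
  then obtain x y where xy: "x \<noteq> 0 \<or> y \<noteq> 0" "x * F.lin i 0 + y * F.lin i 1 = 0" by blast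
  define c where "c = (\<lambda>s::nat. if s = 0 then x else if s = 1 then y else 0)"
  have two: "(\<Sum>s<n. c s * h s) = x * h 0 + y * h 1" for h
  proof -
    have "(\<Sum>s<n. c s * h s) = (\<Sum>s\<in>{0,1}. c s * h s)"
      using n2 by (intro sum.mono_neutral_right) (auto simp: c_def)
    then show ?thesis by (simp add: c_def)
  qed
  have "(\<Sum>s<n. c s * F.lin j s) = 0" if "j < n" for j
    using lin0[OF that] xy unfolding two by (cases "j = i") auto
  then have all: "(\<Sum>s<n. c s * f a (single s 1)) = 0" if "a \<in> wt_series n (\<lambda>_. 1) (ereal R)" for a
    using that by (rule F.linear_part_eq_zero)
  have "x * gen_ser t (single 0 1) + y * gen_ser t (single 1 1) = 0" if "t < n" for t
    using all[OF G.closed[OF F.V.series_gen[OF that]]] unfolding two fg[OF F.V.series_gen[OF that]] .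
  from this[of 0] this[of 1] xy(1) n2 show False
    unfolding gen_ser_eq monom_ser_def single_eq_iff by simp
qed

lemma noncommutative_contradiction:
  assumes q1: "q \<noteq> 1" shows False
proof -
  let ?A = "wt_series n (\<lambda>_. 1) (ereal R)" and ?B = "wt_series n (ball_wt n q) (ereal R)"
  note cf = counit_gen[OF q1]
  have cg: "g (gen_ser s) (\<lambda>_. 0) = 0" if "s < n" for s
  proof -
    have "g (gen_ser s) (\<lambda>_. 0) = f (g (gen_ser s)) (\<lambda>_. 0)"
      by (rule F.counit_preserved[OF cf G.closed[OF F.V.series_gen[OF that]], symmetric])
    then show ?thesis unfolding fg[OF F.V.series_gen[OF that]]
      using single_ne_zero[of s 0] by (simp add: gen_ser_eq monom_ser_def)
  qed
  have gs: "gen_ser i (single j 1) = (if i = j then 1 else 0)" for i j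
    unfolding gen_ser_eq monom_ser_def single_eq_iff by auto
  \<comment> \<open>Linear parts compose, so the matrices of \<open>f\<close> and \<open>g\<close>
    are mutually inverse.\<close>
  have PQ: "(\<Sum>s<n. G.lin s j * F.lin i s) = (if i = j then 1 else 0)" if "i < n" "j < n" for i j
    using G.linear_part[OF cg F.closed[OF F.W.series_gen[OF that(1)]] that(2)]
    unfolding gf[OF F.W.series_gen[OF that(1)]] gs by simp
  have QP: "(\<Sum>i<n. F.lin i t * G.lin s i) = (if s = t then 1 else 0)" if "s < n" "t < n" for s t
    using F.linear_part[OF cf G.closed[OF F.V.series_gen[OF that(1)]] that(2)]
    unfolding fg[OF F.V.series_gen[OF that(1)]] gs by simp
  have col: "F.lin i s * F.lin j s = 0" if "i < n" "j < n" "i \<noteq> j" for i j s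
    using noncommutative_relations(3)[OF q1 that] cf that by blast
  \<comment> \<open>By \<open>col\<close> every column of the matrix of \<open>f\<close> has at most
    one nonzero entry. Invertibility then makes it a monomial matrix whose inverse has the
    reciprocal entries.\<close>
  have row: "\<exists>s<n. F.lin i s \<noteq> 0 \<and> (\<forall>t<n. t \<noteq> s \<longrightarrow> F.lin i t = 0) \<and>
      (\<forall>j<n. G.lin s j = (if j = i then 1 / F.lin i s else 0))" if i: "i < n" for i
  proof -
    have "\<exists>s<n. G.lin s i * F.lin i s \<noteq> 0"
      using PQ[OF i i] by (metis (no_types, lifting) lessThan_iff one_neq_zero sum.neutral)
    then obtain s where s: "s < n" "G.lin s i \<noteq> 0" "F.lin i s \<noteq> 0" by auto
    have t0: "F.lin i t = 0" if t: "t < n" "t \<noteq> s" for t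
    proof (rule ccontr)
      assume nz: "F.lin i t \<noteq> 0"
      have "(\<Sum>j<n. F.lin j t * G.lin s j) = (\<Sum>j<n. if j = i then F.lin i t * G.lin s i else 0)"
        using col[OF i, of _ t] nz by (intro sum.cong) auto
      then have "F.lin i t * G.lin s i = 0" using QP[OF s(1) t(1)] t i by simp
      then show False using nz s by simp
    qed
    have "G.lin s j = (if j = i then 1 / F.lin i s else 0)" if j: "j < n" for j
    proof -
      have "(\<Sum>t<n. G.lin t j * F.lin i t) = (\<Sum>t<n. if t = s then G.lin s j * F.lin i s else 0)"
        using t0 by (intro sum.cong) auto
      then have "G.lin s j * F.lin i s = (if i = j then 1 else 0)" using PQ[OF i j] s by simp
      then show ?thesis using s by (auto simp: field_simps split: if_splits)
    qed
    then show ?thesis using s t0 by blast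
  qed
  have low: "lowest_term n a c (single s 1)" if "s < n" "a (\<lambda>_. 0) = 0" "a (single s 1) = c"
    "\<And>t. t < n \<Longrightarrow> t \<noteq> s \<Longrightarrow> a (single t 1) = 0" for a c s
    unfolding lowest_term_def
  proof (intro ballI impI)
    fix l assume l: "l \<in> mindices n" "mdeg n l \<le> mdeg n (single s 1)"
    then have "mdeg n l \<le> 1" using mdeg_single[OF that(1)] by simp
    with l(1) show "a l = (if l = single s 1 then c else 0)"
    proof (cases rule: mdeg_le_one_cases)
      case 1
      then show ?thesis using that(2) single_ne_zero[of s 0] by auto
    next
      case (2 t)
      then show ?thesis using that(3,4) single_eq_iff by auto
    qed
  qed
  have lowF: "cmod (F.lin i s) \<le> 1"
    if i: "i < n" and s: "s < n" "\<And>t. t < n \<Longrightarrow> t \<noteq> s \<Longrightarrow> F.lin i t = 0" for i s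
  proof (rule ccontr)
    assume "\<not> cmod (F.lin i s) \<le> 1"
    then have c: "1 < cmod (F.lin i s)" by simp
    \<comment> \<open>At this radius the leading term of \<open>f (x_i^m)\<close> has norm exactly
      \<open>R ^ m\<close>, whereas continuity allows only \<open>C * \<sigma> ^ m\<close> with
      \<open>\<sigma> < R\<close>.\<close>
    define \<rho> where "\<rho> = R / cmod (F.lin i s)"
    have \<rho>: "0 < \<rho>" "ereal \<rho> < ereal R" using c R order_less_trans[OF zero_less_one c] by (simp_all add: \<rho>_def pos_divide_less_eq)
    obtain C \<sigma> where C: "0 < \<sigma>" "ereal \<sigma> < ereal R"
      "\<And>a. a \<in> ?A \<Longrightarrow> wt_norm n (ball_wt n q) \<rho> (f a) \<le> C * wt_norm n (\<lambda>_. 1) \<sigma> a"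
      using F.bounded[OF \<rho>] by blast
    have "cmod (F.lin i s) * \<rho> \<le> \<sigma>"
    proof (rule power_le_imp_base_le[OF _ C(1)])
      fix m
      obtain d where d: "cmod d = cmod (F.lin i s) ^ m"
        "lowest_term n (f (monom_ser (single i m))) d (single s m)"
        using F.lowest_term_power[OF q i s(1) low[of s "f (gen_ser i)", OF s(1) cf[OF i] refl s(2)]] by blast
      have "cmod d * ball_wt n q (single s m) * \<rho> ^ mdeg n (single s m) \<le>
          wt_norm n (ball_wt n q) \<rho> (f (monom_ser (single i m)))"
        by (rule F.V.lowest_term_le_norm[OF d(2) single_mindices[OF s(1)]
            F.closed[OF F.W.series_monom[OF single_mindices[OF i]]] \<rho>])
      also have "\<dots> \<le> C * wt_norm n (\<lambda>_. 1) \<sigma> (monom_ser (single i m))"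
        by (rule C(3)[OF F.W.series_monom[OF single_mindices[OF i]]])
      finally show "(cmod (F.lin i s) * \<rho>) ^ m \<le> C * \<sigma> ^ m"
        unfolding F.W.norm_monom[OF single_mindices[OF i]] ball_wt_single[OF q s(1)] d(1)
          mdeg_single[OF s(1)] mdeg_single[OF i] power_mult_distrib by simp
    qed (use \<rho> in simp)
    moreover have "cmod (F.lin i s) * \<rho> = R" using c by (auto simp: \<rho>_def)
    ultimately show False using C(2) by simp
  qed
  have i0: "0 < n" and i1: "1 < n" using n2 by auto
  obtain s where s: "s < n" "F.lin 0 s \<noteq> 0" "\<And>t. t < n \<Longrightarrow> t \<noteq> s \<Longrightarrow> F.lin 0 t = 0"
    "\<And>j. j < n \<Longrightarrow> G.lin s j = (if j = 0 then 1 / F.lin 0 s else 0)" using row[OF i0] by blast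
  obtain t where t: "t < n" "F.lin 1 t \<noteq> 0" "\<And>s. s < n \<Longrightarrow> s \<noteq> t \<Longrightarrow> F.lin 1 s = 0"
    "\<And>j. j < n \<Longrightarrow> G.lin t j = (if j = 1 then 1 / F.lin 1 t else 0)" using row[OF i1] by blast
  have st: "s \<noteq> t" using col[OF i0 i1, of s] s(2) t(2) by auto
  have lowG: "lowest_term n (g (gen_ser s)) (1 / F.lin 0 s) (single 0 1)"
    "lowest_term n (g (gen_ser t)) (1 / F.lin 1 t) (single 1 1)"
  proof -
    show "lowest_term n (g (gen_ser s)) (1 / F.lin 0 s) (single 0 1)"
      by (rule low[of _ "g (gen_ser s)", OF i0 cg[OF s(1)]]) (subst s(4); simp add: i0)+
    show "lowest_term n (g (gen_ser t)) (1 / F.lin 1 t) (single 1 1)"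
      by (rule low[of _ "g (gen_ser t)", OF i1 cg[OF t(1)]]) (subst t(4); simp add: i1[unfolded One_nat_def])+
  qed
  \<comment> \<open>The square 0.81 of the factor must exceed \<open>1 / sqrt 2\<close>; the latter
    is at most 3/4 because \<open>4 / 3 \<le> sqrt 2\<close>.\<close>
  define \<rho> where "\<rho> = 9 / 10 * R"
  have \<rho>: "0 < \<rho>" "ereal \<rho> < ereal R" using R by (auto simp: \<rho>_def)
  obtain C \<sigma> where C: "0 \<le> C" "0 < \<sigma>" "ereal \<sigma> < ereal R"
    "\<And>b. b \<in> ?B \<Longrightarrow> wt_norm n (\<lambda>_. 1) \<rho> (g b) \<le> C * wt_norm n (ball_wt n q) \<sigma> b"
    using G.bounded[OF \<rho>] by blast
  have "\<rho>\<^sup>2 \<le> \<sigma>\<^sup>2 / sqrt 2"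
  proof (rule power_le_imp_base_le)
    fix m
    let ?k = "\<lambda>i. single s m i + single t m i" and ?l = "\<lambda>i. single 0 m i + single 1 m i"
    note ms = single_mindices[OF s(1), of m] and mt = single_mindices[OF t(1), of m]
    note m0 = single_mindices[OF i0, of m] and m1 = single_mindices[OF i1, of m]
    obtain d where d: "cmod d = cmod (1 / F.lin 0 s) ^ m"
      "lowest_term n (g (monom_ser (single s m))) d (single 0 m)"
      using G.lowest_term_power[OF q s(1) i0 lowG(1)] by blast
    obtain e where e: "cmod e = cmod (1 / F.lin 1 t) ^ m"
      "lowest_term n (g (monom_ser (single t m))) e (single 1 m)"
      using G.lowest_term_power[OF q t(1) i1 lowG(2)] by blast
    let ?b = "q_mult n q (monom_ser (single s m)) (monom_ser (single t m))"
    have beq: "?b = (\<lambda>l. inverse q ^ q_twist n (single s m) (single t m) * monom_ser ?k l)"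
      by (rule q_mult_monom[OF ms mt])
    have b: "?b \<in> ?B" unfolding beq by (intro F.V.series_scale F.V.series_monom mindices_add ms mt)
    have gb: "g ?b = q_mult n q (g (monom_ser (single s m))) (g (monom_ser (single t m)))"
      by (rule G.mult[OF F.V.series_monom[OF ms] F.V.series_monom[OF mt]])
    have "cmod (inverse q ^ q_twist n (single 0 m) (single 1 m) * d * e) * 1 * \<rho> ^ mdeg n ?l \<le>
        wt_norm n (\<lambda>_. 1) \<rho> (g ?b)"
      by (rule F.W.lowest_term_le_norm[OF _ mindices_add[OF m0 m1] G.closed[OF b] \<rho>])
         (unfold gb, rule lowest_term_mult[OF d(2) e(2) m0 m1])
    also have "\<dots> \<le> C * wt_norm n (ball_wt n q) \<sigma> ?b" by (rule C(4)[OF b])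
    also have "wt_norm n (ball_wt n q) \<sigma> ?b = ball_wt n q ?k * \<sigma> ^ mdeg n ?k"
      unfolding beq F.V.norm_scale F.V.norm_monom[OF mindices_add[OF ms mt]]
      by (simp add: norm_power norm_inverse q)
    also have "\<dots> \<le> (1 / sqrt 2) ^ m * \<sigma> ^ mdeg n ?k"
      by (rule mult_right_mono[OF ball_wt_two[OF q s(1) t(1) st]]) (use C in simp)
    finally have "cmod d * cmod e * \<rho> ^ mdeg n ?l \<le> C * ((1 / sqrt 2) ^ m * \<sigma> ^ mdeg n ?k)"
      using C(1) by (simp add: norm_mult norm_power norm_inverse q mult_left_mono)
    \<comment> \<open>By \<open>lowF\<close> the entries of \<open>f\<close> have modulus at most 1,
      so the reciprocal entries of \<open>g\<close> do not shrink the leading coefficients.\<close>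
    moreover have "1 \<le> cmod d" "1 \<le> cmod e"
      using lowF[OF i0 s(1,3)] lowF[OF i1 t(1,3)] s(2) t(2)
      unfolding d(1) e(1) by (auto simp: norm_divide intro!: one_le_power)
    then have "1 * 1 * \<rho> ^ mdeg n ?l \<le> cmod d * cmod e * \<rho> ^ mdeg n ?l"
      using \<rho> by (intro mult_mono) auto
    moreover have "mdeg n ?l = 2 * m" "mdeg n ?k = 2 * m"
      using i0 i1 s(1) t(1) by (simp_all only: mdeg_add mdeg_single mult_2)
    ultimately have "\<rho> ^ (2 * m) \<le> C * ((1 / sqrt 2) ^ m * \<sigma> ^ (2 * m))" by simp
    also have "(1 / sqrt 2) ^ m * \<sigma> ^ (2 * m) = (\<sigma>\<^sup>2 / sqrt 2) ^ m"
      by (simp add: power_mult power_divide)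
    finally show "(\<rho>\<^sup>2) ^ m \<le> C * (\<sigma>\<^sup>2 / sqrt 2) ^ m" by (simp only: power_mult)
  qed (use C in auto)
  also have "\<dots> \<le> R\<^sup>2 / sqrt 2" using C by (intro divide_right_mono power_mono) auto
  also have "\<dots> \<le> R\<^sup>2 / (4 / 3)"
    using R by (intro divide_left_mono real_le_rsqrt) (auto simp: power2_eq_square)
  finally show False using R by (simp add: \<rho>_def power2_eq_square field_simps)
qed

end

section \<open>Points and evaluation\<close>

text \<open>Polymorphic, because the same product is formed for a complex point, for its moduli and
  for their squares.\<close>

definition monom_at :: "nat \<Rightarrow> (nat \<Rightarrow> 'a) \<Rightarrow> mindex \<Rightarrow> 'a :: comm_monoid_mult" where
  "monom_at n z k = (\<Prod>i<n. z i ^ k i)"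

lemma monom_at_zero [simp]: "monom_at n z (\<lambda>_. 0) = 1"
  by (simp add: monom_at_def)

lemma monom_at_Suc: "i < n \<Longrightarrow> monom_at n z (k(i := Suc (k i))) = z i * monom_at n z k"
  unfolding monom_at_def by (subst (1 2) prod.remove[of _ i]) (auto simp: mult.assoc)

lemma monom_at_single: "i < n \<Longrightarrow> monom_at n z (single i m) = z i ^ m"
  unfolding monom_at_def by (subst prod.remove[of _ i]) (auto simp: single_apply intro!: prod.neutral)

lemma monom_at_diff:
  assumes "k \<le> m" shows "monom_at n z k * monom_at n z (m - k) = monom_at n z m"
proof -
  have "k i + (m - k) i = m i" for i using le_funD[OF assms, of i] by simp
  then show ?thesis unfolding monom_at_def prod.distrib[symmetric] power_add[symmetric] by simp
qed

lemma norm_monom_at: "norm (monom_at n z k :: complex) = monom_at n (\<lambda>i. norm (z i)) k"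
  by (simp add: monom_at_def prod_norm[symmetric] norm_power)

section \<open>Multinomial expansion and the ball weight\<close>

abbreviation mindices_deg :: "nat \<Rightarrow> nat \<Rightarrow> mindex set" where
  "mindices_deg n d \<equiv> {k \<in> mindices n. mdeg n k = d}"

lemma finite_mindices_deg: "finite (mindices_deg n d)"
  and card_mindices_deg: "card (mindices_deg n d) \<le> (d + 1) ^ n"
proof -
  let ?P = "PiE {..<n} (\<lambda>_. {..d})" and ?h = "\<lambda>g i. if i < n then g i else 0"
  have sub: "mindices_deg n d \<subseteq> ?h ` ?P"
  proof
    fix k assume k: "k \<in> mindices_deg n d"
    have "k = ?h (restrict k {..<n})" using k by (auto simp: mindices_def fun_eq_iff)
    moreover have "k i \<le> d" if "i < n" for i
      using member_le_sum[of i "{..<n}" k] that k by (auto simp: mdeg_def)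
    then have "restrict k {..<n} \<in> ?P" by auto
    ultimately show "k \<in> ?h ` ?P" by (rule image_eqI)
  qed
  have fin: "finite ?P" by (intro finite_PiE) auto
  then show "finite (mindices_deg n d)" using sub by (rule finite_subset[OF _ finite_imageI, rotated])
  have "card (mindices_deg n d) \<le> card (?h ` ?P)" by (rule card_mono[OF finite_imageI[OF fin] sub])
  also have "\<dots> \<le> card ?P" by (rule card_image_le[OF fin])
  also have "\<dots> = (d + 1) ^ n" by (simp add: card_PiE)
  finally show "card (mindices_deg n d) \<le> (d + 1) ^ n" .
qed

lemma multinomial_theorem:
  fixes x :: "nat \<Rightarrow> real"
  shows "(\<Sum>i<n. x i) ^ d = (\<Sum>k\<in>mindices_deg n d. fact d / (\<Prod>i<n. fact (k i)) * monom_at n x k)"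
proof (induction d)
  case 0
  have "mindices_deg n 0 = {\<lambda>_. 0}"
    by (auto simp: mindices_def mdeg_def fun_eq_iff not_less[symmetric])
  then show ?case by simp
next
  case (Suc d)
  let ?M = "\<lambda>d k. fact d / (\<Prod>i<n. fact (k i)) :: real" and ?u = "\<lambda>i k. k(i := Suc (k i)) :: mindex"
  \<comment> \<open>Multiplication by \<open>x i\<close> shifts \<open>k\<close> to
    \<open>k + e_i\<close>. What arrives at degree \<open>d + 1\<close> is the fraction
    \<open>k_i / (d + 1)\<close> of the new multinomial term, and these fractions sum to 1 over
    \<open>i\<close>.\<close>
  have step: "x i * (\<Sum>k\<in>mindices_deg n d. ?M d k * monom_at n x k) =
      (\<Sum>k\<in>mindices_deg n (Suc d). real (k i) / real (Suc d) * (?M (Suc d) k * monom_at n x k))"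
    if i: "i < n" for i
  proof -
    have inj: "inj_on (?u i) (mindices_deg n d)"
    proof (rule inj_onI)
      fix k l assume eq: "?u i k = ?u i l"
      have "k j = l j" for j using fun_cong[OF eq, of j] by (auto split: if_splits)
      then show "k = l" by (rule ext)
    qed
    have M: "real (Suc (k i)) / real (Suc d) * ?M (Suc d) (?u i k) = ?M d k" for k
    proof -
      have "(\<Prod>j<n. fact (?u i k j)) = real (Suc (k i)) * (\<Prod>j<n. fact (k j))"
        using i by (subst (1 2) prod.remove[of _ i]) auto
      moreover have "fact (Suc d) = real (Suc d) * fact d" by (rule fact_Suc)
      ultimately show ?thesis by (simp del: of_nat_Suc fact_Suc fun_upd_apply)
    qed
    have sub: "?u i ` mindices_deg n d \<subseteq> mindices_deg n (Suc d)"
      using i by (auto simp: mindices_def mdeg_Suc)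
    have out: "k i = 0" if "k \<in> mindices_deg n (Suc d) - ?u i ` mindices_deg n d" for k
    proof (rule ccontr)
      assume nz: "k i \<noteq> 0"
      let ?l = "k(i := k i - 1)"
      have k: "k = ?u i ?l" using nz by simp
      then have "mdeg n k = Suc (mdeg n ?l)" using mdeg_Suc[OF i, of ?l] by simp
      then have "?l \<in> mindices_deg n d" using that i by (auto simp: mindices_def)
      then show False using that k by blast
    qed
    have "(\<Sum>k\<in>mindices_deg n (Suc d). real (k i) / real (Suc d) * (?M (Suc d) k * monom_at n x k)) =
        (\<Sum>k\<in>?u i ` mindices_deg n d. real (k i) / real (Suc d) * (?M (Suc d) k * monom_at n x k))"
      by (rule sum.mono_neutral_right[OF finite_mindices_deg sub]) (use out in auto)
    also have "\<dots> = (\<Sum>k\<in>mindices_deg n d. real (Suc (k i)) / real (Suc d) *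
        (?M (Suc d) (?u i k) * monom_at n x (?u i k)))"
      unfolding sum.reindex[OF inj] by simp
    also have "\<dots> = (\<Sum>k\<in>mindices_deg n d. x i * (?M d k * monom_at n x k))"
    proof (rule sum.cong[OF refl])
      fix k
      show "real (Suc (k i)) / real (Suc d) * (?M (Suc d) (?u i k) * monom_at n x (?u i k)) =
          x i * (?M d k * monom_at n x k)"
        unfolding monom_at_Suc[OF i] M[of k, symmetric] by (simp only: mult_ac)
    qed
    finally show ?thesis by (simp add: sum_distrib_left)
  qed
  have "(\<Sum>i<n. x i) ^ Suc d = (\<Sum>i<n. x i * (\<Sum>k\<in>mindices_deg n d. ?M d k * monom_at n x k))"
    unfolding power_Suc Suc by (simp add: sum_distrib_right)
  also have "\<dots> = (\<Sum>i<n. \<Sum>k\<in>mindices_deg n (Suc d).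
      real (k i) / real (Suc d) * (?M (Suc d) k * monom_at n x k))"
    by (rule sum.cong) (use step in auto)
  also have "\<dots> = (\<Sum>k\<in>mindices_deg n (Suc d). (\<Sum>i<n. real (k i) / real (Suc d)) *
      (?M (Suc d) k * monom_at n x k))"
    by (subst sum.swap) (simp only: sum_distrib_right)
  also have "\<dots> = (\<Sum>k\<in>mindices_deg n (Suc d). ?M (Suc d) k * monom_at n x k)"
  proof (rule sum.cong[OF refl])
    fix k assume "k \<in> mindices_deg n (Suc d)"
    then have "(\<Sum>i<n. real (k i)) = real (Suc d)" unfolding of_nat_sum[symmetric] by (simp add: mdeg_def)
    then have "(\<Sum>i<n. real (k i) / real (Suc d)) = 1" unfolding sum_divide_distrib[symmetric] by simp
    then show "(\<Sum>i<n. real (k i) / real (Suc d)) * (?M (Suc d) k * monom_at n x k) =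
        ?M (Suc d) k * monom_at n x k" by simp
  qed
  finally show ?case .
qed

lemma polynomial_growth_imp_le_one:
  fixes x C :: real
  assumes "\<And>d. x ^ d \<le> C * (real d + 1) ^ n" shows "x \<le> 1"
proof (rule ccontr)
  assume "\<not> x \<le> 1"
  then have x: "1 < x" by simp
  \<comment> \<open>Bernoulli makes \<open>y ^ d\<close> grow at least linearly in \<open>d\<close>;
    with the \<open>(n+1)\<close>-st root its \<open>(n+1)\<close>-st power \<open>x ^ d\<close>
    then outruns degree \<open>n\<close>.\<close>
  define y where "y = root (Suc n) x"
  have y: "1 < y" "y ^ Suc n = x" unfolding y_def using x real_root_pow_pos2[of "Suc n" x] real_root_gt_1_iff[of "Suc n" x] by auto
  \<comment> \<open>The cut-off at 1 gives \<open>\<delta> * (d + 1) \<le> 1 + d * (y - 1)\<close>,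
    so that the factor \<open>(d + 1) ^ n\<close> can be cancelled.\<close>
  define \<delta> where "\<delta> = min 1 (y - 1)"
  have \<delta>: "0 < \<delta>" "\<delta> \<le> 1" "\<delta> \<le> y - 1" using y by (auto simp: \<delta>_def)
  have le: "real d + 1 \<le> C / \<delta> ^ Suc n" for d
  proof -
    have "\<delta> * (real d + 1) \<le> 1 + real d * (y - 1)"
      using \<delta> mult_left_mono[OF \<delta>(3), of "real d"] by (simp add: algebra_simps)
    also have "\<dots> \<le> y ^ d" using Bernoulli_inequality[of "y - 1" d] y by simp
    finally have "(\<delta> * (real d + 1)) ^ Suc n \<le> (y ^ d) ^ Suc n" using \<delta> by (intro power_mono) auto
    also have "\<dots> = x ^ d" unfolding y(2)[symmetric] by (simp only: power_mult[symmetric] mult.commute)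
    also have "\<dots> \<le> C * (real d + 1) ^ n" by (rule assms)
    finally have "(\<delta> ^ Suc n * (real d + 1)) * (real d + 1) ^ n \<le> C * (real d + 1) ^ n"
 by (simp only: power_mult_distrib power_Suc mult_ac)
    then have "\<delta> ^ Suc n * (real d + 1) \<le> C" by (rule mult_right_le_imp_le) simp
    then show ?thesis using \<delta> by (simp add: pos_le_divide_eq mult.commute)
  qed
  obtain d where "C / \<delta> ^ Suc n < real d" using reals_Archimedean2 by blast
  with le[of d] show False by simp
qed

abbreviation euclid_norm :: "nat \<Rightarrow> (nat \<Rightarrow> complex) \<Rightarrow> real" where
  "euclid_norm n z \<equiv> L2_set (\<lambda>i. cmod (z i)) {..<n}"

lemma monom_at_square: "monom_at n (\<lambda>i. (x i)\<^sup>2) k = (monom_at n x k :: real)\<^sup>2"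
  by (simp add: monom_at_def power_mult[symmetric] prod_power_distrib mult.commute)

lemma ball_wt_square:
  assumes "cmod q = 1"
  shows "(ball_wt n q k)\<^sup>2 = (\<Prod>i<n. fact (k i)) / fact (mdeg n k)"
  unfolding ball_wt_unimodular[OF assms] by (simp add: prod_nonneg)

text \<open>After squaring, the left side times its multinomial coefficient is a single nonnegative
  summand of the multinomial expansion of a power of \<open>\<Sum> |z_i|^2\<close>.\<close>

lemma monom_at_le_ball_wt:
  assumes q: "cmod q = 1" and k: "k \<in> mindices n"
  shows "cmod (monom_at n z k) \<le> ball_wt n q k * euclid_norm n z ^ mdeg n k"
proof -
  let ?S = "\<Sum>i<n. (cmod (z i))\<^sup>2" and ?P = "\<Prod>i<n. fact (k i) :: real"
  have P: "0 < ?P" by (rule prod_pos) simp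
  have "fact (mdeg n k) / ?P * monom_at n (\<lambda>i. (cmod (z i))\<^sup>2) k \<le>
      (\<Sum>l\<in>mindices_deg n (mdeg n k). fact (mdeg n k) / (\<Prod>i<n. fact (l i)) * monom_at n (\<lambda>i. (cmod (z i))\<^sup>2) l)"
    by (rule member_le_sum[OF _ _ finite_mindices_deg])
       (use k in \<open>auto simp: monom_at_def intro!: mult_nonneg_nonneg prod_nonneg divide_nonneg_nonneg\<close>)
  also have "\<dots> = ?S ^ mdeg n k" by (rule multinomial_theorem[symmetric])
  finally have "(cmod (monom_at n z k))\<^sup>2 \<le> (ball_wt n q k)\<^sup>2 * ?S ^ mdeg n k"
    unfolding ball_wt_square[OF q] monom_at_square norm_monom_at using P by (simp add: field_simps)
  also have "?S ^ mdeg n k = (euclid_norm n z ^ mdeg n k)\<^sup>2"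
  proof -
    have "(euclid_norm n z ^ mdeg n k)\<^sup>2 = ((euclid_norm n z)\<^sup>2) ^ mdeg n k"
      by (metis power_mult mult.commute)
    then show ?thesis by (simp add: L2_set_def sum_nonneg)
  qed
  finally have "(cmod (monom_at n z k))\<^sup>2 \<le> (ball_wt n q k * euclid_norm n z ^ mdeg n k)\<^sup>2"
    by (simp add: power_mult_distrib)
  moreover have "0 \<le> ball_wt n q k * euclid_norm n z ^ mdeg n k"
    unfolding ball_wt_unimodular[OF q]
    by (intro mult_nonneg_nonneg real_sqrt_ge_zero divide_nonneg_nonneg prod_nonneg) auto
  ultimately show ?thesis by (rule power2_le_imp_le)
qed

text \<open>Summing the squared bounds over all monomials of degree \<open>d\<close>, the
  multinomial theorem bounds the \<open>d\<close>-th power of \<open>|z|^2 / \<rho>^2\<close> by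
  \<open>C^2\<close> times the number of monomials, which is polynomial in \<open>d\<close>.\<close>

lemma euclid_norm_le_of_monom_at_le:
  assumes q: "cmod q = 1" and \<rho>: "0 < \<rho>"
    and le: "\<And>k. k \<in> mindices n \<Longrightarrow> cmod (monom_at n z k) \<le> C * ball_wt n q k * \<rho> ^ mdeg n k"
  shows "euclid_norm n z \<le> \<rho>"
proof -
  let ?S = "\<Sum>i<n. (cmod (z i))\<^sup>2"
  have "(?S / \<rho>\<^sup>2) ^ d \<le> C\<^sup>2 * (real d + 1) ^ n" for d
  proof -
    have "?S ^ d = (\<Sum>k\<in>mindices_deg n d. fact d / (\<Prod>i<n. fact (k i)) * (cmod (monom_at n z k))\<^sup>2)"
      unfolding multinomial_theorem monom_at_square norm_monom_at ..
    also have "\<dots> \<le> (\<Sum>k\<in>mindices_deg n d. C\<^sup>2 * (\<rho>\<^sup>2) ^ d)"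
    proof (rule sum_mono)
      fix k assume k: "k \<in> mindices_deg n d"
      let ?P = "\<Prod>i<n. fact (k i) :: real"
      have P: "0 < ?P" by (rule prod_pos) simp
      have "(cmod (monom_at n z k))\<^sup>2 \<le> (C * ball_wt n q k * \<rho> ^ mdeg n k)\<^sup>2"
        using le[of k] k by (intro power_mono) auto
      also have "\<dots> = C\<^sup>2 * (?P / fact d) * (\<rho>\<^sup>2) ^ d"
        using k unfolding power_mult_distrib ball_wt_square[OF q]
        by (simp add: power_mult[symmetric] mult.commute)
      finally have "fact d / ?P * (cmod (monom_at n z k))\<^sup>2 \<le> fact d / ?P * (C\<^sup>2 * (?P / fact d) * (\<rho>\<^sup>2) ^ d)"
        using P by (intro mult_left_mono) (auto intro: divide_nonneg_pos)
      also have "\<dots> = C\<^sup>2 * (\<rho>\<^sup>2) ^ d" using P by (simp add: field_simps)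
      finally show "fact d / ?P * (cmod (monom_at n z k))\<^sup>2 \<le> C\<^sup>2 * (\<rho>\<^sup>2) ^ d" .
    qed
    also have "\<dots> = real (card (mindices_deg n d)) * (C\<^sup>2 * (\<rho>\<^sup>2) ^ d)" by simp
    also have "\<dots> \<le> real ((d + 1) ^ n) * (C\<^sup>2 * (\<rho>\<^sup>2) ^ d)"
      by (intro mult_right_mono of_nat_mono card_mindices_deg) simp
    finally have "?S ^ d \<le> (C\<^sup>2 * (real d + 1) ^ n) * (\<rho>\<^sup>2) ^ d" by (simp add: algebra_simps)
    then show ?thesis using \<rho> by (simp add: power_divide pos_divide_le_eq)
  qed
  then have "?S / \<rho>\<^sup>2 \<le> 1" by (rule polynomial_growth_imp_le_one)
  then have "?S \<le> \<rho>\<^sup>2" using \<rho> by simp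
  then show ?thesis unfolding L2_set_def using \<rho> by (intro real_le_lsqrt) (auto intro: sum_nonneg)
qed

definition eval_at :: "nat \<Rightarrow> (nat \<Rightarrow> complex) \<Rightarrow> series \<Rightarrow> complex" where
  "eval_at n z a = (\<Sum>\<^sub>\<infinity>k\<in>mindices n. a k * monom_at n z k)"

text \<open>The estimate says that evaluation at \<open>z\<close> is bounded on monomials by one
  norm, which extends to the whole algebra. Thus one notion serves both weights; for unimodular
  \<open>q\<close> it is later identified with the open polydisk and the open ball.\<close>

definition domain_point :: "nat \<Rightarrow> (mindex \<Rightarrow> real) \<Rightarrow> ereal \<Rightarrow> (nat \<Rightarrow> complex) \<Rightarrow> bool" where
  "domain_point n w r z \<longleftrightarrow> (\<exists>C \<rho>. 0 < \<rho> \<and> ereal \<rho> < r \<and>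
     (\<forall>k\<in>mindices n. cmod (monom_at n z k) \<le> C * w k * \<rho> ^ mdeg n k))"

lemma eval_at_cong: "(\<And>i. i < n \<Longrightarrow> z i = z' i) \<Longrightarrow> eval_at n z a = eval_at n z' a"
  unfolding eval_at_def monom_at_def by simp

lemma eval_at_monom:
  assumes "k \<in> mindices n" shows "eval_at n z (monom_ser k) = monom_at n z k"
proof -
  have "eval_at n z (monom_ser k) = infsum (\<lambda>l. monom_ser k l * monom_at n z l) {k}"
    unfolding eval_at_def by (rule infsum_cong_neutral) (use assms in \<open>auto simp: monom_ser_def\<close>)
  then show ?thesis by (simp add: monom_ser_def)
qed

lemma eval_at_gen: "i < n \<Longrightarrow> eval_at n z (gen_ser i) = z i"
  unfolding gen_ser_eq by (simp add: eval_at_monom single_mindices monom_at_single del: One_nat_def)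

lemma eval_at_origin: "eval_at n (\<lambda>_. 0) a = a (\<lambda>_. 0)"
proof -
  have "monom_at n (\<lambda>_. 0 :: complex) k = 0" if k: "k \<in> mindices n" "k \<noteq> (\<lambda>_. 0)" for k
  proof -
    obtain i where "k i \<noteq> 0" using k by auto
    moreover then have "i < n" using k by (auto simp: mindices_def not_less[symmetric])
    ultimately show ?thesis unfolding monom_at_def by (intro prod_zero) (auto intro!: bexI[of _ i])
  qed
  then have "eval_at n (\<lambda>_. 0) a = infsum (\<lambda>l. a l * monom_at n (\<lambda>_. 0) l) {\<lambda>_. 0}"
    unfolding eval_at_def by (intro infsum_cong_neutral) (auto simp: mindices_zero)
  then show ?thesis by simp
qed

context positive_weight
begin

lemma term_le:
  assumes "cmod x \<le> C * w k * \<rho> ^ mdeg n k"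
  shows "cmod (a k * x) \<le> C * (cmod (a k) * w k * \<rho> ^ mdeg n k)"
  using mult_left_mono[OF assms, of "cmod (a k)"] by (simp add: norm_mult mult_ac)

lemma eval_summable:
  assumes "domain_point n w r z" "a \<in> wt_series n w r"
  shows "(\<lambda>k. norm (a k * monom_at n z k)) summable_on mindices n"
proof -
  obtain C \<rho> where *: "0 < \<rho>" "ereal \<rho> < r"
    "\<And>k. k \<in> mindices n \<Longrightarrow> cmod (monom_at n z k) \<le> C * w k * \<rho> ^ mdeg n k"
    using assms(1) unfolding domain_point_def by blast
  show ?thesis
    by (rule summable_on_comparison_test[OF summable_on_cmult_right[OF series_summable[OF assms(2) *(1,2)], of C]])
       (use term_le[OF *(3)] in auto)
qed

lemma eval_functional:
  assumes z: "domain_point n w r z" shows "bounded_functional n w r (eval_at n z)"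
proof
  obtain C \<rho> where *: "0 < \<rho>" "ereal \<rho> < r"
    "\<And>k. k \<in> mindices n \<Longrightarrow> cmod (monom_at n z k) \<le> C * w k * \<rho> ^ mdeg n k"
    using z unfolding domain_point_def by blast
  have "cmod (eval_at n z a) \<le> C * wt_norm n w \<rho> a" if a: "a \<in> wt_series n w r" for a
  proof -
    note s = eval_summable[OF z a]
    have "cmod (eval_at n z a) \<le> (\<Sum>\<^sub>\<infinity>k\<in>mindices n. norm (a k * monom_at n z k))"
      unfolding eval_at_def by (rule norm_infsum_bound[OF s])
    also have "\<dots> \<le> (\<Sum>\<^sub>\<infinity>k\<in>mindices n. C * (cmod (a k) * w k * \<rho> ^ mdeg n k))"
      by (rule infsum_mono[OF s summable_on_cmult_right[OF series_summable[OF a *(1,2)]]])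
         (rule term_le[OF *(3)])
    also have "\<dots> = C * wt_norm n w \<rho> a" unfolding wt_norm_def by (rule infsum_cmult_right')
    finally show ?thesis .
  qed
  then show "\<exists>C \<rho>. 0 < \<rho> \<and> ereal \<rho> < r \<and> (\<forall>a\<in>wt_series n w r. cmod (eval_at n z a) \<le> C * wt_norm n w \<rho> a)"
    using * by blast
  fix a assume a: "a \<in> wt_series n w r"
  show "eval_at n z (\<lambda>k. c * a k) = c * eval_at n z a" for c
    unfolding eval_at_def mult.assoc by (rule infsum_cmult_right')
  fix b assume b: "b \<in> wt_series n w r"
  show "eval_at n z (\<lambda>k. a k + b k) = eval_at n z a + eval_at n z b"
    unfolding eval_at_def distrib_right
    by (rule infsum_add) (rule abs_summable_summable[OF eval_summable[OF z]], fact)+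
qed

lemma eval_mult:
  assumes z: "domain_point n w r z" and a: "a \<in> wt_series n w r" and b: "b \<in> wt_series n w r"
  shows "eval_at n z (q_mult n 1 a b) = eval_at n z a * eval_at n z b"
proof -
  have eq: "(\<Sum>k\<in>{..m}. (a k * monom_at n z k) * (b (m - k) * monom_at n z (m - k))) =
      q_mult n 1 a b m * monom_at n z m" for m
    unfolding q_mult_def sum_distrib_right
  proof (rule sum.cong[OF refl])
    fix k assume "k \<in> {..m}"
    then have "monom_at n z m = monom_at n z k * monom_at n z (m - k)" by (simp add: monom_at_diff)
    then show "(a k * monom_at n z k) * (b (m - k) * monom_at n z (m - k)) =
        inverse 1 ^ q_twist n k (m - k) * a k * b (m - k) * monom_at n z m" by simp
  qed
  show ?thesis
    using convolution_has_sum[OF eval_summable[OF z a] eval_summable[OF z b]]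
    unfolding eq eval_at_def by (rule infsumI)
qed

end

text \<open>Points of the domain are exactly the bounded characters, so they pull back along
  homomorphisms.\<close>

lemma (in wt_hom) pullback_point:
  assumes q: "q = 1" and z: "domain_point n v r z"
  defines "p \<equiv> \<lambda>i. eval_at n z (f (gen_ser i))"
  shows "domain_point n w r p" and "a \<in> wt_series n w r \<Longrightarrow> eval_at n z (f a) = eval_at n p a"
proof -
  have T: "bounded_functional n w r (\<lambda>a. eval_at n z (f a))"
    by (rule functional_comp[OF V.eval_functional[OF z]])
  have mon: "eval_at n z (f (monom_ser k)) = monom_at n p k" if "k \<in> mindices n" for k
    using that
  proof (induction k rule: mindex_induct)
    case zero
    then show ?case unfolding one by (simp add: eval_at_monom mindices_zero)
  next
    case (step i k)
    have eq: "f (monom_ser (k(i := Suc (k i)))) = q_mult n q (f (gen_ser i)) (f (monom_ser k))"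
      by (rule gen_mult_monom) (use step in auto)
    show ?case
      unfolding eq q V.eval_mult[OF z closed[OF W.series_gen[OF step(1)]] closed[OF W.series_monom[OF step(2)]]]
        monom_at_Suc[OF step(1)] step.IH by (simp add: p_def)
  qed
  obtain C \<rho> where *: "0 < \<rho>" "ereal \<rho> < r"
    "\<And>a. a \<in> wt_series n w r \<Longrightarrow> cmod (eval_at n z (f a)) \<le> C * wt_norm n w \<rho> a"
    using bounded_functional.T_bounded[OF T] by blast
  have "cmod (monom_at n p k) \<le> C * w k * \<rho> ^ mdeg n k" if k: "k \<in> mindices n" for k
    using *(3)[OF W.series_monom[OF k]] unfolding mon[OF k] W.norm_monom[OF k] by (simp add: mult.assoc)
  then show p: "domain_point n w r p" unfolding domain_point_def using * by blast
  show "eval_at n z (f a) = eval_at n p a" if "a \<in> wt_series n w r"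
    by (rule bounded_functional_eqI[OF T W.eval_functional[OF p] _ that]) (simp add: mon eval_at_monom)
qed

lemma domain_point_polydisk:
  assumes "0 < R" shows "domain_point n (\<lambda>_. 1) (ereal R) z \<longleftrightarrow> (\<forall>i<n. cmod (z i) < R)"
proof
  assume "domain_point n (\<lambda>_. 1) (ereal R) z"
  then obtain C \<rho> where *: "0 < \<rho>" "\<rho> < R"
    "\<And>k. k \<in> mindices n \<Longrightarrow> cmod (monom_at n z k) \<le> C * 1 * \<rho> ^ mdeg n k"
    unfolding domain_point_def by auto
  have "cmod (z i) \<le> \<rho>" if "i < n" for i
    by (rule power_le_imp_base_le[OF _ *(1), of _ C])
       (use *(3)[OF single_mindices[OF that]] in \<open>simp_all add: monom_at_single mdeg_single that norm_power\<close>)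
  then show "\<forall>i<n. cmod (z i) < R" using *(2) by force
next
  assume z: "\<forall>i<n. cmod (z i) < R"
  \<comment> \<open>\<open>R / 2\<close> keeps the maximum positive when all coordinates vanish, and
    the set nonempty when there are none.\<close>
  define \<rho> where "\<rho> = Max (insert (R / 2) ((\<lambda>i. cmod (z i)) ` {..<n}))"
  have \<rho>: "R / 2 \<le> \<rho>" "\<And>i. i < n \<Longrightarrow> cmod (z i) \<le> \<rho>"
    unfolding \<rho>_def by (rule Max_ge; simp)+
  have "\<rho> < R" unfolding \<rho>_def using z assms by (subst Max_less_iff) auto
  moreover have "cmod (monom_at n z k) \<le> 1 * 1 * \<rho> ^ mdeg n k" for k
  proof -
    have "(\<Prod>i<n. cmod (z i) ^ k i) \<le> (\<Prod>i<n. \<rho> ^ k i)"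
      using \<rho> by (intro prod_mono conjI power_mono) auto
    then have "monom_at n (\<lambda>i. cmod (z i)) k \<le> \<rho> ^ mdeg n k"
      by (simp add: monom_at_def mdeg_def power_sum)
    then show ?thesis by (simp add: norm_monom_at)
  qed
  ultimately show "domain_point n (\<lambda>_. 1) (ereal R) z"
    unfolding domain_point_def using \<rho>(1) assms by (intro exI[of _ 1] exI[of _ \<rho>]) auto
qed

lemma domain_point_ball:
  assumes q: "cmod q = 1" and "0 < R"
  shows "domain_point n (ball_wt n q) (ereal R) z \<longleftrightarrow> euclid_norm n z < R"
proof
  assume "domain_point n (ball_wt n q) (ereal R) z"
  then obtain C \<rho> where *: "0 < \<rho>" "\<rho> < R"
    "\<And>k. k \<in> mindices n \<Longrightarrow> cmod (monom_at n z k) \<le> C * ball_wt n q k * \<rho> ^ mdeg n k"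
    unfolding domain_point_def by auto
  show "euclid_norm n z < R" using euclid_norm_le_of_monom_at_le[OF q *(1,3)] *(2) by linarith
next
  assume z: "euclid_norm n z < R"
  let ?\<rho> = "max (euclid_norm n z) (R / 2)"
  have "cmod (monom_at n z k) \<le> 1 * ball_wt n q k * ?\<rho> ^ mdeg n k" if k: "k \<in> mindices n" for k
  proof -
    have "0 < ball_wt n q k" using q by (intro ball_wt_pos) auto
    then show ?thesis
      using order_trans[OF monom_at_le_ball_wt[OF q k, of z] mult_left_mono[OF power_mono]] by simp
  qed
  then show "domain_point n (ball_wt n q) (ereal R) z"
    unfolding domain_point_def using z \<open>0 < R\<close>
    by (intro exI[of _ 1] exI[of _ ?\<rho>]) auto
qed

section \<open>Holomorphic discs\<close>

lemma monom_at_derivative_origin: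
  assumes k: "k \<in> mindices n" and z0: "\<And>i. i < n \<Longrightarrow> z 0 i = 0"
    and D: "\<And>i. i < n \<Longrightarrow> ((\<lambda>\<zeta>. z \<zeta> i) has_field_derivative D i) (at (0 :: complex))"
  shows "((\<lambda>\<zeta>. monom_at n (z \<zeta>) k) has_field_derivative (\<Sum>i<n. if k = single i 1 then D i else 0)) (at 0)"
  using k
proof (induction k rule: mindex_induct)
  case zero
  have "(\<lambda>_. 0) \<noteq> single i 1" for i using single_ne_zero[of i 0] by (metis One_nat_def)
  then show ?case by simp
next
  case (step j k)
  have m0: "monom_at n (z 0) k = (if k = (\<lambda>_. 0) then 1 else 0)"
  proof (cases "k = (\<lambda>_. 0)")
    case False
    then obtain i where i: "k i \<noteq> 0" by auto
    then have "i < n" using step(2) by (auto simp: mindices_def not_less[symmetric])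
    then show ?thesis using False i z0 unfolding monom_at_def by (auto intro!: prod_zero bexI[of _ i])
  qed simp
  have "((\<lambda>\<zeta>. z \<zeta> j * monom_at n (z \<zeta>) k) has_field_derivative
      (D j * monom_at n (z 0) k + (\<Sum>i<n. if k = single i 1 then D i else 0) * z 0 j)) (at 0)"
    using DERIV_mult[OF D[OF step(1)] step.IH] by simp
  moreover have "D j * monom_at n (z 0) k + (\<Sum>i<n. if k = single i 1 then D i else 0) * z 0 j =
      (\<Sum>i<n. if k(j := Suc (k j)) = single i 1 then D i else 0)"
  proof -
    have "(\<Sum>i<n. if k(j := Suc (k j)) = single i 1 then D i else 0) =
        (\<Sum>i<n. if i = j then (if k = (\<lambda>_. 0) then D j else 0) else 0)"
      unfolding fun_upd_Suc_eq_single by (rule sum.cong) auto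
    also have "\<dots> = (if k = (\<lambda>_. 0) then D j else 0)" using step(1) by simp
    finally show ?thesis unfolding m0 z0[OF step(1)] by simp
  qed
  ultimately show ?case by (simp only: monom_at_Suc[OF step(1)])
qed

text \<open>On each smaller closed disc one pair \<open>C\<close>, \<open>\<rho>\<close> bounds all
  monomials, which is what the Weierstrass M-test needs. A pointwise \<open>domain_point\<close>
  would let both vary with \<open>\<zeta>\<close>.\<close>

definition holomorphic_disc :: "nat \<Rightarrow> (mindex \<Rightarrow> real) \<Rightarrow> ereal \<Rightarrow> (complex \<Rightarrow> nat \<Rightarrow> complex) \<Rightarrow> bool" where
  "holomorphic_disc n w r z \<longleftrightarrow> (\<forall>i<n. (\<lambda>\<zeta>. z \<zeta> i) holomorphic_on ball 0 1) \<and>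
     (\<forall>\<eta>. 0 < \<eta> \<and> \<eta> < 1 \<longrightarrow> (\<exists>C \<rho>. 0 < \<rho> \<and> ereal \<rho> < r \<and>
       (\<forall>\<zeta>\<in>cball 0 \<eta>. \<forall>k\<in>mindices n. cmod (monom_at n (z \<zeta>) k) \<le> C * w k * \<rho> ^ mdeg n k)))"

lemma holomorphic_monom_at:
  assumes "\<And>i. i < n \<Longrightarrow> (\<lambda>\<zeta>. z \<zeta> i) holomorphic_on S"
  shows "(\<lambda>\<zeta>. monom_at n (z \<zeta>) k) holomorphic_on S"
  unfolding monom_at_def using assms by (auto intro!: holomorphic_intros)

context positive_weight
begin

text \<open>Uniform convergence on a closed disc with \<open>\<xi>\<close> in its interior permits
  termwise differentiation. The derivative is returned together with the limit that defines it, so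
  that it can be computed at the origin.\<close>

lemma eval_disc_derivative:
  assumes disc: "holomorphic_disc n w r z" and a: "a \<in> wt_series n w r" and \<xi>: "cmod \<xi> < 1"
  obtains d where "((\<lambda>\<zeta>. eval_at n (z \<zeta>) a) has_field_derivative d) (at \<xi>)"
    "((\<lambda>S. \<Sum>k\<in>S. a k * deriv (\<lambda>\<zeta>. monom_at n (z \<zeta>) k) \<xi>) \<longlongrightarrow> d) (finite_subsets_at_top (mindices n))"
proof -
  obtain \<eta> where \<eta>': "cmod \<xi> < \<eta>" "\<eta> < 1" using dense[OF \<xi>] by auto
  then have \<eta>: "0 < \<eta>" "\<eta> < 1" using norm_ge_zero[of \<xi>] by linarith+
  have \<xi>\<eta>: "\<xi> \<in> ball 0 \<eta>" using \<eta>' by simp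
  obtain C \<rho> where *: "0 < \<rho>" "ereal \<rho> < r"
    "\<And>\<zeta> k. \<zeta> \<in> cball 0 \<eta> \<Longrightarrow> k \<in> mindices n \<Longrightarrow> cmod (monom_at n (z \<zeta>) k) \<le> C * w k * \<rho> ^ mdeg n k"
    using disc \<eta> unfolding holomorphic_disc_def by blast
  have hol: "(\<lambda>\<zeta>. monom_at n (z \<zeta>) k) holomorphic_on ball 0 1" for k
    by (rule holomorphic_monom_at) (use disc in \<open>auto simp: holomorphic_disc_def\<close>)
  have sub: "cball 0 \<eta> \<subseteq> ball (0::complex) 1" using \<eta> by auto
  have ul: "uniform_limit (cball 0 \<eta>) (\<lambda>S \<zeta>. \<Sum>k\<in>S. a k * monom_at n (z \<zeta>) k)
      (\<lambda>\<zeta>. \<Sum>\<^sub>\<infinity>k\<in>mindices n. a k * monom_at n (z \<zeta>) k) (finite_subsets_at_top (mindices n))"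
    by (rule Weierstrass_m_test_general[OF _ summable_on_cmult_right[OF series_summable[OF a *(1,2)], of C]])
       (rule term_le[OF *(3)])
  have der: "((\<lambda>\<zeta>. \<Sum>k\<in>S. a k * monom_at n (z \<zeta>) k) has_field_derivative
      (\<Sum>k\<in>S. a k * deriv (\<lambda>\<zeta>. monom_at n (z \<zeta>) k) \<zeta>)) (at \<zeta>)" if "\<zeta> \<in> ball 0 \<eta>" for S \<zeta>
  proof (rule DERIV_sum)
    fix k
    have "\<zeta> \<in> ball 0 1" using that \<eta> by auto
    then have "((\<lambda>\<zeta>. monom_at n (z \<zeta>) k) has_field_derivative deriv (\<lambda>\<zeta>. monom_at n (z \<zeta>) k) \<zeta>) (at \<zeta>)"
      by (rule holomorphic_derivI[OF hol open_ball])
    then show "((\<lambda>\<zeta>. a k * monom_at n (z \<zeta>) k) has_field_derivative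
        a k * deriv (\<lambda>\<zeta>. monom_at n (z \<zeta>) k) \<zeta>) (at \<zeta>)" by (rule DERIV_cmult)
  qed
  have cont: "continuous_on (cball 0 \<eta>) (\<lambda>\<zeta>. \<Sum>k\<in>S. a k * monom_at n (z \<zeta>) k)" for S
    by (intro continuous_intros holomorphic_on_imp_continuous_on holomorphic_on_subset[OF hol sub])
  show ?thesis
  proof (rule has_complex_derivative_uniform_limit[OF _ ul _ \<eta>(1)])
    show "\<forall>\<^sub>F S in finite_subsets_at_top (mindices n).
        continuous_on (cball 0 \<eta>) (\<lambda>\<zeta>. \<Sum>k\<in>S. a k * monom_at n (z \<zeta>) k) \<and>
        (\<forall>\<zeta>\<in>ball 0 \<eta>. ((\<lambda>\<zeta>. \<Sum>k\<in>S. a k * monom_at n (z \<zeta>) k) has_field_derivative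
          (\<Sum>k\<in>S. a k * deriv (\<lambda>\<zeta>. monom_at n (z \<zeta>) k) \<zeta>)) (at \<zeta>))"
      using cont der by (intro always_eventually) blast
    fix g' assume "\<And>\<zeta>. \<zeta> \<in> ball 0 \<eta> \<Longrightarrow>
      ((\<lambda>\<zeta>. \<Sum>\<^sub>\<infinity>k\<in>mindices n. a k * monom_at n (z \<zeta>) k) has_field_derivative g' \<zeta>) (at \<zeta>) \<and>
      ((\<lambda>S. \<Sum>k\<in>S. a k * deriv (\<lambda>\<zeta>. monom_at n (z \<zeta>) k) \<zeta>) \<longlongrightarrow> g' \<zeta>) (finite_subsets_at_top (mindices n))"
    from this[OF \<xi>\<eta>] show thesis unfolding eval_at_def[symmetric] by (intro that[of "g' \<xi>"]) simp_all
  qed simp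
qed

lemma eval_disc_holomorphic:
  assumes disc: "holomorphic_disc n w r z" and a: "a \<in> wt_series n w r"
  shows "(\<lambda>\<zeta>. eval_at n (z \<zeta>) a) holomorphic_on ball 0 1"
proof (rule holomorphic_onI)
  fix \<zeta> :: complex assume "\<zeta> \<in> ball 0 1"
  then have "cmod \<zeta> < 1" by simp
  then obtain d where "((\<lambda>\<zeta>. eval_at n (z \<zeta>) a) has_field_derivative d) (at \<zeta>)"
    by (rule eval_disc_derivative[OF disc a])
  then show "(\<lambda>\<zeta>. eval_at n (z \<zeta>) a) field_differentiable at \<zeta> within ball 0 1"
    using field_differentiable_at_within field_differentiable_def by blast
qed

text \<open>Since the disc starts at the origin, only the linear monomials have a nonzero derivative
  there.\<close>

lemma eval_disc_derivative_origin:
  assumes disc: "holomorphic_disc n w r z" and a: "a \<in> wt_series n w r"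
    and z0: "\<And>i. i < n \<Longrightarrow> z 0 i = 0"
    and D: "\<And>i. i < n \<Longrightarrow> ((\<lambda>\<zeta>. z \<zeta> i) has_field_derivative D i) (at 0)"
  shows "((\<lambda>\<zeta>. eval_at n (z \<zeta>) a) has_field_derivative (\<Sum>i<n. a (single i 1) * D i)) (at 0)"
proof -
  obtain d where d: "((\<lambda>\<zeta>. eval_at n (z \<zeta>) a) has_field_derivative d) (at 0)"
    "((\<lambda>S. \<Sum>k\<in>S. a k * deriv (\<lambda>\<zeta>. monom_at n (z \<zeta>) k) 0) \<longlongrightarrow> d) (finite_subsets_at_top (mindices n))"
    by (rule eval_disc_derivative[OF disc a, of 0]) simp_all
  let ?h = "\<lambda>k. a k * deriv (\<lambda>\<zeta>. monom_at n (z \<zeta>) k) 0"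
  have dk: "deriv (\<lambda>\<zeta>. monom_at n (z \<zeta>) k) 0 = (\<Sum>i<n. if k = single i 1 then D i else 0)"
    if "k \<in> mindices n" for k
    by (rule DERIV_imp_deriv[OF monom_at_derivative_origin[OF that z0 D]])
  let ?T = "(\<lambda>i. single i 1) ` {..<n}"
  have inj: "inj_on (\<lambda>i. single i 1) {..<n}" using single_eq_iff by (intro inj_onI) blast
  have sub: "?T \<subseteq> mindices n" using single_mindices by auto
  have z: "?h k = 0" if "k \<in> mindices n - ?T" for k
  proof -
    have "(\<Sum>i<n. if k = single i 1 then D i else 0) = 0" using that by (intro sum.neutral) auto
    then show ?thesis using dk that by simp
  qed
  have hs: "(?h has_sum sum ?h ?T) (mindices n)"
    by (rule has_sum_finite_neutralI) (use sub z in auto)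
  have "sum ?h ?T = (\<Sum>i<n. a (single i 1) * D i)"
    unfolding sum.reindex[OF inj] comp_def
  proof (rule sum.cong[OF refl])
    fix i assume i: "i \<in> {..<n}"
    have "(\<Sum>j<n. if single i 1 = single j 1 then D j else 0) = (\<Sum>j<n. if j = i then D i else 0)"
      unfolding single_eq_iff by (rule sum.cong) auto
    then have "(\<Sum>j<n. if single i 1 = single j 1 then D j else 0) = D i" using i by simp
    then show "?h (single i 1) = a (single i 1) * D i" using dk[OF single_mindices] i by auto
  qed
  moreover have "d = sum ?h ?T"
    by (rule tendsto_unique[OF _ d(2) hs[unfolded has_sum_def]]) simp
  ultimately show ?thesis using d(1) by simp
qed

end

section \<open>The Schwarz lemma and the commutative case\<close>

text \<open>Rescaling by \<open>R\<close> and composing with the disc automorphism that moves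
  \<open>h 0 / R\<close> to 0 reduces this to the Schwarz lemma; the derivative of the automorphism
  yields the factor \<open>R^2 - |h 0|^2\<close>.\<close>

lemma Schwarz_Pick_origin:
  assumes hol: "h holomorphic_on ball 0 1" and lt: "\<And>\<zeta>. cmod \<zeta> < 1 \<Longrightarrow> cmod (h \<zeta>) < R" and R: "0 < R"
    and d: "(h has_field_derivative d) (at 0)"
  shows "cmod d \<le> (R\<^sup>2 - (cmod (h 0))\<^sup>2) / R"
proof -
  define s where "s = h 0 / of_real R"
  have s1: "cmod s < 1" using lt[of 0] R by (simp add: s_def norm_divide)
  let ?\<phi> = "\<lambda>\<zeta>. Moebius_function 0 s (h \<zeta> / of_real R)"
  have b: "cmod (h \<zeta> / of_real R) < 1" if "cmod \<zeta> < 1" for \<zeta>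
    using lt[OF that] R by (simp add: norm_divide)
  have "(\<lambda>\<zeta>. h \<zeta> / of_real R) holomorphic_on ball 0 1" using hol R by (intro holomorphic_intros) auto
  then have "(Moebius_function 0 s \<circ> (\<lambda>\<zeta>. h \<zeta> / of_real R)) holomorphic_on ball 0 1"
    by (rule holomorphic_on_compose_gen[OF _ Moebius_function_holomorphic[OF s1]]) (use b in auto)
  then have "?\<phi> holomorphic_on ball 0 1" by (simp add: comp_def)
  moreover have "?\<phi> 0 = 0" by (simp add: s_def Moebius_function_eq_zero)
  moreover have "cmod (?\<phi> \<zeta>) < 1" if "cmod \<zeta> < 1" for \<zeta>
    by (rule Moebius_function_norm_lt_1[OF s1 b[OF that]])
  ultimately have le: "cmod (deriv ?\<phi> 0) \<le> 1" by (rule Schwarz_Lemma(2)[of _ 0]) simp_all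
  have ss: "cnj s * s = of_real ((cmod s)\<^sup>2)" by (metis complex_norm_square mult.commute)
  have s2: "(cmod s)\<^sup>2 < 1" using s1 by (simp add: abs_square_less_1)
  then have nz: "1 - cnj s * s \<noteq> 0" unfolding ss by (metis eq_iff_diff_eq_0 less_irrefl of_real_eq_1_iff)
  have "(?\<phi> has_field_derivative
      ((d / of_real R) * (1 - cnj s * s) - (s - s) * (- cnj s * (d / of_real R))) / ((1 - cnj s * s) * (1 - cnj s * s))) (at 0)"
    unfolding Moebius_function_simple using nz d R
    by (auto intro!: derivative_eq_intros simp: s_def)
  moreover have "((d / of_real R) * (1 - cnj s * s) - (s - s) * (- cnj s * (d / of_real R))) / ((1 - cnj s * s) * (1 - cnj s * s)) =
      d / (of_real R * (1 - cnj s * s))" using nz R by simp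
  ultimately have "deriv ?\<phi> 0 = d / of_real (R * (1 - (cmod s)\<^sup>2))"
    using ss by (simp add: DERIV_imp_deriv)
  then have "cmod (deriv ?\<phi> 0) = cmod d / (R * (1 - (cmod s)\<^sup>2))"
    using R s2 by (simp only: norm_divide norm_of_real) simp
  then have "cmod d \<le> R * (1 - (cmod s)\<^sup>2)" using le R s2 by (simp add: pos_divide_le_eq)
  also have "\<dots> = (R\<^sup>2 - (cmod (h 0))\<^sup>2) / R"
    using R by (simp add: s_def norm_divide power_divide field_simps power2_eq_square)
  finally show ?thesis .
qed

lemma norm_sum_mult_le_euclid:
  "cmod (\<Sum>i<n. x i * y i) \<le> euclid_norm n x * euclid_norm n y"
proof -
  have "cmod (\<Sum>i<n. x i * y i) \<le> (\<Sum>i<n. \<bar>cmod (x i)\<bar> * \<bar>cmod (y i)\<bar>)"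
    by (rule order_trans[OF norm_sum]) (simp add: norm_mult)
  also have "\<dots> \<le> euclid_norm n x * euclid_norm n y" by (rule L2_set_mult_ineq)
  finally show ?thesis .
qed

text \<open>Pairing with the conjugate of \<open>d\<close> gives a scalar function with derivative
  \<open>|d|^2\<close>, bounded by \<open>|d| R\<close> through Cauchy-Schwarz, so the scalar
  estimate leaves \<open>|d| \<le> R\<close>.\<close>

lemma Schwarz_ball:
  assumes hol: "\<And>i. i < n \<Longrightarrow> (\<lambda>\<zeta>. z \<zeta> i) holomorphic_on ball 0 1"
    and lt: "\<And>\<zeta>. cmod \<zeta> < 1 \<Longrightarrow> euclid_norm n (z \<zeta>) < R"
    and z0: "\<And>i. i < n \<Longrightarrow> z 0 i = 0"
    and d: "\<And>i. i < n \<Longrightarrow> ((\<lambda>\<zeta>. z \<zeta> i) has_field_derivative d i) (at 0)"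
  shows "euclid_norm n d \<le> R"
proof (cases "euclid_norm n d = 0")
  case True
  have "0 \<le> euclid_norm n (z 0)" by (rule L2_set_nonneg)
  also have "\<dots> < R" using lt[of 0] by simp
  finally show ?thesis using True by simp
next
  case False
  define N where "N = euclid_norm n d"
  have N: "0 < N" unfolding N_def by (rule order_le_neq_trans[OF L2_set_nonneg False[symmetric]])
  have "0 \<le> euclid_norm n (z 0)" by (rule L2_set_nonneg)
  also have "\<dots> < R" using lt[of 0] by simp
  finally have R: "0 < R" .
  let ?h = "\<lambda>\<zeta>. \<Sum>i<n. cnj (d i) * z \<zeta> i"
  have "?h holomorphic_on ball 0 1" using hol by (intro holomorphic_intros) auto
  moreover have "cmod (?h \<zeta>) < N * R" if "cmod \<zeta> < 1" for \<zeta>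
  proof -
    have "cmod (?h \<zeta>) \<le> euclid_norm n (\<lambda>i. cnj (d i)) * euclid_norm n (z \<zeta>)" by (rule norm_sum_mult_le_euclid)
    also have "\<dots> < N * R" using lt[OF that] N by (simp add: N_def)
    finally show ?thesis .
  qed
  moreover have "0 < N * R" using N R by simp
  moreover have "(?h has_field_derivative (\<Sum>i<n. cnj (d i) * d i)) (at 0)"
    by (rule DERIV_sum) (use d in \<open>auto intro!: DERIV_cmult\<close>)
  ultimately have "cmod (\<Sum>i<n. cnj (d i) * d i) \<le> ((N * R)\<^sup>2 - (cmod (?h 0))\<^sup>2) / (N * R)"
    by (rule Schwarz_Pick_origin)
  moreover have "?h 0 = 0" using z0 by simp
  moreover have "(\<Sum>i<n. cnj (d i) * d i) = of_real (N\<^sup>2)"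
  proof -
    have "cnj (d i) * d i = of_real ((cmod (d i))\<^sup>2)" for i by (metis complex_norm_square mult.commute)
    then show ?thesis by (simp add: N_def L2_set_def sum_nonneg)
  qed
  ultimately have "N\<^sup>2 \<le> ((N * R)\<^sup>2 - (cmod 0)\<^sup>2) / (N * R)" by (simp only: norm_of_real abs_power2)
  also have "\<dots> = N * R" using N R by (simp add: power2_eq_square)
  finally have "N\<^sup>2 \<le> N * R" .
  then show ?thesis using N by (simp add: power2_eq_square N_def[symmetric])
qed

text \<open>The maximum over the compact disc is attained, hence still below \<open>R\<close>;
  taking it together with \<open>R / 2\<close> makes the bound positive.\<close>

lemma continuous_bound_cball:
  fixes \<phi> :: "complex \<Rightarrow> real"
  assumes "continuous_on (ball 0 1) \<phi>" "\<And>\<zeta>. cmod \<zeta> < 1 \<Longrightarrow> \<phi> \<zeta> < R" "0 < R" "0 < \<eta>" "\<eta> < 1"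
  shows "\<exists>\<rho>. 0 < \<rho> \<and> \<rho> < R \<and> (\<forall>\<zeta>\<in>cball 0 \<eta>. \<phi> \<zeta> \<le> \<rho>)"
proof -
  have "cball 0 \<eta> \<subseteq> ball (0::complex) 1" using assms by auto
  then have "continuous_on (cball 0 \<eta>) \<phi>" using assms(1) continuous_on_subset by blast
  then obtain x where x: "x \<in> cball 0 \<eta>" "\<And>y. y \<in> cball 0 \<eta> \<Longrightarrow> \<phi> y \<le> \<phi> x"
    using continuous_attains_sup[of "cball 0 \<eta>" \<phi>] assms(4) by auto
  have "\<phi> x < R" using x(1) assms by auto
  then show ?thesis
    by (intro exI[of _ "max (\<phi> x) (R / 2)"]) (use x(2) assms(3) in \<open>auto intro: max.coboundedI1\<close>)
qed

lemma holomorphic_disc_polydisk: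
  assumes R: "0 < R" and hol: "\<And>i. i < n \<Longrightarrow> (\<lambda>\<zeta>. z \<zeta> i) holomorphic_on ball 0 1"
    and lt: "\<And>\<zeta> i. cmod \<zeta> < 1 \<Longrightarrow> i < n \<Longrightarrow> cmod (z \<zeta> i) < R"
  shows "holomorphic_disc n (\<lambda>_. 1) (ereal R) z"
  unfolding holomorphic_disc_def
proof (intro conjI allI impI)
  fix \<eta> :: real assume \<eta>: "0 < \<eta> \<and> \<eta> < 1"
  have "\<exists>\<rho>. 0 < \<rho> \<and> \<rho> < R \<and> (\<forall>\<zeta>\<in>cball 0 \<eta>. cmod (z \<zeta> i) \<le> \<rho>)" if i: "i < n" for i
  proof -
    have "continuous_on (ball 0 1) (\<lambda>\<zeta>. cmod (z \<zeta> i))"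
      by (intro continuous_intros holomorphic_on_imp_continuous_on hol i)
    then show ?thesis by (rule continuous_bound_cball[OF _ lt[OF _ i] R]) (use \<eta> in auto)
  qed
  then obtain \<sigma> where \<sigma>: "\<And>i. i < n \<Longrightarrow> 0 < \<sigma> i \<and> \<sigma> i < R \<and> (\<forall>\<zeta>\<in>cball 0 \<eta>. cmod (z \<zeta> i) \<le> \<sigma> i)" by metis
  define \<rho> where "\<rho> = Max (insert (R / 2) (\<sigma> ` {..<n}))"
  have ge: "R / 2 \<le> \<rho>" "\<And>i. i < n \<Longrightarrow> \<sigma> i \<le> \<rho>" unfolding \<rho>_def by (rule Max_ge; simp)+
  have "\<rho> < R" unfolding \<rho>_def using \<sigma> R by (subst Max_less_iff) auto
  moreover have "cmod (monom_at n (z \<zeta>) k) \<le> 1 * 1 * \<rho> ^ mdeg n k" if "\<zeta> \<in> cball 0 \<eta>" for \<zeta> k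
  proof -
    have "cmod (z \<zeta> i) \<le> \<rho>" if "i < n" for i using \<sigma>[OF that] ge(2)[OF that] \<open>\<zeta> \<in> cball 0 \<eta>\<close> by force
    then have "(\<Prod>i<n. cmod (z \<zeta> i) ^ k i) \<le> (\<Prod>i<n. \<rho> ^ k i)"
      by (intro prod_mono conjI power_mono) auto
    then have "monom_at n (\<lambda>i. cmod (z \<zeta> i)) k \<le> \<rho> ^ mdeg n k"
      by (simp add: monom_at_def mdeg_def power_sum)
    then show ?thesis by (simp add: norm_monom_at)
  qed
  ultimately show "\<exists>C \<rho>. 0 < \<rho> \<and> ereal \<rho> < ereal R \<and>
       (\<forall>\<zeta>\<in>cball 0 \<eta>. \<forall>k\<in>mindices n. cmod (monom_at n (z \<zeta>) k) \<le> C * 1 * \<rho> ^ mdeg n k)"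
    using ge(1) R by (intro exI[of _ 1] exI[of _ \<rho>]) auto
qed (use hol in auto)

lemma holomorphic_disc_ball:
  assumes q: "cmod q = 1" and R: "0 < R" and hol: "\<And>i. i < n \<Longrightarrow> (\<lambda>\<zeta>. z \<zeta> i) holomorphic_on ball 0 1"
    and lt: "\<And>\<zeta>. cmod \<zeta> < 1 \<Longrightarrow> euclid_norm n (z \<zeta>) < R"
  shows "holomorphic_disc n (ball_wt n q) (ereal R) z"
  unfolding holomorphic_disc_def
proof (intro conjI allI impI)
  fix \<eta> :: real assume \<eta>: "0 < \<eta> \<and> \<eta> < 1"
  have "continuous_on (ball 0 1) (\<lambda>\<zeta>. euclid_norm n (z \<zeta>))"
    unfolding L2_set_def by (intro continuous_intros holomorphic_on_imp_continuous_on hol) auto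
  then have "\<exists>\<rho>. 0 < \<rho> \<and> \<rho> < R \<and> (\<forall>\<zeta>\<in>cball 0 \<eta>. euclid_norm n (z \<zeta>) \<le> \<rho>)"
    by (rule continuous_bound_cball[OF _ lt R]) (use \<eta> in auto)
  then obtain \<rho> where \<rho>: "0 < \<rho>" "\<rho> < R" "\<And>\<zeta>. \<zeta> \<in> cball 0 \<eta> \<Longrightarrow> euclid_norm n (z \<zeta>) \<le> \<rho>"
    by blast
  have "cmod (monom_at n (z \<zeta>) k) \<le> 1 * ball_wt n q k * \<rho> ^ mdeg n k"
    if "\<zeta> \<in> cball 0 \<eta>" "k \<in> mindices n" for \<zeta> k
  proof -
    have "0 < ball_wt n q k" using q by (intro ball_wt_pos) auto
    then show ?thesis
      using order_trans[OF monom_at_le_ball_wt[OF q that(2), of "z \<zeta>"] mult_left_mono[OF power_mono[OF \<rho>(3)[OF that(1)]]]]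
      by simp
  qed
  then show "\<exists>C \<rho>. 0 < \<rho> \<and> ereal \<rho> < ereal R \<and>
       (\<forall>\<zeta>\<in>cball 0 \<eta>. \<forall>k\<in>mindices n. cmod (monom_at n (z \<zeta>) k) \<le> C * ball_wt n q k * \<rho> ^ mdeg n k)"
    using \<rho> by (intro exI[of _ 1] exI[of _ \<rho>]) auto
qed (use hol in auto)

text \<open>Disc automorphisms attain equality in \<open>Schwarz_Pick_origin\<close>, so they give
  discs through a prescribed point with the largest possible derivative.\<close>

lemma disc_automorphism:
  assumes R: "0 < R" and p: "cmod p < R"
  obtains m where "m holomorphic_on ball 0 1" "\<And>\<zeta>. cmod \<zeta> < 1 \<Longrightarrow> cmod (m \<zeta>) < R" "m 0 = p"
    "(m has_field_derivative of_real ((R\<^sup>2 - (cmod p)\<^sup>2) / R)) (at 0)"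
proof
  \<comment> \<open>The sign is due to \<open>Moebius_function 0 s\<close> sending 0 to
    \<open>- s\<close>.\<close>
  define s where "s = - p / of_real R"
  have s1: "cmod s < 1" using p R by (simp add: s_def norm_divide)
  let ?m = "\<lambda>\<zeta>. of_real R * Moebius_function 0 s \<zeta>"
  show "?m holomorphic_on ball 0 1" by (intro holomorphic_intros Moebius_function_holomorphic s1)
  show "cmod (?m \<zeta>) < R" if "cmod \<zeta> < 1" for \<zeta>
    using Moebius_function_norm_lt_1[OF s1 that] R by (simp add: norm_mult)
  show "?m 0 = p" using R by (simp add: Moebius_function_simple s_def)
  have ss: "cnj s * s = of_real ((cmod s)\<^sup>2)" by (metis complex_norm_square mult.commute)
  have "(?m has_field_derivative of_real R * (1 - cnj s * s)) (at 0)"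
    unfolding Moebius_function_simple by (auto intro!: derivative_eq_intros simp: algebra_simps)
  moreover have "of_real R * (1 - cnj s * s) = complex_of_real ((R\<^sup>2 - (cmod p)\<^sup>2) / R)"
  proof -
    have "R * (1 - (cmod s)\<^sup>2) = (R\<^sup>2 - (cmod p)\<^sup>2) / R"
      using R by (simp add: s_def norm_divide power_divide field_simps power2_eq_square)
    then show ?thesis unfolding ss by (metis of_real_1 of_real_diff of_real_mult)
  qed
  ultimately show "(?m has_field_derivative of_real ((R\<^sup>2 - (cmod p)\<^sup>2) / R)) (at 0)" by simp
qed

lemma euclid_parallelogram:
  "(euclid_norm n (\<lambda>i. x i + y i))\<^sup>2 + (euclid_norm n (\<lambda>i. x i - y i))\<^sup>2 =
    2 * (euclid_norm n x)\<^sup>2 + 2 * (euclid_norm n y)\<^sup>2"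
proof -
  have sq: "(euclid_norm n z)\<^sup>2 = (\<Sum>i<n. (cmod (z i))\<^sup>2)" for z
    by (simp add: L2_set_def sum_nonneg)
  have "(cmod (u + v))\<^sup>2 + (cmod (u - v))\<^sup>2 = 2 * (cmod u)\<^sup>2 + 2 * (cmod v)\<^sup>2" for u v
    unfolding cmod_power2 by (simp add: power2_eq_square algebra_simps)
  then show ?thesis unfolding sq sum.distrib[symmetric] sum_distrib_left by simp
qed

section \<open>The two Schwarz estimates and the parallelogram law\<close>

context unimodular_iso
begin

lemma polydisk_point: "domain_point n (\<lambda>_. 1) (ereal R) z \<longleftrightarrow> (\<forall>i<n. cmod (z i) < R)"
  by (rule domain_point_polydisk[OF R])

lemma ball_point: "domain_point n (ball_wt n q) (ereal R) z \<longleftrightarrow> euclid_norm n z < R"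
  by (rule domain_point_ball[OF q R])

text \<open>Coordinates of the image of the centre of the ball under the map into the polydisk that
  \<open>f\<close> induces when \<open>q = 1\<close>.\<close>

abbreviation base_point :: "nat \<Rightarrow> complex" where
  "base_point i \<equiv> f (gen_ser i) (\<lambda>_. 0)"

text \<open>By Schwarz-Pick, the largest derivative at 0 of a holomorphic map from the unit disc
  into the disc of radius \<open>R\<close> that sends 0 to \<open>base_point i\<close>.\<close>

abbreviation conformal_factor :: "nat \<Rightarrow> real" where
  "conformal_factor i \<equiv> (R\<^sup>2 - (cmod (base_point i))\<^sup>2) / R"

lemma ball_point_image:
  assumes "q = 1" "euclid_norm n z < R" "i < n"
  shows "cmod (eval_at n z (f (gen_ser i))) < R"
  using F.pullback_point(1)[OF assms(1) ball_point[THEN iffD2, OF assms(2)]] assms(3)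
  unfolding polydisk_point by blast

lemma base_point_bound:
  assumes "q = 1" "i < n" shows "cmod (base_point i) < R"
  using ball_point_image[of "\<lambda>_. 0", OF assms(1) _ assms(2)] R
  by (simp add: eval_at_origin L2_set_def)

text \<open>Schwarz-Pick is applied to the \<open>i\<close>-th coordinate of the induced map along
  the linear disc of the ball in the direction of \<open>v\<close>, scaled to reach the boundary
  sphere.\<close>

lemma lin_bound:
  assumes q1: "q = 1" and i: "i < n"
  shows "R * cmod (\<Sum>s<n. F.lin i s * v s) \<le> conformal_factor i * euclid_norm n v"
proof (cases "euclid_norm n v = 0")
  case True
  then have "v s = 0" if "s < n" for s using that by (simp add: L2_set_eq_0_iff)
  then show ?thesis using True by simp
next
  case False
  define N where "N = euclid_norm n v"
  have N: "0 < N" unfolding N_def by (rule order_le_neq_trans[OF L2_set_nonneg False[symmetric]])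
  let ?z = "\<lambda>\<zeta> s. \<zeta> * (of_real (R / N) * v s)"
  have lt: "euclid_norm n (?z \<zeta>) < R" if "cmod \<zeta> < 1" for \<zeta>
  proof -
    have "euclid_norm n (?z \<zeta>) = cmod \<zeta> * (R / N) * N"
      unfolding N_def using R N by (subst L2_set_right_distrib) (auto simp: norm_mult norm_divide N_def mult_ac intro!: L2_set_cong)
    also have "\<dots> < R" using N R that by simp
    finally show ?thesis .
  qed
  have disc: "holomorphic_disc n (ball_wt n q) (ereal R) ?z"
    by (rule holomorphic_disc_ball[OF q R _ lt]) (intro holomorphic_intros)
  let ?h = "\<lambda>\<zeta>. eval_at n (?z \<zeta>) (f (gen_ser i))"
  note fi = F.closed[OF F.W.series_gen[OF i]]
  have "?h holomorphic_on ball 0 1" by (rule F.V.eval_disc_holomorphic[OF disc fi])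
  moreover have "cmod (?h \<zeta>) < R" if "cmod \<zeta> < 1" for \<zeta>
    by (rule ball_point_image[OF q1 lt[OF that] i])
  moreover have "(?h has_field_derivative (\<Sum>s<n. F.lin i s * (of_real (R / N) * v s))) (at 0)"
    by (rule F.V.eval_disc_derivative_origin[OF disc fi]) (use N in \<open>auto intro!: derivative_eq_intros\<close>)
  ultimately have "cmod (\<Sum>s<n. F.lin i s * (of_real (R / N) * v s)) \<le> (R\<^sup>2 - (cmod (?h 0))\<^sup>2) / R"
    by (intro Schwarz_Pick_origin R)
  moreover have "?h 0 = base_point i" by (simp add: eval_at_origin)
  moreover have "(\<Sum>s<n. F.lin i s * (of_real (R / N) * v s)) = of_real (R / N) * (\<Sum>s<n. F.lin i s * v s)"
    unfolding sum_distrib_left by (intro sum.cong) (simp_all only: mult_ac)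
  ultimately have "R / N * cmod (\<Sum>s<n. F.lin i s * v s) \<le> conformal_factor i"
    using R N by (simp add: norm_mult norm_divide)
  then show ?thesis using N by (simp add: N_def[symmetric] field_simps)
qed

text \<open>The reverse estimate. The disc in the polydisk through \<open>base_point\<close> with
  derivatives \<open>conformal_factor i * u i\<close> is carried by the map that \<open>g\<close>
  induces to a disc in the ball starting at the centre. \<open>Schwarz_ball\<close> bounds its
  derivative \<open>c\<close>, and the map induced by \<open>f\<close> returns the original
  disc.\<close>

lemma lin_realizes:
  assumes q1: "q = 1" and u: "\<And>i. i < n \<Longrightarrow> cmod (u i) \<le> 1"
  obtains c where "euclid_norm n c \<le> R"
    "\<And>i. i < n \<Longrightarrow> (\<Sum>s<n. F.lin i s * c s) = of_real (conformal_factor i) * u i"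
proof -
  have "\<exists>m. m holomorphic_on ball 0 1 \<and> (\<forall>\<zeta>. cmod \<zeta> < 1 \<longrightarrow> cmod (m \<zeta>) < R) \<and> m 0 = base_point i \<and>
      (m has_field_derivative of_real (conformal_factor i)) (at 0)" if "i < n" for i
    using disc_automorphism[OF R base_point_bound[OF q1 that]] by metis
  then obtain m where m: "\<And>i. i < n \<Longrightarrow> m i holomorphic_on ball 0 1 \<and>
      (\<forall>\<zeta>. cmod \<zeta> < 1 \<longrightarrow> cmod (m i \<zeta>) < R) \<and> m i 0 = base_point i \<and>
      (m i has_field_derivative of_real (conformal_factor i)) (at 0)" by metis
  let ?w = "\<lambda>\<zeta> i. m i (u i * \<zeta>)" and ?G = "\<lambda>\<zeta> s. eval_at n (\<lambda>i. m i (u i * \<zeta>)) (g (gen_ser s))"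
  have u\<zeta>: "cmod (u i * \<zeta>) < 1" if "cmod \<zeta> < 1" "i < n" for \<zeta> i
    using mult_right_mono[OF u[OF that(2)], of "cmod \<zeta>"] that(1) by (simp add: norm_mult)
  have wlt: "cmod (?w \<zeta> i) < R" if "cmod \<zeta> < 1" "i < n" for \<zeta> i
    using m[OF that(2)] u\<zeta>[OF that] by blast
  have whol: "(\<lambda>\<zeta>. ?w \<zeta> i) holomorphic_on ball 0 1" if i: "i < n" for i
  proof -
    have "(m i \<circ> (\<lambda>\<zeta>. u i * \<zeta>)) holomorphic_on ball 0 1"
      by (rule holomorphic_on_compose_gen[where t = "ball 0 1"])
         (use m[OF i] u\<zeta>[OF _ i] in \<open>auto intro!: holomorphic_intros\<close>)
    then show ?thesis by (simp add: comp_def)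
  qed
  have wdisc: "holomorphic_disc n (\<lambda>_. 1) (ereal R) ?w"
    by (rule holomorphic_disc_polydisk[OF R whol wlt])
  have wpt: "domain_point n (\<lambda>_. 1) (ereal R) (?w \<zeta>)" if "cmod \<zeta> < 1" for \<zeta>
    unfolding polydisk_point using wlt[OF that] by blast
  have Glt: "euclid_norm n (?G \<zeta>) < R" if "cmod \<zeta> < 1" for \<zeta>
    using G.pullback_point(1)[OF q1 wpt[OF that]] unfolding ball_point .
  have Ghol: "(\<lambda>\<zeta>. ?G \<zeta> s) holomorphic_on ball 0 1" if s: "s < n" for s
    by (rule F.W.eval_disc_holomorphic[OF wdisc G.closed[OF F.V.series_gen[OF s]]])
  have Gdisc: "holomorphic_disc n (ball_wt n q) (ereal R) ?G"
    by (rule holomorphic_disc_ball[OF q R Ghol Glt])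
  \<comment> \<open>\<open>base_point\<close> is the pullback of the centre along \<open>f\<close>,
    so evaluating \<open>g (gen_ser s)\<close> there is evaluating \<open>f (g (gen_ser s))\<close>,
    a coordinate, at the centre.\<close>
  have G0: "?G 0 s = 0" if s: "s < n" for s
  proof -
    have "euclid_norm n (\<lambda>_. 0) < R" using R by (simp add: L2_set_def)
    then have o: "domain_point n (ball_wt n q) (ereal R) (\<lambda>_. 0)" unfolding ball_point .
    have "?G 0 s = eval_at n base_point (g (gen_ser s))"
      by (rule eval_at_cong) (use m in simp)
    also have "\<dots> = eval_at n (\<lambda>_. 0) (f (g (gen_ser s)))"
      using F.pullback_point(2)[OF q1 o G.closed[OF F.V.series_gen[OF s]]]
      unfolding eval_at_origin by (rule sym)
    also have "\<dots> = 0" unfolding fg[OF F.V.series_gen[OF s]] by (simp add: eval_at_gen s)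
    finally show ?thesis .
  qed
  let ?c = "\<lambda>s. deriv (\<lambda>\<zeta>. ?G \<zeta> s) 0"
  have Gder: "((\<lambda>\<zeta>. ?G \<zeta> s) has_field_derivative ?c s) (at 0)" if "s < n" for s
    by (rule holomorphic_derivI[OF Ghol[OF that] open_ball]) simp
  show ?thesis
  proof (rule that[of ?c])
    show "euclid_norm n ?c \<le> R" by (rule Schwarz_ball[OF Ghol Glt G0 Gder])
    fix i assume i: "i < n"
    have 1: "((\<lambda>\<zeta>. eval_at n (?G \<zeta>) (f (gen_ser i))) has_field_derivative (\<Sum>s<n. F.lin i s * ?c s)) (at 0)"
      by (rule F.V.eval_disc_derivative_origin[OF Gdisc F.closed[OF F.W.series_gen[OF i]] G0 Gder])
    have eq: "eval_at n (?G \<zeta>) (f (gen_ser i)) = ?w \<zeta> i" if "cmod \<zeta> < 1" for \<zeta>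
      unfolding G.pullback_point(2)[OF q1 wpt[OF that] F.closed[OF F.W.series_gen[OF i]], symmetric]
        gf[OF F.W.series_gen[OF i]] eval_at_gen[OF i] ..
    have "((\<lambda>\<zeta>. u i * \<zeta>) has_field_derivative u i) (at 0)" by (auto intro!: derivative_eq_intros)
    moreover have "(m i has_field_derivative of_real (conformal_factor i)) (at (u i * 0))" using m[OF i] by simp
    ultimately have 2: "((\<lambda>\<zeta>. ?w \<zeta> i) has_field_derivative of_real (conformal_factor i) * u i) (at 0)"
      by (rule DERIV_chain2[rotated])
    have "((\<lambda>\<zeta>. eval_at n (?G \<zeta>) (f (gen_ser i))) has_field_derivative of_real (conformal_factor i) * u i) (at 0)"
      by (rule has_field_derivative_transform_within_open[OF 2 open_ball[of 0 1]]) (use eq in auto)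
    with 1 show "(\<Sum>s<n. F.lin i s * ?c s) = of_real (conformal_factor i) * u i" by (rule DERIV_unique)
  qed
qed

text \<open>The vectors \<open>c\<close> and \<open>d\<close>, of norm at most \<open>R\<close>,
  realize the sign vectors \<open>(1, 1, ...)\<close> and \<open>(1, -1, 1, ...)\<close>. Their sum
  doubles coordinate 0 and their difference coordinate 1, so by \<open>lin_bound\<close> both have
  norm at least \<open>2 * R\<close>, and the parallelogram law gives
  \<open>8 * R^2 \<le> 4 * R^2\<close>.\<close>

lemma commutative_contradiction:
  assumes q1: "q = 1" shows False
proof -
  have i: "0 < n" "1 < n" using n2 by auto
  obtain c where c: "euclid_norm n c \<le> R"
    "\<And>i. i < n \<Longrightarrow> (\<Sum>s<n. F.lin i s * c s) = of_real (conformal_factor i) * 1"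
    using lin_realizes[OF q1, of "\<lambda>_. 1"] by auto
  define u where "u = (\<lambda>i::nat. if i = 1 then - 1 else 1 :: complex)"
  have u: "u 0 = 1" "u 1 = - 1" by (simp_all add: u_def)
  have "cmod (u i) \<le> 1" for i by (simp add: u_def)
  then obtain d where d: "euclid_norm n d \<le> R"
    "\<And>i. i < n \<Longrightarrow> (\<Sum>s<n. F.lin i s * d s) = of_real (conformal_factor i) * u i"
    using lin_realizes[OF q1, of u] by blast
  have pos: "0 < conformal_factor i" if "i < n" for i
    using base_point_bound[OF q1 that] R by (simp add: power_strict_mono)
  have big: "2 * R \<le> euclid_norm n v"
    if "i < n" "(\<Sum>s<n. F.lin i s * v s) = of_real (2 * conformal_factor i)" for v i
  proof -
    have "0 \<le> 2 * conformal_factor i" using pos[OF that(1)] by linarith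
    then have "R * (2 * conformal_factor i) \<le> conformal_factor i * euclid_norm n v"
      using lin_bound[OF q1 that(1), of v] unfolding that(2) norm_of_real by (simp only: abs_of_nonneg)
    then have "conformal_factor i * (2 * R) \<le> conformal_factor i * euclid_norm n v" by (simp only: mult_ac)
    then show ?thesis by (rule mult_left_le_imp_le[OF _ pos[OF that(1)]])
  qed
  have "2 * R \<le> euclid_norm n (\<lambda>s. c s + d s)"
    by (rule big[OF i(1)], unfold distrib_left sum.distrib c(2)[OF i(1)] d(2)[OF i(1)] u)
       (simp only: mult_1_right mult_2 of_real_add)
  moreover have "2 * R \<le> euclid_norm n (\<lambda>s. c s - d s)"
    by (rule big[OF i(2)], unfold right_diff_distrib sum_subtractf c(2)[OF i(2)] d(2)[OF i(2)] u)
       (simp only: mult_1_right mult_minus_right diff_minus_eq_add mult_2 of_real_add)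
  ultimately have "(2 * R)\<^sup>2 + (2 * R)\<^sup>2 \<le> 2 * (euclid_norm n c)\<^sup>2 + 2 * (euclid_norm n d)\<^sup>2"
    unfolding euclid_parallelogram[symmetric] using R by (intro add_mono power_mono) auto
  also have "\<dots> \<le> 2 * R\<^sup>2 + 2 * R\<^sup>2" using c(1) d(1) by (intro add_mono mult_left_mono power_mono) auto
  finally show False using R by (simp add: power2_eq_square)
qed

end

section \<open>Assembly of the two halves of the theorem\<close>

lemma polydisk_not_isomorphic_ball:
  assumes n: "2 \<le> n" and r: "0 < r" "r < \<infinity>" and q: "cmod q = 1"
  shows "\<not> top_isomorphic (q_polydisk n q r) (q_ball n q r)"
proof
  assume iso: "top_isomorphic (q_polydisk n q r) (q_ball n q r)"
  obtain R where R: "r = ereal R" "0 < R" using r by (cases r) auto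
  have q0: "q \<noteq> 0" using q by auto
  have pw: "positive_weight n (\<lambda>_. 1) (ereal R)" "positive_weight n (ball_wt n q) (ereal R)"
    using positive_weight_polydisk[OF q0, of "ereal R" n] positive_weight_ball[OF q0, of "ereal R" n] R
    by (auto simp: polydisk_wt_unimodular[OF q])
  have "top_isomorphic (wt_algebra n q (\<lambda>_. 1) (ereal R)) (wt_algebra n q (ball_wt n q) (ereal R))"
    using iso unfolding q_polydisk_def q_ball_def polydisk_wt_unimodular[OF q] R(1) .
  from top_isomorphic_imp_wt_homs[OF pw q_mult_closed_polydisk[OF q] this]
  obtain f g where "wt_hom n (\<lambda>_. 1) (ball_wt n q) (ereal R) q f" "wt_hom n (ball_wt n q) (\<lambda>_. 1) (ereal R) q g"
    "\<And>a. a \<in> wt_series n (\<lambda>_. 1) (ereal R) \<Longrightarrow> g (f a) = a"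
    "\<And>b. b \<in> wt_series n (ball_wt n q) (ereal R) \<Longrightarrow> f (g b) = b" by metis
  then have "unimodular_iso n q R f g"
    unfolding unimodular_iso_def unimodular_iso_axioms_def using n R(2) q by blast
  then show False
    using unimodular_iso.noncommutative_contradiction unimodular_iso.commutative_contradiction by blast
qed

theorem theorem8p1:
  fixes n :: nat and r :: ereal and q :: complex
  assumes "n \<ge> 1" and "0 < r" and "q \<noteq> 0"
  shows "(n \<ge> 2 \<and> r < \<infinity> \<and> cmod q = 1 \<longrightarrow>
            \<not> top_isomorphic (q_polydisk n q r) (q_ball n q r)) \<and>
         (cmod q \<noteq> 1 \<longrightarrow>
            top_isomorphic (q_polydisk n q r) (q_ball n q r) \<and>
            q_polydisk n q r = q_ball n q r)"
  using polydisk_not_isomorphic_ball[of n r q] polydisk_eq_ball[of q r n]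
    top_isomorphic_refl[of "q_ball n q r"] assms by auto

end
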